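(* Let $B$ be a standard Brownian motion started at $0$ and $t>0$. The $\zeta$-function of the process $|B|$ on $[0,t]$ is $$\zeta_{|B|}(p)=\frac{2^{1-\frac p2}(2^p-2)\,t^{\frac p2}}{\sqrt\pi}\,\Gamma\!\left(\frac{p+1}2\right)\zeta(p-1),$$ which has a unique pole at $p=2$, of residue $t$.
   Context: $\zeta$ is the Riemann zeta function. For a continuous process $X$ and $\varepsilon>0$, put $S_0^\varepsilon=T_0^\varepsilon=0$ and $T_{i+1}^\varepsilon=\inf\{u\ge S_i^\varepsilon:\sup_{[S_i^\varepsilon,u]}X-X_u>\varepsilon\}$, $S_{i+1}^\varepsilon=\inf\{u\ge T_{i+1}^\varepsilon:X_u-\inf_{[T_{i+1}^\varepsilon,u]}X>\varepsilon\}$. With $R_t=\sup_{[0,t]}X-\inf_{[0,t]}X$, $N_t^\varepsilon=\mathbf{1}_{\{R_t\ge\varepsilon\}}+\max\{k\ge0:S_k^\varepsilon\le t\}$ is the number of bars of length $\ge\varepsilon$ in the $H_0$ superlevel-set barcode of $X|_{[0,t]}$ (infinite bar given length $R_t$). The $\zeta$-function of $X$ on $[0,t]$ is $\zeta_X(p)=p\int_0^\infty\varepsilon^{p-1}\,\mathbb{E}[N_t^\varepsilon]\,d\varepsilon$ where the integral converges (here $\mathrm{Re}(p)>2$), extended meromorphically. Here $X=|B|$. *)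

theory Defs
  imports "HOL-Probability.Probability" "HOL-Complex_Analysis.Complex_Analysis"
begin

section \<open>Meromorphic continuation and the Riemann zeta function\<close>

text \<open>
  The meromorphic continuation to the whole plane of a function \<open>g\<close> given on \<open>D\<close>.
  \<open>nicely_meromorphic_on\<close> is the library's normal form for meromorphic functions
  (value 0 at poles, removable singularities removed). It makes the continuation unique as
  a function as soon as \<open>D\<close> contains a nonempty open set; see
  \<open>meromorphic_continuation_eqI\<close> below.
\<close>

definition meromorphic_continuation ::
    "complex set \<Rightarrow> (complex \<Rightarrow> complex) \<Rightarrow> complex \<Rightarrow> complex" where
  "meromorphic_continuation D g =
     (THE f. f nicely_meromorphic_on UNIV \<and> (\<forall>z\<in>D. f z = g z))"

lemma nicely_meromorphic_on_UNIV_unique: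
  fixes f g :: "complex \<Rightarrow> complex"
  assumes f: "f nicely_meromorphic_on UNIV" and g: "g nicely_meromorphic_on UNIV"
    and U: "open U" "U \<noteq> {}" and eq: "\<And>z. z \<in> U \<Longrightarrow> f z = g z"
  shows "f = g"
proof -
  have mf: "f meromorphic_on UNIV" and mg: "g meromorphic_on UNIV"
    using f g by (auto simp: nicely_meromorphic_on_def)
  have "(\<forall>\<^sub>\<approx>z\<in>UNIV. f z - g z = 0) \<or> (\<forall>\<^sub>\<approx>z\<in>UNIV. f z - g z \<noteq> 0)"
    by (rule meromorphic_imp_constant_or_avoid) (auto intro!: meromorphic_intros mf mg)
  moreover have "\<not> (\<forall>\<^sub>\<approx>z\<in>UNIV. f z - g z \<noteq> 0)"
  proof
    assume ev: "\<forall>\<^sub>\<approx>z\<in>UNIV. f z - g z \<noteq> 0"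
    obtain w where w: "w \<in> U" using U by blast
    have "\<forall>\<^sub>F z in at w. f z - g z \<noteq> 0"
      using ev by (auto simp: eventually_cosparse_open_eq)
    moreover have "\<forall>\<^sub>F z in at w. z \<in> U"
      using U w by (intro eventually_at_in_open') auto
    ultimately have "\<forall>\<^sub>F z in at w. False"
      by eventually_elim (use eq in auto)
    thus False by simp
  qed
  ultimately have ev: "\<forall>\<^sub>\<approx>z\<in>UNIV. f z - g z = 0" by blast
  show "f = g"
  proof
    fix z
    have ev_z: "\<forall>\<^sub>F w in at z. f w = g w"
      using ev by (auto simp: eventually_cosparse_open_eq)
    have pole: "is_pole f z \<longleftrightarrow> is_pole g z"
      by (rule is_pole_cong) (use ev_z in auto)
    show "f z = g z"
    proof (cases "is_pole f z")
      case True
      hence "\<not> f \<midarrow>z\<rightarrow> f z" "\<not> g \<midarrow>z\<rightarrow> g z"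
        using pole not_tendsto_and_filterlim_at_infinity[of "at z"]
        by (auto simp: is_pole_def)
      thus ?thesis using f g unfolding nicely_meromorphic_on_def by (metis UNIV_I)
    next
      case False
      hence "f \<midarrow>z\<rightarrow> f z" "g \<midarrow>z\<rightarrow> g z"
        using f g pole by (auto simp: nicely_meromorphic_on_def)
      moreover from this have "f \<midarrow>z\<rightarrow> g z"
        using tendsto_cong[OF ev_z] by blast
      ultimately show ?thesis using LIM_unique by blast
    qed
  qed
qed

lemma meromorphic_continuation_eqI:
  assumes "f nicely_meromorphic_on UNIV" "\<And>z. z \<in> D \<Longrightarrow> f z = g z"
    and "open U" "U \<noteq> {}" "U \<subseteq> D"
  shows "meromorphic_continuation D g = f"
  unfolding meromorphic_continuation_def
  by (rule the_equality)
    (use assms in \<open>auto intro!: nicely_meromorphic_on_UNIV_unique[of _ _ U] simp: subset_iff\<close>)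

definition riemann_zeta :: "complex \<Rightarrow> complex" where
  "riemann_zeta =
     meromorphic_continuation {s. Re s > 1} (\<lambda>s. \<Sum>n. 1 / (of_nat (Suc n) powr s))"


section \<open>Brownian motion\<close>

locale standard_brownian_motion = prob_space M for M :: "'a measure" +
  fixes B :: "real \<Rightarrow> 'a \<Rightarrow> real"
  assumes measurable_BM: "\<And>s. 0 \<le> s \<Longrightarrow> B s \<in> borel_measurable M"
    and start_BM: "AE \<omega> in M. B 0 \<omega> = 0"
    and continuous_BM: "\<And>\<omega>. \<omega> \<in> space M \<Longrightarrow> continuous_on {0..} (\<lambda>s. B s \<omega>)"
    and indep_increments_BM:
      "\<And>(n::nat) \<tau>. 0 \<le> \<tau> 0 \<Longrightarrow> (\<And>i. i < n \<Longrightarrow> \<tau> i < \<tau> (Suc i)) \<Longrightarrow>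
         indep_vars (\<lambda>_. borel) (\<lambda>i \<omega>. B (\<tau> (Suc i)) \<omega> - B (\<tau> i) \<omega>) {..<n}"
    and gaussian_increments_BM:
      "\<And>s u. 0 \<le> s \<Longrightarrow> s < u \<Longrightarrow>
         distributed M lborel (\<lambda>\<omega>. B u \<omega> - B s \<omega>) (normal_density 0 (sqrt (u - s)))"


section \<open>Bars of a path and the zeta function of a process\<close>

text \<open>
  Paths \<open>x\<close> are only used on \<open>[0,\<infinity>)\<close>. Hitting times take values in \<^typ>\<open>ereal\<close>, so that the
  infimum of the empty set is \<open>\<infinity>\<close>; in particular both functions map \<open>\<infinity>\<close> to \<open>\<infinity>\<close>.
\<close>

definition drop_time :: "(real \<Rightarrow> real) \<Rightarrow> real \<Rightarrow> ereal \<Rightarrow> ereal" where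
  "drop_time x \<epsilon> s =
     Inf {ereal u | u. s \<le> ereal u \<and> (SUP v\<in>{v. s \<le> ereal v \<and> v \<le> u}. x v) - x u > \<epsilon>}"

definition rise_time :: "(real \<Rightarrow> real) \<Rightarrow> real \<Rightarrow> ereal \<Rightarrow> ereal" where
  "rise_time x \<epsilon> s =
     Inf {ereal u | u. s \<le> ereal u \<and> x u - (INF v\<in>{v. s \<le> ereal v \<and> v \<le> u}. x v) > \<epsilon>}"

text \<open>\<open>bar_time x \<epsilon> i\<close> is $S_i^\varepsilon$, and \<open>drop_time x \<epsilon> (bar_time x \<epsilon> i)\<close> is $T_{i+1}^\varepsilon$.\<close>

primrec bar_time :: "(real \<Rightarrow> real) \<Rightarrow> real \<Rightarrow> nat \<Rightarrow> ereal" where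
  "bar_time x \<epsilon> 0 = 0"
| "bar_time x \<epsilon> (Suc i) = rise_time x \<epsilon> (drop_time x \<epsilon> (bar_time x \<epsilon> i))"

definition path_range :: "(real \<Rightarrow> real) \<Rightarrow> real \<Rightarrow> real" where
  "path_range x t = (SUP s\<in>{0..t}. x s) - (INF s\<in>{0..t}. x s)"

definition num_bars :: "(real \<Rightarrow> real) \<Rightarrow> real \<Rightarrow> real \<Rightarrow> nat" where
  "num_bars x t \<epsilon> = of_bool (path_range x t \<ge> \<epsilon>) + Max {k. bar_time x \<epsilon> k \<le> ereal t}"

definition expected_bars :: "'a measure \<Rightarrow> (real \<Rightarrow> 'a \<Rightarrow> real) \<Rightarrow> real \<Rightarrow> real \<Rightarrow> real" where
  "expected_bars M X t \<epsilon> = (\<integral>\<omega>. real (num_bars (\<lambda>s. X s \<omega>) t \<epsilon>) \<partial>M)"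

text \<open>
  The set of \<open>p\<close> where the defining integral converges absolutely. Integrability of the number
  of bars is required because Bochner integrals of non-integrable functions are 0.
\<close>

definition zeta_domain :: "'a measure \<Rightarrow> (real \<Rightarrow> 'a \<Rightarrow> real) \<Rightarrow> real \<Rightarrow> complex set" where
  "zeta_domain M X t =
     {p. (\<forall>\<epsilon>>0. integrable M (\<lambda>\<omega>. real (num_bars (\<lambda>s. X s \<omega>) t \<epsilon>))) \<and>
         set_integrable lborel {0<..}
           (\<lambda>\<epsilon>. of_real \<epsilon> powr (p - 1) * of_real (expected_bars M X t \<epsilon>))}"

definition zeta_integral ::
    "'a measure \<Rightarrow> (real \<Rightarrow> 'a \<Rightarrow> real) \<Rightarrow> real \<Rightarrow> complex \<Rightarrow> complex" where
  "zeta_integral M X t p =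
     p * (LINT \<epsilon>:{0<..}|lborel. of_real \<epsilon> powr (p - 1) * of_real (expected_bars M X t \<epsilon>))"

definition process_zeta ::
    "'a measure \<Rightarrow> (real \<Rightarrow> 'a \<Rightarrow> real) \<Rightarrow> real \<Rightarrow> complex \<Rightarrow> complex" where
  "process_zeta M X t = meromorphic_continuation (zeta_domain M X t) (zeta_integral M X t)"

end

theory Submission
  imports Defs
begin

text \<open>
  On a dyadic grid the increments of \<open>B\<close> are independent centred Gaussians, so that multiplying
  each of them by a sign depending only on the past does not change their joint law. Split a
  Gaussian walk into stages, each ending when the walk has left the interval of radius \<open>\<epsilon>\<close>
  around the position where the stage began. One choice of signs, a discrete version of the
  theorems of Levy and Tanaka, turns the walk into a walk \<open>V\<close> for which \<open>\<bar>V\<bar>\<close> rises by \<open>\<epsilon>\<close>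
  above its minimum over the stage in the even stages and falls by \<open>\<epsilon>\<close> below its maximum in the
  odd ones, up to the step size. Hence the number of bars of \<open>\<bar>V\<bar>\<close> is \<open>(m + 1) div 2\<close>, where \<open>m\<close>
  is the number of completed stages. Signs that are constant on each stage instead turn the
  endpoint into \<open>\<epsilon> z + q \<bar>u\<bar>\<close>, where \<open>z\<close> is a sum of \<open>m\<close> signs and \<open>u\<close> is the displacement in
  the unfinished stage, and the average over all signs of \<open>G(w) = 2 \<lfloor>(\<lfloor>\<bar>w\<bar>/\<epsilon>\<rfloor> + 1)/2\<rfloor>\<^sup>2\<close> at
  this endpoint \<open>w\<close> is again \<open>(m + 1) div 2\<close>. Comparing the two, with a slight change of \<open>\<epsilon>\<close> to
  absorb the overshoots, gives \<open>E N_t = E G(B_t)\<close> for almost all \<open>\<epsilon>\<close>.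

  Since \<open>G(w)\<close> is the sum of \<open>2 n\<close> over the odd \<open>n \<le> \<bar>w\<bar>/\<epsilon>\<close>, its Mellin transform is an absolute
  Gaussian moment times the sum of \<open>n powr (1 - p)\<close> over odd \<open>n\<close>. Finally \<open>F(s) = (s - 1) \<zeta>(s)\<close>
  is continued by a recursion that expresses \<open>F(s)\<close> through the values \<open>F(s + 2k + 2)\<close>; it also
  yields the trivial zeros, which cancel the poles of the Gamma factor.
\<close>

section \<open>The coupling of a walk with an absolute value\<close>

text \<open>The locale offers only independent Gaussian increments at fixed times, so strong Markov,
  reflection and local time arguments for \<open>B\<close> are replaced by changes of variables on a
  grid. The same stages serve twice: for the bars, a functional of the whole path, and for the
  endpoint. The averaging succeeds because z has mean square m and is uncorrelated with the sign of
  the unfinished stage, while G at the endpoint is z^2/2 for even m and (z^2 + 1)/2 plus z times a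
  multiple of that sign for odd m.

  The obstacle is the overshoot, up to one step in every stage. A second moment bound, uniform in
  the mesh, keeps the number of stages below A outside a set of probability O(1/A); only then is the
  step bound \<delta> chosen small compared with 1/A, and the mesh refined until larger steps become
  improbable.

  Bars are encoded by chains of strict alternating moves because strict inequalities survive
  rounding to grid points. The remaining losses in \<epsilon> and t are not removed pointwise:
  scaling merges them into one, and a monotone function of \<epsilon> has only countably many
  discontinuities, which the Mellin integral ignores.\<close>

definition alternates :: "('i::linorder \<Rightarrow> real) \<Rightarrow> real \<Rightarrow> (nat \<Rightarrow> 'i) \<Rightarrow> nat \<Rightarrow> bool" where
  "alternates y e \<tau> k \<longleftrightarrow>
     (\<forall>j<k. \<tau> j \<le> \<tau> (Suc j) \<and> (-1) ^ j * (y (\<tau> (Suc j)) - y (\<tau> j)) > e)"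

lemma alternates_snoc:
  assumes "alternates y e \<tau> k" "\<tau> k \<le> i" "(-1) ^ k * (y i - y (\<tau> k)) > e"
  shows "alternates y e (\<tau>(Suc k := i)) (Suc k)"
  using assms unfolding alternates_def by (auto simp: less_Suc_eq)

text \<open>The last move is a fall for even \<open>k\<close> and a rise for odd \<open>k\<close>,
  so a later and more extreme endpoint only widens it. This is how a running minimum or maximum is
  carried along by a chain.\<close>

lemma alternates_update_last:
  assumes "alternates y e \<tau> k" "\<tau> k \<le> i" "(-1) ^ k * y i \<le> (-1) ^ k * y (\<tau> k)"
  shows "alternates y e (\<tau>(k := i)) k"
  unfolding alternates_def
proof (intro allI impI)
  fix j assume j: "j < k"
  have *: "\<tau> j \<le> \<tau> (Suc j)" "(-1) ^ j * (y (\<tau> (Suc j)) - y (\<tau> j)) > e"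
    using assms j unfolding alternates_def by auto
  show "(\<tau>(k := i)) j \<le> (\<tau>(k := i)) (Suc j) \<and>
      (-1) ^ j * (y ((\<tau>(k := i)) (Suc j)) - y ((\<tau>(k := i)) j)) > e"
  proof (cases "Suc j = k")
    case True
    with * assms(2,3) show ?thesis by (auto simp: right_diff_distrib)
  next
    case False with * j show ?thesis by simp
  qed
qed

lemma alternates_mono_bound:
  assumes "alternates y e \<tau> k" "e' \<le> e"
  shows "alternates y e' \<tau> k"
  using assms unfolding alternates_def by force

lemma alternates_shorten:
  assumes "alternates y e \<tau> k" "k' \<le> k"
  shows "alternates y e \<tau> k'"
  using assms unfolding alternates_def by auto

lemma alternates_mono:
  assumes "alternates y e \<tau> k" "i \<le> j" "j \<le> k"
  shows "\<tau> i \<le> \<tau> j"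
  using assms(2,3)
proof (induction j rule: dec_induct)
  case (step n)
  then show ?case using assms(1) unfolding alternates_def by (metis Suc_le_lessD less_imp_le order_trans)
qed simp

text \<open>Unlike \<open>sgn\<close>, the value at 0 is 1: a sign 0 would erase a step, whereas the
  law of the walk is preserved only under factors 1 and -1.\<close>

definition sg :: "real \<Rightarrow> real" where "sg r = (if r \<ge> 0 then 1 else -1)"

lemma sg_mult_self [simp]: "sg r * r = \<bar>r\<bar>"
  by (auto simp: sg_def)

lemma sg_cases: "sg r = 1 \<or> sg r = -1"
  by (auto simp: sg_def)

lemma sg_square [simp]: "sg r * sg r = 1" "sg r * (sg r * z) = z"
  by (auto simp: sg_def)

lemma abs_sg [simp]: "\<bar>sg r\<bar> = 1"
  by (auto simp: sg_def)

text \<open>The number of completed stages, and the displacement since the last of them.\<close>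

primrec stage :: "real \<Rightarrow> (nat \<Rightarrow> real) \<Rightarrow> nat \<Rightarrow> nat \<times> real" where
  "stage e x 0 = (0, 0)"
| "stage e x (Suc i) =
     (if e \<le> \<bar>snd (stage e x i) + x i\<bar> then (Suc (fst (stage e x i)), 0)
      else (fst (stage e x i), snd (stage e x i) + x i))"

abbreviation "stg e x i \<equiv> fst (stage e x i)"
abbreviation "dsp e x i \<equiv> snd (stage e x i)"

text \<open>
  The pair consists of the value of the coupled walk and its sign at the start of the current
  stage: in an odd stage that sign, not the current one, decides the direction, because the
  walk may overshoot 0 there.
\<close>

definition coupling_sign :: "nat \<Rightarrow> real \<Rightarrow> real \<times> real \<Rightarrow> real" where
  "coupling_sign m u vs = (if even m then sg (fst vs) * sg u else - snd vs * sg u)"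

primrec coupled :: "real \<Rightarrow> (nat \<Rightarrow> real) \<Rightarrow> nat \<Rightarrow> real \<times> real" where
  "coupled e x 0 = (0, 1)"
| "coupled e x (Suc i) =
     (let v = fst (coupled e x i) + coupling_sign (stg e x i) (dsp e x i) (coupled e x i) * x i
      in (v, if e \<le> \<bar>dsp e x i + x i\<bar> then sg v else snd (coupled e x i)))"

text \<open>The factor applied to step \<open>i\<close>. It is computed from the steps before
  \<open>i\<close>, which makes the coupled walk a predictable sign change of the original
  one.\<close>

definition flip_coupled :: "real \<Rightarrow> (nat \<Rightarrow> real) \<Rightarrow> nat \<Rightarrow> real" where
  "flip_coupled e x i = coupling_sign (stg e x i) (dsp e x i) (coupled e x i)"

lemma coupled_eq_sum: "fst (coupled e x i) = (\<Sum>j<i. flip_coupled e x j * x j)"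
  by (induction i) (auto simp: Let_def flip_coupled_def)

lemma snd_coupled_cases: "snd (coupled e x i) = 1 \<or> snd (coupled e x i) = -1"
  by (induction i) (auto simp: Let_def sg_cases)

lemma flip_coupled_cases: "flip_coupled e x i = 1 \<or> flip_coupled e x i = -1"
  using snd_coupled_cases[of e x i] by (auto simp: flip_coupled_def coupling_sign_def sg_def)

lemma stg_mono: "i \<le> j \<Longrightarrow> stg e x i \<le> stg e x j"
  by (induction j rule: dec_induct) auto

lemma abs_dsp_less: "e > 0 \<Longrightarrow> \<bar>dsp e x i\<bar> < e"
  by (induction i) auto

lemma stg_le: "stg e x i \<le> i"
  by (induction i) auto

section \<open>Stages of the walk and alternations of the coupled walk\<close>

context
  fixes e \<delta> :: real and x :: "nat \<Rightarrow> real" and n :: nat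
  assumes \<delta>: "0 < \<delta>" "4 * \<delta> \<le> e" and small: "\<And>i. i < n \<Longrightarrow> \<bar>x i\<bar> \<le> \<delta>"
begin

text \<open>\<open>p\<close> is the minimum (even stage) or maximum (odd stage) of \<open>\<bar>V\<bar>\<close> over the current stage.\<close>

definition bars_inv :: "nat \<Rightarrow> real \<Rightarrow> bool" where
  "bars_inv i p \<longleftrightarrow>
     (let m = stg e x i; u = dsp e x i; v = fst (coupled e x i); s = snd (coupled e x i);
          y = (\<lambda>a. \<bar>fst (coupled e x a)\<bar>)
      in (if even m
          then 0 \<le> p \<and> (\<forall>a\<le>i. stg e x a = m \<longrightarrow> p \<le> y a) \<and> \<bar>v\<bar> - p \<le> \<bar>u\<bar> + \<delta> \<and> \<bar>u\<bar> \<le> \<bar>v\<bar> - p + \<delta>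
          else e - \<delta> \<le> p \<and> (\<forall>a\<le>i. stg e x a = m \<longrightarrow> y a \<le> p) \<and> p - s * v \<le> \<bar>u\<bar> \<and> \<bar>u\<bar> \<le> p - s * v + \<delta>)
       \<and> (\<exists>\<tau>. alternates y (e - 4 * \<delta>) \<tau> m \<and> \<tau> m \<le> i \<and> y (\<tau> m) = p))"

text \<open>Discrete Levy identity. With \<open>b = sg u * x i\<close>, both |V| and |u| move by
  \<open>b\<close>, except that |u| is reflected at 0 while the minimum \<open>p\<close> follows |V|
  down. Hence |V| - p tracks |u|. Whenever a reflection or a new minimum occurs, both quantities are
  at most \<delta> afterwards, so the error does not accumulate.\<close>

lemma bars_inv_step_even:
  assumes i: "i < n" and inv: "bars_inv i p" and ev: "even (stg e x i)"
  shows "\<exists>p. bars_inv (Suc i) p"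
proof -
  define m u v s y where "m = stg e x i" and "u = dsp e x i" and "v = fst (coupled e x i)"
    and "s = snd (coupled e x i)" and "y = (\<lambda>a. \<bar>fst (coupled e x a)\<bar>)"
  define v' where "v' = fst (coupled e x (Suc i))"
  define b where "b = sg u * x i"
  have b: "\<bar>b\<bar> \<le> \<delta>" using small[OF i] by (simp add: b_def abs_mult)
  have v'_eq: "v' = v + sg v * b"
    using ev by (simp add: v'_def v_def b_def u_def coupling_sign_def Let_def)
  have yv: "y (Suc i) = \<bar>\<bar>v\<bar> + b\<bar>"
    unfolding y_def v'_def[symmetric] v'_eq by (auto simp: sg_def)
  have ux: "\<bar>u + x i\<bar> = \<bar>\<bar>u\<bar> + b\<bar>"
    by (auto simp: b_def sg_def)
  from inv ev obtain \<tau> where p: "0 \<le> p" "\<And>a. a \<le> i \<Longrightarrow> stg e x a = m \<Longrightarrow> p \<le> y a"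
      "\<bar>v\<bar> - p \<le> \<bar>u\<bar> + \<delta>" "\<bar>u\<bar> \<le> \<bar>v\<bar> - p + \<delta>"
      and \<tau>: "alternates y (e - 4 * \<delta>) \<tau> m" "\<tau> m \<le> i" "y (\<tau> m) = p"
    unfolding bars_inv_def Let_def m_def u_def v_def y_def by auto
  define p' where "p' = min p (y (Suc i))"
  have 1: "y (Suc i) - p' \<le> \<bar>u + x i\<bar> + \<delta>"
    unfolding p'_def yv ux using p b by linarith
  have 2: "\<bar>u + x i\<bar> \<le> y (Suc i) - p' + \<delta>"
    unfolding p'_def yv ux using p b by linarith
  have evm: "even m" using ev by (simp add: m_def)
  show ?thesis
  proof (cases "e \<le> \<bar>u + x i\<bar>")
    case False
    have st: "stg e x (Suc i) = m" "dsp e x (Suc i) = u + x i"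
      using False by (auto simp: m_def u_def)
    have A: "\<exists>\<tau>. alternates y (e - 4 * \<delta>) \<tau> m \<and> \<tau> m \<le> Suc i \<and> y (\<tau> m) = p'"
    proof (cases "p \<le> y (Suc i)")
      case True
      with \<tau> show ?thesis by (intro exI[of _ \<tau>]) (auto simp: p'_def)
    next
      case False
      have "alternates y (e - 4 * \<delta>) (\<tau>(m := Suc i)) m"
        using \<tau> False evm by (intro alternates_update_last) auto
      with False show ?thesis by (intro exI[of _ "\<tau>(m := Suc i)"]) (auto simp: p'_def)
    qed
    have "p' \<le> y a" if "a \<le> Suc i" "stg e x a = m" for a
      using that p(2)[of a] by (cases "a = Suc i") (auto simp: p'_def)
    moreover have "0 \<le> p'" using p(1) by (auto simp: p'_def y_def)
    ultimately have "bars_inv (Suc i) p'"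
      unfolding bars_inv_def Let_def st y_def[symmetric]
      using 1 2 evm A by (auto simp: y_def[THEN fun_cong, symmetric] simp del: coupled.simps stage.simps)
    then show ?thesis ..
  next
    case True
    have st: "stg e x (Suc i) = Suc m" "dsp e x (Suc i) = 0" "snd (coupled e x (Suc i)) = sg v'"
      using True by (auto simp: m_def u_def v'_def Let_def)
    \<comment> \<open>Completion means that |u| has reached \<open>e\<close>, so |V| is at least e -
      \<delta> > 0 above the minimum. The last step therefore set no new minimum, and the rise can
      be measured from the recorded time of \<open>p\<close>.\<close>
    have pp: "p' = p" "y (Suc i) \<ge> p + e - \<delta>" using 2 True \<delta> by (auto simp: p'_def)
    have "alternates y (e - 4 * \<delta>) (\<tau>(Suc m := Suc i)) (Suc m)"
      using \<tau> evm pp \<delta> by (intro alternates_snoc) auto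
    hence A: "\<exists>\<tau>. alternates y (e - 4 * \<delta>) \<tau> (Suc m) \<and> \<tau> (Suc m) \<le> Suc i \<and> y (\<tau> (Suc m)) = y (Suc i)"
      by (intro exI[of _ "\<tau>(Suc m := Suc i)"]) auto
    have B: "a = Suc i" if "a \<le> Suc i" "stg e x a = Suc m" for a
      using stg_mono[of a i e x] that by (cases "a \<le> i") (auto simp: m_def)
    have "sg v' * v' = y (Suc i)" by (simp add: y_def v'_def)
    hence "bars_inv (Suc i) (y (Suc i))"
      unfolding bars_inv_def Let_def st y_def[symmetric] v'_def[symmetric]
      using evm A p pp B \<delta> by (auto simp: y_def[THEN fun_cong, symmetric] simp del: coupled.simps stage.simps)
    then show ?thesis ..
  qed
qed

text \<open>Here \<open>s * v\<close>, rather than |V|, moves by \<open>-b\<close>, and p - s v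
  tracks |u|, where \<open>p\<close> is the running maximum. Since p is at least e - \<delta> and
  |u| < e, the walk passes beyond 0 by at most 2 \<delta>, so that |V| stays below the maximum even
  then.\<close>

lemma bars_inv_step_odd:
  assumes i: "i < n" and inv: "bars_inv i p" and od: "odd (stg e x i)"
  shows "\<exists>p. bars_inv (Suc i) p"
proof -
  define m u v s y where "m = stg e x i" and "u = dsp e x i" and "v = fst (coupled e x i)"
    and "s = snd (coupled e x i)" and "y = (\<lambda>a. \<bar>fst (coupled e x a)\<bar>)"
  define v' where "v' = fst (coupled e x (Suc i))"
  define b where "b = sg u * x i"
  have s: "s = 1 \<or> s = -1" using snd_coupled_cases by (simp add: s_def)
  have b: "\<bar>b\<bar> \<le> \<delta>" using small[OF i] by (simp add: b_def abs_mult)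
  have "v' = v - s * b"
    using od by (simp add: v'_def v_def b_def u_def s_def coupling_sign_def Let_def)
  hence sv: "s * v' = s * v - b" using s by auto
  have yv: "y (Suc i) = \<bar>s * v'\<bar>"
    using s by (auto simp: y_def v'_def)
  have ux: "\<bar>u + x i\<bar> = \<bar>\<bar>u\<bar> + b\<bar>"
    by (auto simp: b_def sg_def)
  have ue: "\<bar>u\<bar> < e" unfolding u_def by (rule abs_dsp_less) (use \<delta> in auto)
  from inv od obtain \<tau> where p: "e - \<delta> \<le> p" "\<And>a. a \<le> i \<Longrightarrow> stg e x a = m \<Longrightarrow> y a \<le> p"
      "p - s * v \<le> \<bar>u\<bar>" "\<bar>u\<bar> \<le> p - s * v + \<delta>"
      and \<tau>: "alternates y (e - 4 * \<delta>) \<tau> m" "\<tau> m \<le> i" "y (\<tau> m) = p"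
    unfolding bars_inv_def Let_def m_def u_def v_def y_def s_def by auto
  define p' where "p' = max p (s * v')"
  have 1: "p' - s * v' \<le> \<bar>u + x i\<bar>"
    unfolding p'_def sv ux using p b by linarith
  have 2: "\<bar>u + x i\<bar> \<le> p' - s * v' + \<delta>"
    unfolding p'_def sv ux using p b by linarith
  have 3: "- (s * v') \<le> 2 * \<delta>"
    unfolding sv using p b ue \<delta> by linarith
  have 4: "y (Suc i) \<le> p'"
    unfolding yv p'_def using 3 p \<delta> by linarith
  have odm: "odd m" using od by (simp add: m_def)
  show ?thesis
  proof (cases "e \<le> \<bar>u + x i\<bar>")
    case False
    have st: "stg e x (Suc i) = m" "dsp e x (Suc i) = u + x i" "snd (coupled e x (Suc i)) = s"
      using False by (auto simp: m_def u_def Let_def s_def)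
    have A: "\<exists>\<tau>. alternates y (e - 4 * \<delta>) \<tau> m \<and> \<tau> m \<le> Suc i \<and> y (\<tau> m) = p'"
    proof (cases "p \<ge> s * v'")
      case True
      with \<tau> show ?thesis by (intro exI[of _ \<tau>]) (auto simp: p'_def)
    next
      case False
      have ye: "y (Suc i) = p'" using False p \<delta> unfolding yv p'_def by linarith
      have "alternates y (e - 4 * \<delta>) (\<tau>(m := Suc i)) m"
        using \<tau> False odm ye by (intro alternates_update_last) (auto simp: p'_def)
      with ye show ?thesis by (intro exI[of _ "\<tau>(m := Suc i)"]) auto
    qed
    have "y a \<le> p'" if "a \<le> Suc i" "stg e x a = m" for a
      using that p(2)[of a] 4 by (cases "a = Suc i") (auto simp: p'_def)
    hence "bars_inv (Suc i) p'"
      unfolding bars_inv_def Let_def st y_def[symmetric] v'_def[symmetric]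
      using 1 2 odm A p by (auto simp: y_def[THEN fun_cong, symmetric] p'_def simp del: coupled.simps stage.simps)
    then show ?thesis ..
  next
    case True
    have st: "stg e x (Suc i) = Suc m" "dsp e x (Suc i) = 0"
      using True by (auto simp: m_def u_def)
    have pp: "p' = p" "s * v' \<le> p - e + \<delta>" using 2 True \<delta> by (auto simp: p'_def)
    \<comment> \<open>If the walk has passed 0, then |V| is at most 2 \<delta> while p is at least e
      - \<delta>, so the fall may be as small as e - 3 \<delta>. This worst case, made strict, is
      the origin of 4 \<delta>.\<close>
    have "p - y (Suc i) > e - 4 * \<delta>"
      unfolding yv using pp 3 p \<delta> by linarith
    hence "alternates y (e - 4 * \<delta>) (\<tau>(Suc m := Suc i)) (Suc m)"
      using \<tau> odm by (intro alternates_snoc) auto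
    hence A: "\<exists>\<tau>. alternates y (e - 4 * \<delta>) \<tau> (Suc m) \<and> \<tau> (Suc m) \<le> Suc i \<and> y (\<tau> (Suc m)) = y (Suc i)"
      by (intro exI[of _ "\<tau>(Suc m := Suc i)"]) auto
    have B: "a = Suc i" if "a \<le> Suc i" "stg e x a = Suc m" for a
      using stg_mono[of a i e x] that by (cases "a \<le> i") (auto simp: m_def)
    have "0 \<le> y (Suc i)" by (simp add: y_def)
    hence "bars_inv (Suc i) (y (Suc i))"
      unfolding bars_inv_def Let_def st y_def[symmetric]
      using odm A p pp B \<delta> by (auto simp: y_def[THEN fun_cong, symmetric] simp del: coupled.simps stage.simps)
    then show ?thesis ..
  qed
qed

lemma bars_inv_exists: "i \<le> n \<Longrightarrow> \<exists>p. bars_inv i p"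
proof (induction i)
  case 0
  have "bars_inv 0 0"
    using \<delta> by (auto simp: bars_inv_def alternates_def)
  thus ?case ..
next
  case (Suc i)
  then obtain p where "bars_inv i p" by auto
  thus ?case using bars_inv_step_even[of i p] bars_inv_step_odd[of i p] Suc.prems by auto
qed

lemma alternates_coupled_exists:
  "\<exists>\<tau>. alternates (\<lambda>a. \<bar>fst (coupled e x a)\<bar>) (e - 4 * \<delta>) \<tau> (stg e x n) \<and> \<tau> (stg e x n) \<le> n"
  using bars_inv_exists[of n] unfolding bars_inv_def Let_def by auto

text \<open>The extremum \<open>p\<close> of the stage bounds the earlier value, so the move is at
  most |V| - p in an even stage and p - |V| in an odd one. The invariant compares both with |u|,
  which stays below \<open>e\<close>.\<close>

lemma stage_oscillation:
  assumes "a \<le> b" "b \<le> n" "stg e x a = stg e x b"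
  shows "(-1) ^ stg e x b * (\<bar>fst (coupled e x b)\<bar> - \<bar>fst (coupled e x a)\<bar>) \<le> e + \<delta>"
proof -
  obtain p where p: "bars_inv b p" using bars_inv_exists assms by blast
  have ue: "\<bar>dsp e x b\<bar> < e" by (rule abs_dsp_less) (use \<delta> in auto)
  have "snd (coupled e x b) * fst (coupled e x b) \<le> \<bar>fst (coupled e x b)\<bar>"
    using snd_coupled_cases[of e x b] by auto
  with p ue assms \<delta> show ?thesis
    unfolding bars_inv_def Let_def by (cases "even (stg e x b)") fastforce+
qed

text \<open>Move \<open>j\<close> has the direction in which stage \<open>j\<close> ends and is too
  large to fit into that stage. By induction the \<open>j\<close>-th time of any such chain lies in
  stage \<open>j\<close> or later.\<close>

lemma alternates_coupled_le_stg:
  assumes "alternates (\<lambda>a. \<bar>fst (coupled e x a)\<bar>) (e + \<delta>) \<tau> k" "\<tau> k \<le> n"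
  shows "k \<le> stg e x n"
proof -
  have "j \<le> stg e x (\<tau> j)" if "j \<le> k" for j
    using that
  proof (induction j)
    case (Suc j)
    hence 1: "\<tau> j \<le> \<tau> (Suc j)"
      "(-1) ^ j * (\<bar>fst (coupled e x (\<tau> (Suc j)))\<bar> - \<bar>fst (coupled e x (\<tau> j))\<bar>) > e + \<delta>"
      using assms(1) unfolding alternates_def by auto
    have 2: "\<tau> (Suc j) \<le> n" using alternates_mono[OF assms(1) Suc.prems order.refl] assms(2) by simp
    have 3: "j \<le> stg e x (\<tau> j)" using Suc by simp
    have 4: "stg e x (\<tau> j) \<le> stg e x (\<tau> (Suc j))" using 1(1) by (rule stg_mono)
    show ?case
    proof (rule ccontr)
      assume "\<not> Suc j \<le> stg e x (\<tau> (Suc j))"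
      with 3 4 have "stg e x (\<tau> (Suc j)) = j" "stg e x (\<tau> j) = j" by linarith+
      with stage_oscillation[OF 1(1) 2] 1(2) show False by simp
    qed
  qed simp
  from this[of k] stg_mono[OF assms(2), of e x] show ?thesis by simp
qed

end

lemma stage_cong: "(\<And>j. j < i \<Longrightarrow> x j = y j) \<Longrightarrow> stage e x i = stage e y i"
  by (induction i) auto

lemma coupled_cong: "(\<And>j. j < i \<Longrightarrow> x j = y j) \<Longrightarrow> coupled e x i = coupled e y i"
proof (induction i)
  case (Suc i)
  have "stage e x i = stage e y i" using Suc.prems by (intro stage_cong) auto
  moreover have "coupled e x i = coupled e y i" using Suc by auto
  ultimately show ?case using Suc.prems by (simp add: Let_def)
qed simp

section \<open>Averaging over the signs of the stages\<close>

abbreviation gauss_measure :: "real \<Rightarrow> real measure" where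
  "gauss_measure \<sigma> \<equiv> density lborel (normal_density 0 \<sigma>)"

definition walk_measure :: "real \<Rightarrow> nat \<Rightarrow> (nat \<Rightarrow> real) measure" where
  "walk_measure \<sigma> n = PiM {..<n} (\<lambda>_. gauss_measure \<sigma>)"

lemma sets_walk_measure [measurable_cong]: "sets (walk_measure \<sigma> n) = sets (PiM {..<n} (\<lambda>_. borel))"
  unfolding walk_measure_def by (intro sets_PiM_cong) auto

lemma space_walk_measure: "space (walk_measure \<sigma> n) = PiE {..<n} (\<lambda>_. UNIV)"
  by (simp add: walk_measure_def space_PiM)

lemma nn_integral_gauss_sign:
  assumes [measurable]: "f \<in> borel_measurable borel" and c: "c = 1 \<or> c = -1"
  shows "(\<integral>\<^sup>+y. f (c * y) \<partial>gauss_measure \<sigma>) = (\<integral>\<^sup>+y. f y \<partial>gauss_measure \<sigma>)"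
proof -
  have "(\<integral>\<^sup>+y. f y \<partial>gauss_measure \<sigma>) = (\<integral>\<^sup>+y. ennreal (normal_density 0 \<sigma> y) * f y \<partial>lborel)"
    by (subst nn_integral_density) auto
  also have "\<dots> = ennreal \<bar>c\<bar> * (\<integral>\<^sup>+y. ennreal (normal_density 0 \<sigma> (0 + c * y)) * f (0 + c * y) \<partial>lborel)"
    using c by (intro nn_integral_real_affine) auto
  also have "\<dots> = (\<integral>\<^sup>+y. ennreal (normal_density 0 \<sigma> y) * f (c * y) \<partial>lborel)"
    using c by (auto simp: normal_density_def)
  also have "\<dots> = (\<integral>\<^sup>+y. f (c * y) \<partial>gauss_measure \<sigma>)"
    by (subst nn_integral_density) auto
  finally show ?thesis ..
qed

text \<open>Induction on the last coordinate. Its sign depends only on the other coordinates, so the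
  inner Gaussian integral is unchanged by symmetry; what remains is a function of the first
  \<open>n\<close> coordinates, to which the induction hypothesis applies.\<close>

lemma nn_integral_walk_flip:
  assumes \<sigma>: "\<sigma> > 0"
    and f: "f \<in> borel_measurable (PiM {..<n} (\<lambda>_. borel))"
    and s: "\<And>i. i < n \<Longrightarrow> s i \<in> borel_measurable (PiM {..<i} (\<lambda>_. borel))"
    and s1: "\<And>i x. i < n \<Longrightarrow> s i x = 1 \<or> s i x = (-1::real)"
    and pred: "\<And>i x y. i < n \<Longrightarrow> (\<And>j. j < i \<Longrightarrow> x j = y j) \<Longrightarrow> s i x = s i y"
  shows "(\<integral>\<^sup>+x. f (\<lambda>i\<in>{..<n}. s i x * x i) \<partial>walk_measure \<sigma> n) = (\<integral>\<^sup>+x. f x \<partial>walk_measure \<sigma> n)"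
  using f s s1 pred
proof (induction n arbitrary: f)
  case 0
  have "(\<integral>\<^sup>+x. f (\<lambda>i\<in>{..<0}. s i x * x i) \<partial>walk_measure \<sigma> 0) = (\<integral>\<^sup>+x. f x \<partial>walk_measure \<sigma> 0)"
    by (intro nn_integral_cong arg_cong[of _ _ f] ext) (auto simp: space_walk_measure)
  then show ?case .
next
  case (Suc n)
  interpret prob_space "gauss_measure \<sigma>" using prob_space_normal_density[OF \<sigma>] .
  interpret product_sigma_finite "\<lambda>_::nat. gauss_measure \<sigma>" ..
  note f = Suc.prems(1)
  have upd [measurable]: "(\<lambda>(x, y). x(n := y)) \<in> PiM {..<n} (\<lambda>_. borel) \<Otimes>\<^sub>M borel \<rightarrow>\<^sub>M PiM {..<Suc n} (\<lambda>_. borel :: real measure)"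
    unfolding lessThan_Suc by (rule measurable_add_dim)
  have upd' [measurable]: "(\<lambda>y. x(n := y)) \<in> borel \<rightarrow>\<^sub>M PiM {..<Suc n} (\<lambda>_. borel :: real measure)"
    if "x \<in> space (PiM {..<n} (\<lambda>_. borel))" for x
    using that upd by (rule measurable_Pair2[where f="\<lambda>(x, y). x(n := y)", simplified, rotated])
  \<comment> \<open>\<open>s i\<close> is known to be measurable only on the first \<open>i\<close>
    coordinates; by predictability it factors through the restriction to them.\<close>
  have sm: "(\<lambda>x. s i x) \<in> borel_measurable (PiM {..<Suc n} (\<lambda>_. borel))" if "i < Suc n" for i
  proof -
    have "(\<lambda>x. s i (restrict x {..<i})) \<in> borel_measurable (PiM {..<Suc n} (\<lambda>_. borel))"
      using that by (intro measurable_compose[OF measurable_restrict_subset Suc.prems(2)]) auto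
    moreover have "(\<lambda>x. s i (restrict x {..<i})) = s i"
      using that by (intro ext Suc.prems(4)) auto
    ultimately show ?thesis by simp
  qed
  have phi: "(\<lambda>x. \<lambda>i\<in>{..<Suc n}. s i x * x i) \<in> PiM {..<Suc n} (\<lambda>_. borel) \<rightarrow>\<^sub>M PiM {..<Suc n} (\<lambda>_. borel)"
    by (intro measurable_restrict borel_measurable_times sm) auto
  have g: "(\<lambda>x. \<integral>\<^sup>+y. f (x(n := y)) \<partial>gauss_measure \<sigma>) \<in> borel_measurable (PiM {..<n} (\<lambda>_. borel))"
  proof (rule borel_measurable_nn_integral)
    show "(\<lambda>(x, y). f (x(n := y))) \<in> borel_measurable (PiM {..<n} (\<lambda>_. borel) \<Otimes>\<^sub>M gauss_measure \<sigma>)"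
      using measurable_compose[OF upd f] by (simp add: case_prod_unfold del: fun_upd_apply cong: measurable_cong_sets)
  qed
  have PS: "walk_measure \<sigma> (Suc n) = PiM (insert n {..<n}) (\<lambda>_. gauss_measure \<sigma>)"
    by (simp add: walk_measure_def lessThan_Suc)
  have fS: "f \<in> borel_measurable (PiM (insert n {..<n}) (\<lambda>_. gauss_measure \<sigma>))"
    using f by (simp add: PS[symmetric] cong: measurable_cong_sets)
  have phiS: "(\<lambda>x. f (\<lambda>i\<in>{..<Suc n}. s i x * x i)) \<in> borel_measurable (PiM (insert n {..<n}) (\<lambda>_. gauss_measure \<sigma>))"
    using measurable_compose[OF phi f] unfolding PS[symmetric] measurable_cong_sets[OF sets_walk_measure refl] .
  have "(\<integral>\<^sup>+x. f (\<lambda>i\<in>{..<Suc n}. s i x * x i) \<partial>walk_measure \<sigma> (Suc n))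
      = (\<integral>\<^sup>+x. \<integral>\<^sup>+y. f (\<lambda>i\<in>{..<Suc n}. s i (x(n := y)) * (x(n := y)) i) \<partial>gauss_measure \<sigma> \<partial>walk_measure \<sigma> n)"
    unfolding PS by (subst product_nn_integral_insert[OF _ _ phiS]) (auto simp: walk_measure_def)
  also have "\<dots> = (\<integral>\<^sup>+x. \<integral>\<^sup>+y. f ((\<lambda>i\<in>{..<n}. s i x * x i)(n := s n x * y)) \<partial>gauss_measure \<sigma> \<partial>walk_measure \<sigma> n)"
  proof (intro nn_integral_cong arg_cong[of _ _ f] ext)
    fix x y i
    have "s i (x(n := y)) = s i x" if "i < Suc n"
      using that by (intro Suc.prems(4)) auto
    thus "(\<lambda>i\<in>{..<Suc n}. s i (x(n := y)) * (x(n := y)) i) i = ((\<lambda>i\<in>{..<n}. s i x * x i)(n := s n x * y)) i"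
      by auto
  qed
  also have "\<dots> = (\<integral>\<^sup>+x. \<integral>\<^sup>+y. f ((\<lambda>i\<in>{..<n}. s i x * x i)(n := y)) \<partial>gauss_measure \<sigma> \<partial>walk_measure \<sigma> n)"
  proof (rule nn_integral_cong)
    fix x :: "nat \<Rightarrow> real"
    have "(\<lambda>z. f ((\<lambda>i\<in>{..<n}. s i x * x i)(n := z))) \<in> borel_measurable borel"
      by (intro measurable_compose[OF upd' f]) (auto simp: space_PiM)
    moreover have "s n x = 1 \<or> s n x = -1" using Suc.prems(3) by simp
    ultimately show "(\<integral>\<^sup>+y. f ((\<lambda>i\<in>{..<n}. s i x * x i)(n := s n x * y)) \<partial>gauss_measure \<sigma>)
        = (\<integral>\<^sup>+y. f ((\<lambda>i\<in>{..<n}. s i x * x i)(n := y)) \<partial>gauss_measure \<sigma>)"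
      by (rule nn_integral_gauss_sign)
  qed
  also have "\<dots> = (\<integral>\<^sup>+x. \<integral>\<^sup>+y. f (x(n := y)) \<partial>gauss_measure \<sigma> \<partial>walk_measure \<sigma> n)"
  proof (rule Suc.IH[OF g])
    fix i and x y :: "nat \<Rightarrow> real" assume "i < n"
    thus "s i \<in> borel_measurable (PiM {..<i} (\<lambda>_. borel))" by (intro Suc.prems(2)) simp
    show "s i x = 1 \<or> s i x = -1" using \<open>i < n\<close> by (intro Suc.prems(3)) simp
    assume "\<And>j. j < i \<Longrightarrow> x j = y j"
    thus "s i x = s i y" using \<open>i < n\<close> by (intro Suc.prems(4)) auto
  qed
  also have "\<dots> = (\<integral>\<^sup>+x. f x \<partial>walk_measure \<sigma> (Suc n))"
    unfolding PS by (subst product_nn_integral_insert[OF _ _ fS]) (auto simp: walk_measure_def)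
  finally show ?case .
qed

section \<open>Second moments of independent signs\<close>

definition signs :: "nat \<Rightarrow> (nat \<Rightarrow> real) set" where
  "signs n = PiE {..<n} (\<lambda>_. {1, -1})"

lemma card_signs: "card (signs n) = 2 ^ n"
  by (simp add: signs_def card_PiE numeral_2_eq_2)

lemma signs_cases: "c \<in> signs n \<Longrightarrow> i < n \<Longrightarrow> c i = 1 \<or> c i = -1"
  by (auto simp: signs_def PiE_iff)

text \<open>For distinct indices, flipping sign \<open>i\<close> is an involution of the index set
  that negates every summand.\<close>

lemma sum_signs_mult:
  assumes "i < n" "j < n"
  shows "(\<Sum>c\<in>signs n. c i * c j) = (if i = j then 2 ^ n else 0)"
proof (cases "i = j")
  case True
  have "(\<Sum>c\<in>signs n. c i * c j) = (\<Sum>c\<in>signs n. 1)"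
    using signs_cases[OF _ assms(1)] True by (intro sum.cong) fastforce+
  with True show ?thesis by (simp add: card_signs)
next
  case False
  have "(\<Sum>c\<in>signs n. c i * c j) = (\<Sum>c\<in>signs n. (c(i := - c i)) i * (c(i := - c i)) j)"
    using assms by (intro sum.reindex_bij_witness[of _ "\<lambda>c. c(i := - c i)" "\<lambda>c. c(i := - c i)"])
      (auto simp: signs_def PiE_iff extensional_def)
  also have "\<dots> = - (\<Sum>c\<in>signs n. c i * c j)"
    using False by (simp add: sum_negf)
  finally show ?thesis using False by simp
qed

lemma sum_signs_square:
  "(\<Sum>c\<in>signs n. (\<Sum>m<n. a m * c m)\<^sup>2) = 2 ^ n * (\<Sum>m<n. (a m)\<^sup>2)"
proof -
  have "(\<Sum>c\<in>signs n. (\<Sum>m<n. a m * c m)\<^sup>2)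
      = (\<Sum>i<n. \<Sum>j<n. a i * a j * (\<Sum>c\<in>signs n. c i * c j))"
    unfolding power2_eq_square sum_product
    by (subst sum.swap, rule sum.cong[OF refl], subst sum.swap) (simp add: sum_distrib_left mult_ac)
  also have "\<dots> = (\<Sum>i<n. \<Sum>j<n. if i = j then 2 ^ n * (a i)\<^sup>2 else 0)"
    by (intro sum.cong refl) (auto simp: sum_signs_mult power2_eq_square)
  also have "\<dots> = 2 ^ n * (\<Sum>m<n. (a m)\<^sup>2)"
    by (simp add: sum_distrib_left)
  finally show ?thesis .
qed

text \<open>The squared term counts the odd integers up to |w|/e. The value is thus constant between
  consecutive odd multiples of \<open>e\<close>, and an error in \<open>w\<close> can matter only
  near these.\<close>

definition bar_count :: "real \<Rightarrow> real \<Rightarrow> nat" where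
  "bar_count e w = 2 * ((nat \<lfloor>\<bar>w\<bar> / e\<rfloor> + 1) div 2)\<^sup>2"

lemma bar_count_ge:
  assumes "e > 0" "h = 0 \<or> \<bar>w\<bar> \<ge> (2 * real h - 1) * e"
  shows "bar_count e w \<ge> 2 * h\<^sup>2"
proof (cases "h = 0")
  case False
  with assms have "2 * real h - 1 \<le> \<bar>w\<bar> / e" by (simp add: pos_le_divide_eq)
  hence "2 * int h - 1 \<le> \<lfloor>\<bar>w\<bar> / e\<rfloor>" by (simp add: le_floor_iff)
  hence "h \<le> (nat \<lfloor>\<bar>w\<bar> / e\<rfloor> + 1) div 2" by linarith
  thus ?thesis unfolding bar_count_def by (simp add: power_mono)
qed simp

lemma bar_count_le:
  assumes "e > 0" "\<bar>w\<bar> < (2 * real h + 1) * e"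
  shows "bar_count e w \<le> 2 * h\<^sup>2"
proof -
  from assms have "\<bar>w\<bar> / e < 2 * real h + 1" by (simp add: pos_divide_less_eq)
  hence "\<lfloor>\<bar>w\<bar> / e\<rfloor> < 2 * int h + 1" by (subst floor_less_iff) simp
  hence "(nat \<lfloor>\<bar>w\<bar> / e\<rfloor> + 1) div 2 \<le> h" by linarith
  thus ?thesis unfolding bar_count_def by (simp add: power_mono)
qed

lemma bar_count_antimono: "0 < e' \<Longrightarrow> e' \<le> e \<Longrightarrow> bar_count e w \<le> bar_count e' w"
  unfolding bar_count_def
  by (intro mult_left_mono power_mono div_le_mono add_right_mono nat_mono floor_mono divide_left_mono) auto

text \<open>For a completed stage this includes the final overshooting step, which
  \<open>dsp\<close> loses when it is reset to 0.\<close>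

definition displacement :: "real \<Rightarrow> (nat \<Rightarrow> real) \<Rightarrow> nat \<Rightarrow> nat \<Rightarrow> real" where
  "displacement e x n m = (\<Sum>i<n. if stg e x i = m then x i else 0)"

lemma displacement_Suc:
  "displacement e x (Suc n) m = displacement e x n m + (if stg e x n = m then x n else 0)"
  by (simp add: displacement_def)

lemma displacement_0 [simp]: "displacement e x 0 m = 0"
  by (simp add: displacement_def)

lemma displacement_greater: "stg e x n < m \<Longrightarrow> displacement e x n m = 0"
  by (induction n) (auto simp: displacement_Suc split: if_splits)

lemma displacement_last: "displacement e x n (stg e x n) = dsp e x n"
  by (induction n) (auto simp: displacement_Suc displacement_greater)

lemma displacement_bounds:
  assumes "e > 0" "m < stg e x n" "\<And>i. i < n \<Longrightarrow> \<bar>x i\<bar> \<le> \<delta>"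
  shows "e \<le> \<bar>displacement e x n m\<bar> \<and> \<bar>displacement e x n m\<bar> \<le> e + \<delta>"
  using assms(2,3)
proof (induction n)
  case (Suc n)
  show ?case
  proof (cases "m < stg e x n")
    case True
    thus ?thesis using Suc by (auto simp: displacement_Suc)
  next
    case False
    with Suc.prems(1) have *: "e \<le> \<bar>dsp e x n + x n\<bar>" "m = stg e x n"
      by (auto split: if_splits)
    have "displacement e x (Suc n) m = dsp e x n + x n"
      using *(2) by (simp add: displacement_Suc displacement_last)
    thus ?thesis using *(1) abs_dsp_less[OF assms(1), of x n] Suc.prems(2)[of n] by auto
  qed
qed simp

lemma displacement_ge:
  assumes "e > 0" "m < stg e x n"
  shows "e \<le> \<bar>displacement e x n m\<bar>"
proof -
  \<comment> \<open>Only the lower bound of \<open>displacement_bounds\<close> is wanted, so any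
    bound on the steps will do as \<delta>.\<close>
  have "\<bar>x i\<bar> \<le> (\<Sum>i<n. \<bar>x i\<bar>)" if "i < n" for i
    using that by (intro member_le_sum) auto
  from displacement_bounds[OF assms this] show ?thesis by simp
qed

text \<open>The steps are grouped by stage. Stage numbers are at most the number of steps, hence the
  range \<open>Suc n\<close> for the signs.\<close>

lemma sum_flip_stage:
  "(\<Sum>i<n. c (stg e x i) * x i) = (\<Sum>m<Suc n. displacement e x n m * c m)"
proof -
  have "(\<Sum>m<Suc n. displacement e x n m * c m)
      = (\<Sum>m<Suc n. \<Sum>i<n. if stg e x i = m then c m * x i else 0)"
    unfolding displacement_def sum_distrib_right by (intro sum.cong refl) auto
  also have "\<dots> = (\<Sum>i<n. \<Sum>m<Suc n. if stg e x i = m then c m * x i else 0)"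
    by (rule sum.swap)
  also have "\<dots> = (\<Sum>i<n. c (stg e x i) * x i)"
  proof (intro sum.cong refl)
    fix i assume "i \<in> {..<n}"
    hence "stg e x i < Suc n" using stg_le[of e x i] by simp
    thus "(\<Sum>m<Suc n. if stg e x i = m then c m * x i else 0) = c (stg e x i) * x i"
      by (subst sum.delta') auto
  qed
  finally show ?thesis ..
qed

text \<open>
  The value of \<open>bar_count e\<close> at \<open>e * z + q * \<bar>u\<bar>\<close> for \<open>0 < \<bar>u\<bar> < e\<close> and \<open>q = \<plusminus>1\<close>, as a polynomial that
  is easy to average over independent signs.
\<close>

definition formal_count :: "int \<Rightarrow> real \<Rightarrow> real" where
  "formal_count z q = (if even z then (real_of_int z)\<^sup>2 / 2 else ((real_of_int z)\<^sup>2 + 1) / 2 + z * q)"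

text \<open>For even z, the point e |z| lies midway between the odd multiples (2h - 1) e and (2h +
  1) e, and a displacement below \<open>e\<close> in either direction crosses neither. For odd z it
  lies on an odd multiple, and the count depends on whether the last displacement leads away from 0
  (\<open>outward\<close>) or back (\<open>inward\<close>).\<close>

lemma formal_count_cases [consumes 1, case_names even outward inward]:
  fixes z :: int
  assumes q: "q = 1 \<or> q = (-1::real)"
  obtains (even) h where "formal_count z q = 2 * (real h)\<^sup>2" "\<bar>real_of_int z\<bar> = 2 * real h"
  | (outward) h where "formal_count z q = 2 * (real h)\<^sup>2" "\<bar>real_of_int z\<bar> = 2 * real h - 1"
      "real_of_int z = q * \<bar>real_of_int z\<bar>" "h \<ge> 1"
  | (inward) h where "formal_count z q = 2 * (real h)\<^sup>2" "\<bar>real_of_int z\<bar> = 2 * real h + 1"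
      "real_of_int z = - q * \<bar>real_of_int z\<bar>"
proof (cases "even z")
  case True
  then obtain k where k: "z = 2 * k" by blast
  have "formal_count z q = 2 * (real (nat \<bar>k\<bar>))\<^sup>2" "\<bar>real_of_int z\<bar> = 2 * real (nat \<bar>k\<bar>)"
    using k by (auto simp: formal_count_def power2_eq_square)
  thus ?thesis by (rule that(1))
next
  case False
  have a: "real_of_int z = q * \<bar>real_of_int z\<bar> \<or> real_of_int z = - q * \<bar>real_of_int z\<bar>"
    using q by (cases "z \<ge> 0") auto
  have sq: "(real_of_int z)\<^sup>2 = \<bar>real_of_int z\<bar>\<^sup>2" by simp
  have odd: "odd \<bar>z\<bar>" using False by simp
  then obtain k where k: "\<bar>z\<bar> = 2 * k + 1" by (elim oddE)
  hence k0: "k \<ge> 0" by linarith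
  have kr: "\<bar>real_of_int z\<bar> = 2 * real (nat k) + 1" using k k0 by linarith
  have qq: "q * q = 1" using q by auto
  from a show ?thesis
  proof
    assume A: "real_of_int z = q * \<bar>real_of_int z\<bar>"
    have zq: "z * q = \<bar>real_of_int z\<bar>" using q A by auto
    have "formal_count z q = 2 * (real (nat k + 1))\<^sup>2"
      using False unfolding formal_count_def zq sq kr by (simp add: power2_eq_square algebra_simps)
    thus ?thesis by (rule that(2)) (use kr A in auto)
  next
    assume A: "real_of_int z = - q * \<bar>real_of_int z\<bar>"
    have zq: "z * q = - \<bar>real_of_int z\<bar>" using q A by auto
    have "formal_count z q = 2 * (real (nat k))\<^sup>2"
      using False unfolding formal_count_def zq sq kr by (simp add: power2_eq_square algebra_simps)
    thus ?thesis by (rule that(3)) (use kr A in auto)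
  qed
qed

lemma abs_combination:
  assumes q: "q = 1 \<or> q = (-1::real)" and e: "e > 0"
  shows "\<bar>e * z + q * \<bar>u\<bar>\<bar> \<ge> e * \<bar>z\<bar> - \<bar>u\<bar>" "\<bar>e * z + q * \<bar>u\<bar>\<bar> \<le> e * \<bar>z\<bar> + \<bar>u\<bar>"
    "z = q * \<bar>z\<bar> \<Longrightarrow> \<bar>e * z + q * \<bar>u\<bar>\<bar> = e * \<bar>z\<bar> + \<bar>u\<bar>"
    "z = - q * \<bar>z\<bar> \<Longrightarrow> \<bar>e * z + q * \<bar>u\<bar>\<bar> = \<bar>e * \<bar>z\<bar> - \<bar>u\<bar>\<bar>"
proof -
  have ez: "\<bar>e * z\<bar> = e * \<bar>z\<bar>" using e by (simp add: abs_mult)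
  show "\<bar>e * z + q * \<bar>u\<bar>\<bar> \<ge> e * \<bar>z\<bar> - \<bar>u\<bar>" "\<bar>e * z + q * \<bar>u\<bar>\<bar> \<le> e * \<bar>z\<bar> + \<bar>u\<bar>"
    using q unfolding ez[symmetric] by auto
  {
    assume "z = q * \<bar>z\<bar>"
    hence "e * z = q * (e * \<bar>z\<bar>)" by (metis mult.left_commute)
    moreover have "e * \<bar>z\<bar> \<ge> 0" using e by simp
    ultimately show "\<bar>e * z + q * \<bar>u\<bar>\<bar> = e * \<bar>z\<bar> + \<bar>u\<bar>"
      using q by auto
  }
  {
    assume "z = - q * \<bar>z\<bar>"
    hence "e * z = - q * (e * \<bar>z\<bar>)" by (metis mult.left_commute)
    thus "\<bar>e * z + q * \<bar>u\<bar>\<bar> = \<bar>e * \<bar>z\<bar> - \<bar>u\<bar>\<bar>"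
      using q by auto
  }
qed

text \<open>Lowering \<open>e\<close> to \<open>e'\<close> moves the barrier (2h - 1) e down by at
  least e - e' when h is positive. This exceeds the error \<eta>, so an endpoint that ideally
  reaches the barrier still passes the lowered one.\<close>

lemma formal_count_le_bar_count:
  assumes e: "0 < e'" "e' < e" and q: "q = 1 \<or> q = (-1::real)" and u: "\<bar>u\<bar> < e"
    and w: "\<bar>w - (e * real_of_int z + q * \<bar>u\<bar>)\<bar> \<le> \<eta>" and \<eta>: "\<eta> < e - e'"
  shows "formal_count z q \<le> bar_count e' w"
proof -
  have e0: "e > 0" using e by simp
  note ac = abs_combination[OF q e0, of "real_of_int z" u]
  obtain h where h: "formal_count z q = 2 * (real h)\<^sup>2" "h = 0 \<or> \<bar>w\<bar> \<ge> (2 * real h - 1) * e'"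
  using q
  proof (cases rule: formal_count_cases[where z = z])
    case (even h)
    have "\<bar>w\<bar> \<ge> e * (2 * real h) - \<bar>u\<bar> - \<eta>" using ac(1)[unfolded even(2)] w by linarith
    moreover have "h \<noteq> 0 \<Longrightarrow> (2 * real h - 1) * (e - e') \<ge> 1 * (e - e')"
      using e by (intro mult_right_mono) auto
    ultimately show ?thesis using even that u \<eta> by (cases "h = 0") (auto simp: algebra_simps)
  next
    case (outward h)
    have "\<bar>w\<bar> \<ge> e * (2 * real h - 1) - \<eta>" using ac(3)[OF outward(3)] w unfolding outward(2) by linarith
    moreover have "(2 * real h - 1) * (e - e') \<ge> 1 * (e - e')"
      using e outward by (intro mult_right_mono) auto
    ultimately show ?thesis using outward that u \<eta> by (auto simp: algebra_simps)
  next
    case (inward h)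
    have "\<bar>w\<bar> \<ge> e * (2 * real h + 1) - \<bar>u\<bar> - \<eta>" using ac(1)[unfolded inward(2)] w by linarith
    moreover have "h \<noteq> 0 \<Longrightarrow> (2 * real h - 1) * (e - e') \<ge> 1 * (e - e')"
      using e by (intro mult_right_mono) auto
    ultimately show ?thesis using inward that u \<eta> e by (cases "h = 0") (auto simp: algebra_simps)
  qed
  have "2 * h\<^sup>2 \<le> bar_count e' w" using h e by (intro bar_count_ge) auto
  hence "real (2 * h\<^sup>2) \<le> real (bar_count e' w)" by (rule of_nat_mono)
  thus ?thesis using h by simp
qed

text \<open>The barrier is now the upper one: (2h + 1) e is raised by at least e' - e, which is more
  than \<eta>.\<close>

lemma bar_count_le_formal_count:
  assumes e: "0 < e" "e < e'" and q: "q = 1 \<or> q = (-1::real)" and u: "\<bar>u\<bar> < e"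
    and w: "\<bar>w - (e * real_of_int z + q * \<bar>u\<bar>)\<bar> \<le> \<eta>" and \<eta>: "\<eta> < e' - e"
  shows "bar_count e' w \<le> formal_count z q"
proof -
  note ac = abs_combination[OF q e(1), of "real_of_int z" u]
  obtain h where h: "formal_count z q = 2 * (real h)\<^sup>2" "\<bar>w\<bar> < (2 * real h + 1) * e'"
    using q
  proof (cases rule: formal_count_cases[where z = z])
    case (even h)
    have "\<bar>w\<bar> \<le> e * (2 * real h) + \<bar>u\<bar> + \<eta>" using ac(2)[unfolded even(2)] w by linarith
    moreover have "(2 * real h + 1) * (e' - e) \<ge> 1 * (e' - e)"
      using e by (intro mult_right_mono) auto
    ultimately have "\<bar>w\<bar> < (2 * real h + 1) * e'" using u \<eta> e(1) by (simp add: algebra_simps)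
    with even(1) show ?thesis by (rule that)
  next
    case (outward h)
    have "\<bar>w\<bar> \<le> e * (2 * real h - 1) + \<bar>u\<bar> + \<eta>" using ac(2)[unfolded outward(2)] w by linarith
    moreover have "(2 * real h + 1) * (e' - e) \<ge> 1 * (e' - e)"
      using e by (intro mult_right_mono) auto
    ultimately have "\<bar>w\<bar> < (2 * real h + 1) * e'" using u \<eta> e(1) by (simp add: algebra_simps)
    with outward(1) show ?thesis by (rule that)
  next
    case (inward h)
    have "\<bar>e * \<bar>real_of_int z\<bar> - \<bar>u\<bar>\<bar> \<le> e * (2 * real h + 1)"
    proof -
      have "e * (2 * real h + 1) \<ge> e * 1" using e by (intro mult_left_mono) auto
      thus ?thesis unfolding inward(2) using u by linarith
    qed
    hence "\<bar>w\<bar> \<le> e * (2 * real h + 1) + \<eta>" using ac(4)[OF inward(3)] w by linarith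
    moreover have "(2 * real h + 1) * (e' - e) \<ge> 1 * (e' - e)"
      using e by (intro mult_right_mono) auto
    ultimately have "\<bar>w\<bar> < (2 * real h + 1) * e'" using u \<eta> e(1) by (simp add: algebra_simps)
    with inward(1) show ?thesis by (rule that)
  qed
  have "bar_count e' w \<le> 2 * h\<^sup>2" using h e by (intro bar_count_le) auto
  hence "real (bar_count e' w) \<le> real (2 * h\<^sup>2)" by (rule of_nat_mono)
  thus ?thesis using h by simp
qed

section \<open>The count at the endpoint, averaged over the signs of the stages\<close>

context
  fixes e \<delta> :: real and x :: "nat \<Rightarrow> real" and n :: nat
  assumes e: "e > 0" and small: "\<And>i. i < n \<Longrightarrow> \<bar>x i\<bar> \<le> \<delta>"
begin

text \<open>The integer z, one sign per completed stage. Forming it in the integers makes its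
  parity, that of the number of stages, available.\<close>

private definition "zz c = (\<Sum>m<stg e x n. if c m * sg (displacement e x n m) = 1 then 1 else - 1 :: int)"

private lemma zz_real:
  assumes "c \<in> signs (Suc n)"
  shows "real_of_int (zz c) = (\<Sum>m<stg e x n. sg (displacement e x n m) * c m)"
  unfolding zz_def of_int_sum
proof (intro sum.cong refl)
  fix m assume "m \<in> {..<stg e x n}"
  hence "m < Suc n" using stg_le[of e x n] by auto
  from signs_cases[OF assms this] sg_cases[of "displacement e x n m"]
  show "real_of_int (if c m * sg (displacement e x n m) = 1 then 1 else - 1) = sg (displacement e x n m) * c m"
    by auto
qed

private lemma even_zz: "even (zz c) \<longleftrightarrow> even (stg e x n)"
proof -
  have "even (\<Sum>m<k. if P m then 1 else - 1 :: int) \<longleftrightarrow> even k" for k :: nat and P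
    by (induction k) auto
  thus ?thesis unfolding zz_def .
qed

text \<open>z is a sum of K orthogonal signs, so z^2 averages to K, and z is uncorrelated with the
  sign \<open>c K\<close> of the unfinished stage. The average is K/2 for even K and (K + 1)/2 for
  odd K.\<close>

private lemma sum_formal_count:
  "(\<Sum>c\<in>signs (Suc n). formal_count (zz c) (c (stg e x n) * sg (dsp e x n)))
     = 2 ^ Suc n * real ((stg e x n + 1) div 2)"
proof -
  define K where "K = stg e x n"
  define a where "a m = (if m < K then sg (displacement e x n m) else 0)" for m
  have K: "K < Suc n" using stg_le[of e x n] by (simp add: K_def)
  have z: "real_of_int (zz c) = (\<Sum>m<Suc n. a m * c m)" if "c \<in> signs (Suc n)" for c
  proof -
    have "(\<Sum>m<Suc n. a m * c m) = (\<Sum>m<K. a m * c m)"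
      using K by (intro sum.mono_neutral_right) (auto simp: a_def)
    thus ?thesis using zz_real[OF that] by (simp add: a_def K_def)
  qed
  have "(\<Sum>c\<in>signs (Suc n). (real_of_int (zz c))\<^sup>2) = 2 ^ Suc n * (\<Sum>m<Suc n. (a m)\<^sup>2)"
    using z sum_signs_square[of a "Suc n"] by simp
  also have "(\<Sum>m<Suc n. (a m)\<^sup>2) = (\<Sum>m<K. 1)"
    using K by (intro sum.mono_neutral_cong_right) (auto simp: a_def power2_eq_square)
  finally have 1: "(\<Sum>c\<in>signs (Suc n). (real_of_int (zz c))\<^sup>2) = 2 ^ Suc n * real K" by simp
  have "(\<Sum>c\<in>signs (Suc n). real_of_int (zz c) * c K)
      = (\<Sum>c\<in>signs (Suc n). \<Sum>m<Suc n. a m * (c m * c K))"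
    by (intro sum.cong refl) (simp only: z sum_distrib_right mult.assoc)
  also have "\<dots> = (\<Sum>m<Suc n. a m * (\<Sum>c\<in>signs (Suc n). c m * c K))"
    by (subst sum.swap) (simp only: sum_distrib_left)
  also have "\<dots> = 0"
    using K by (intro sum.neutral ballI) (auto simp: a_def sum_signs_mult)
  finally have 2: "(\<Sum>c\<in>signs (Suc n). real_of_int (zz c) * c K) = 0" .
  show ?thesis
  proof (cases "even K")
    case True
    hence "(\<Sum>c\<in>signs (Suc n). formal_count (zz c) (c K * sg (dsp e x n)))
       = (\<Sum>c\<in>signs (Suc n). (real_of_int (zz c))\<^sup>2) / 2"
      using even_zz by (simp add: formal_count_def K_def sum_divide_distrib)
    also have "\<dots> = 2 ^ Suc n * real ((K + 1) div 2)"
      using True unfolding 1 by (auto elim!: evenE)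
    finally show ?thesis by (simp add: K_def)
  next
    case False
    hence "(\<Sum>c\<in>signs (Suc n). formal_count (zz c) (c K * sg (dsp e x n)))
       = (\<Sum>c\<in>signs (Suc n). (real_of_int (zz c))\<^sup>2 / 2 + 1 / 2 + sg (dsp e x n) * (real_of_int (zz c) * c K))"
      using even_zz by (intro sum.cong refl) (simp add: formal_count_def K_def add_divide_distrib)
    also have "\<dots> = (\<Sum>c\<in>signs (Suc n). (real_of_int (zz c))\<^sup>2) / 2 + 2 ^ Suc n / 2
        + sg (dsp e x n) * (\<Sum>c\<in>signs (Suc n). real_of_int (zz c) * c K)"
      by (simp add: sum.distrib sum_divide_distrib sum_distrib_left card_signs del: power_Suc)
    also have "\<dots> = 2 ^ Suc n * real ((K + 1) div 2)"
      using False unfolding 1 2 by (auto elim!: oddE simp: field_simps)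
    finally show ?thesis by (simp add: K_def)
  qed
qed

text \<open>Each completed stage has displacement between \<open>e\<close> and e + \<delta> in
  absolute value and contributes an error of at most \<delta>; the unfinished stage enters
  exactly.\<close>

private lemma flip_approx:
  assumes c: "c \<in> signs (Suc n)"
  shows "\<bar>(\<Sum>i<n. c (stg e x i) * x i) - (e * real_of_int (zz c) + c (stg e x n) * sg (dsp e x n) * \<bar>dsp e x n\<bar>)\<bar>
           \<le> real (stg e x n) * \<delta>"
proof -
  define K where "K = stg e x n"
  have K: "K < Suc n" using stg_le[of e x n] by (simp add: K_def)
  have "(\<Sum>i<n. c (stg e x i) * x i) = (\<Sum>m<Suc n. displacement e x n m * c m)"
    by (rule sum_flip_stage)
  also have "\<dots> = (\<Sum>m<Suc K. displacement e x n m * c m)"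
    using K by (intro sum.mono_neutral_right) (auto simp: displacement_greater K_def)
  also have "\<dots> = (\<Sum>m<K. displacement e x n m * c m) + dsp e x n * c K"
    by (simp add: displacement_last K_def)
  also have "\<dots> - (e * real_of_int (zz c) + c K * sg (dsp e x n) * \<bar>dsp e x n\<bar>)
     = (\<Sum>m<K. (displacement e x n m - e * sg (displacement e x n m)) * c m)"
    unfolding zz_real[OF c] K_def[symmetric]
    by (simp add: sum_distrib_left sum_subtractf algebra_simps) (auto simp: sg_def)
  finally have eq: "(\<Sum>i<n. c (stg e x i) * x i) - (e * real_of_int (zz c) + c K * sg (dsp e x n) * \<bar>dsp e x n\<bar>)
     = (\<Sum>m<K. (displacement e x n m - e * sg (displacement e x n m)) * c m)" .
  have "\<bar>\<Sum>m<K. (displacement e x n m - e * sg (displacement e x n m)) * c m\<bar> \<le> (\<Sum>m<K. \<delta>)"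
  proof (intro order.trans[OF sum_abs] sum_mono)
    fix m assume m: "m \<in> {..<K}"
    hence "e \<le> \<bar>displacement e x n m\<bar>" "\<bar>displacement e x n m\<bar> \<le> e + \<delta>"
      using displacement_bounds[OF e, of m x n \<delta>] small by (auto simp: K_def)
    moreover have "c m = 1 \<or> c m = -1" using signs_cases[OF c, of m] m K by auto
    ultimately show "\<bar>(displacement e x n m - e * sg (displacement e x n m)) * c m\<bar> \<le> \<delta>"
      by (auto simp: sg_def)
  qed
  thus ?thesis using eq by (simp add: K_def)
qed

private lemma sign_last: "c \<in> signs (Suc n) \<Longrightarrow>
   c (stg e x n) * sg (dsp e x n) = 1 \<or> c (stg e x n) * sg (dsp e x n) = -1"
  using signs_cases[of c "Suc n" "stg e x n"] sg_cases[of "dsp e x n"] stg_le[of e x n] by auto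

lemma average_bar_count_ge:
  assumes "0 < e'" "real (stg e x n) * \<delta> < e - e'" "e' < e"
  shows "2 ^ Suc n * real ((stg e x n + 1) div 2)
           \<le> (\<Sum>c\<in>signs (Suc n). real (bar_count e' (\<Sum>i<n. c (stg e x i) * x i)))"
  unfolding sum_formal_count[symmetric]
  by (intro sum_mono formal_count_le_bar_count[OF assms(1,3) sign_last abs_dsp_less[OF e] flip_approx assms(2)])

lemma average_bar_count_le:
  assumes "real (stg e x n) * \<delta> < e' - e" "e < e'"
  shows "(\<Sum>c\<in>signs (Suc n). real (bar_count e' (\<Sum>i<n. c (stg e x i) * x i)))
           \<le> 2 ^ Suc n * real ((stg e x n + 1) div 2)"
  unfolding sum_formal_count[symmetric]
  by (intro sum_mono bar_count_le_formal_count[OF e assms(2) sign_last abs_dsp_less[OF e] flip_approx assms(1)])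

end

section \<open>Bars of a Gaussian walk\<close>

lemma borel_measurable_sg [measurable]: "sg \<in> borel_measurable borel"
  unfolding sg_def[abs_def] by measurable

lemma measurable_stage:
  assumes w: "\<And>j. j < i \<Longrightarrow> (\<lambda>x. w x j) \<in> borel_measurable M"
  shows "(\<lambda>x. stg e (w x) i) \<in> M \<rightarrow>\<^sub>M count_space UNIV"
    and "(\<lambda>x. dsp e (w x) i) \<in> borel_measurable M"
proof -
  have "(\<lambda>x. stg e (w x) i) \<in> M \<rightarrow>\<^sub>M count_space UNIV \<and> (\<lambda>x. dsp e (w x) i) \<in> borel_measurable M"
    using w
  proof (induction i)
    case (Suc i)
    have [measurable]: "(\<lambda>x. stg e (w x) i) \<in> M \<rightarrow>\<^sub>M count_space UNIV"
      "(\<lambda>x. dsp e (w x) i) \<in> borel_measurable M" "(\<lambda>x. w x i) \<in> borel_measurable M"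
      using Suc by auto
    have "(\<lambda>x. stg e (w x) (Suc i)) = (\<lambda>x. if e \<le> \<bar>dsp e (w x) i + w x i\<bar> then Suc (stg e (w x) i) else stg e (w x) i)"
      "(\<lambda>x. dsp e (w x) (Suc i)) = (\<lambda>x. if e \<le> \<bar>dsp e (w x) i + w x i\<bar> then 0 else dsp e (w x) i + w x i)"
      by auto
    thus ?case by simp
  qed simp
  thus "(\<lambda>x. stg e (w x) i) \<in> M \<rightarrow>\<^sub>M count_space UNIV" "(\<lambda>x. dsp e (w x) i) \<in> borel_measurable M"
    by auto
qed

lemma measurable_coupling_sign:
  assumes [measurable]: "m \<in> M \<rightarrow>\<^sub>M count_space UNIV" "u \<in> borel_measurable M"
    "(\<lambda>x. fst (v x)) \<in> borel_measurable M" "(\<lambda>x. snd (v x)) \<in> borel_measurable M"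
  shows "(\<lambda>x. coupling_sign (m x) (u x) (v x)) \<in> borel_measurable M"
  unfolding coupling_sign_def by measurable

lemma measurable_coupled:
  assumes w: "\<And>j. j < i \<Longrightarrow> (\<lambda>x. w x j) \<in> borel_measurable M"
  shows "(\<lambda>x. fst (coupled e (w x) i)) \<in> borel_measurable M"
    "(\<lambda>x. flip_coupled e (w x) i) \<in> borel_measurable M"
proof -
  have fs: "(\<lambda>x. fst (coupled e (w x) i)) \<in> borel_measurable M \<and> (\<lambda>x. snd (coupled e (w x) i)) \<in> borel_measurable M"
    using w
  proof (induction i)
    case (Suc i)
    have 1: "(\<lambda>x. fst (coupled e (w x) i)) \<in> borel_measurable M" "(\<lambda>x. snd (coupled e (w x) i)) \<in> borel_measurable M"
      "(\<lambda>x. w x i) \<in> borel_measurable M" "(\<lambda>x. dsp e (w x) i) \<in> borel_measurable M"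
      using Suc by (auto intro!: measurable_stage)
    have 2: "(\<lambda>x. coupling_sign (stg e (w x) i) (dsp e (w x) i) (coupled e (w x) i)) \<in> borel_measurable M"
      using Suc.prems 1 by (intro measurable_coupling_sign measurable_stage) auto
    have f: "(\<lambda>x. fst (coupled e (w x) (Suc i))) = (\<lambda>x. fst (coupled e (w x) i)
        + coupling_sign (stg e (w x) i) (dsp e (w x) i) (coupled e (w x) i) * w x i)"
      by (simp add: Let_def)
    have s: "(\<lambda>x. snd (coupled e (w x) (Suc i))) = (\<lambda>x. if e \<le> \<bar>dsp e (w x) i + w x i\<bar>
        then sg (fst (coupled e (w x) (Suc i))) else snd (coupled e (w x) i))"
      unfolding coupled.simps(2) Let_def fst_conv snd_conv by (simp add: Let_def)
    have 3 [measurable]: "(\<lambda>x. fst (coupled e (w x) (Suc i))) \<in> borel_measurable M"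
      unfolding f using 1 2 by measurable
    have "(\<lambda>x. snd (coupled e (w x) (Suc i))) \<in> borel_measurable M"
      unfolding s using 1 3 by measurable
    with 3 show ?case by blast
  qed simp
  thus "(\<lambda>x. fst (coupled e (w x) i)) \<in> borel_measurable M" by simp
  show "(\<lambda>x. flip_coupled e (w x) i) \<in> borel_measurable M"
    unfolding flip_coupled_def using fs w by (intro measurable_coupling_sign measurable_stage) auto
qed

lemma measurable_walk_component: "i < n \<Longrightarrow> (\<lambda>x. x i) \<in> borel_measurable (walk_measure \<sigma> n)"
  unfolding measurable_cong_sets[OF sets_walk_measure refl] by (intro measurable_component_singleton) auto

text \<open>For each fixed \<open>c\<close> the factor \<open>c (stg e x i)\<close> is a predictable
  sign, so the flipped endpoint has the original law. Adding this over all \<open>c\<close> brings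
  the average over signs inside the integral.\<close>

lemma nn_integral_stage_signs:
  assumes \<sigma>: "\<sigma> > 0" and [measurable]: "f \<in> borel_measurable borel"
  shows "ennreal (2 ^ Suc n) * (\<integral>\<^sup>+x. f (\<Sum>i<n. x i) \<partial>walk_measure \<sigma> n)
    = (\<integral>\<^sup>+x. (\<Sum>c\<in>signs (Suc n). f (\<Sum>i<n. c (stg e x i) * x i)) \<partial>walk_measure \<sigma> n)"
proof -
  have c1: "c (stg e x i) = 1 \<or> c (stg e x i) = -1" if "c \<in> signs (Suc n)" "i < n" for c i x
    using signs_cases[OF that(1), of "stg e x i"] stg_le[of e x i] that(2) by auto
  have "(\<integral>\<^sup>+x. f (\<Sum>i<n. c (stg e x i) * x i) \<partial>walk_measure \<sigma> n) = (\<integral>\<^sup>+x. f (\<Sum>i<n. x i) \<partial>walk_measure \<sigma> n)"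
    if c: "c \<in> signs (Suc n)" for c
  proof -
    have "(\<integral>\<^sup>+x. f (\<Sum>i<n. (\<lambda>i\<in>{..<n}. c (stg e x i) * x i) i) \<partial>walk_measure \<sigma> n)
        = (\<integral>\<^sup>+x. f (\<Sum>i<n. x i) \<partial>walk_measure \<sigma> n)"
    proof (rule nn_integral_walk_flip[OF \<sigma>, where s = "\<lambda>i x. c (stg e x i)" and f = "\<lambda>x. f (\<Sum>i<n. x i)"])
      show "(\<lambda>x. f (\<Sum>i<n. x i)) \<in> borel_measurable (PiM {..<n} (\<lambda>_. borel))"
        by (rule measurable_compose[OF borel_measurable_sum assms(2)]) (rule measurable_component_singleton)
      show "(\<lambda>x. c (stg e x i)) \<in> borel_measurable (PiM {..<i} (\<lambda>_. borel))" for i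
        by (rule measurable_compose[OF measurable_stage(1)]) (auto intro!: measurable_component_singleton)
      show "c (stg e x i) = c (stg e y i)" if "\<And>j. j < i \<Longrightarrow> x j = y j" for x y i
        using stage_cong[of i x y e] that by simp
    qed (use c1[OF c] in auto)
    thus ?thesis by simp
  qed
  moreover have "(\<lambda>x. f (\<Sum>i<n. c (stg e x i) * x i)) \<in> borel_measurable (walk_measure \<sigma> n)" for c
  proof -
    have "(\<lambda>x. c (stg e x i) * x i) \<in> borel_measurable (walk_measure \<sigma> n)" if "i < n" for i
    proof -
      have "(\<lambda>x. stg e x i) \<in> walk_measure \<sigma> n \<rightarrow>\<^sub>M count_space UNIV"
        using that by (intro measurable_stage measurable_walk_component) auto
      hence [measurable]: "(\<lambda>x. c (stg e x i)) \<in> borel_measurable (walk_measure \<sigma> n)"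
        by (rule measurable_compose) simp
      show ?thesis using measurable_walk_component[OF that, of \<sigma>] by simp
    qed
    thus ?thesis by simp
  qed
  ultimately show ?thesis
    by (subst nn_integral_sum) (auto simp: card_signs ennreal_of_nat_eq_real_of_nat)
qed

definition alternating :: "real \<Rightarrow> nat \<Rightarrow> nat \<Rightarrow> (nat \<Rightarrow> real) \<Rightarrow> bool" where
  "alternating e k n y \<longleftrightarrow> (\<exists>\<tau>. alternates y e \<tau> k \<and> \<tau> k \<le> n)"

abbreviation "walk_alternates e k n w \<equiv> alternating e k n (\<lambda>a. \<bar>w a\<bar>)"

text \<open>The times lie in a finite range and only indices up to \<open>k\<close> matter, so the
  existential quantifier runs over a finite set. Measurability of the event follows from this
  form.\<close>

lemma alternating_iff_finite:
  "alternating e k n y \<longleftrightarrow> (\<exists>\<tau>\<in>PiE {..k} (\<lambda>_. {..n}). \<forall>j\<in>{..<k}.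
     \<tau> j \<le> \<tau> (Suc j) \<and> (-1) ^ j * (y (\<tau> (Suc j)) - y (\<tau> j)) > e)"
proof
  assume "alternating e k n y"
  then obtain \<tau> where \<tau>: "alternates y e \<tau> k" "\<tau> k \<le> n"
    unfolding alternating_def by blast
  have "restrict \<tau> {..k} \<in> PiE {..k} (\<lambda>_. {..n})"
  proof (rule PiE_I)
    fix j assume "j \<in> {..k}"
    thus "restrict \<tau> {..k} j \<in> {..n}"
      using alternates_mono[OF \<tau>(1), of j k] \<tau>(2) by simp
  qed auto
  moreover have "\<forall>j\<in>{..<k}. restrict \<tau> {..k} j \<le> restrict \<tau> {..k} (Suc j) \<and>
      (-1) ^ j * (y (restrict \<tau> {..k} (Suc j)) - y (restrict \<tau> {..k} j)) > e"
    using \<tau>(1) unfolding alternates_def by auto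
  ultimately show "\<exists>\<tau>\<in>PiE {..k} (\<lambda>_. {..n}). \<forall>j\<in>{..<k}.
     \<tau> j \<le> \<tau> (Suc j) \<and> (-1) ^ j * (y (\<tau> (Suc j)) - y (\<tau> j)) > e" by blast
next
  assume "\<exists>\<tau>\<in>PiE {..k} (\<lambda>_. {..n}). \<forall>j\<in>{..<k}.
     \<tau> j \<le> \<tau> (Suc j) \<and> (-1) ^ j * (y (\<tau> (Suc j)) - y (\<tau> j)) > e"
  thus "alternating e k n y"
    unfolding alternating_def alternates_def by (metis PiE_mem atMost_iff lessThan_iff order.refl)
qed

lemma alternating_cong:
  assumes "\<And>i. i \<le> n \<Longrightarrow> y i = y' i"
  shows "alternating e k n y \<longleftrightarrow> alternating e k n y'"
proof -
  have "alternating e k n y'" if "alternating e k n y" and eq: "\<And>i. i \<le> n \<Longrightarrow> y i = y' i" for y y'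
  proof -
    from that(1) obtain \<tau> where \<tau>: "alternates y e \<tau> k" "\<tau> k \<le> n"
      unfolding alternating_def by blast
    have le: "\<tau> j \<le> n" if "j \<le> k" for j
      using alternates_mono[OF \<tau>(1) that order.refl] \<tau>(2) by simp
    have "alternates y' e \<tau> k"
      unfolding alternates_def
    proof (intro allI impI)
      fix j assume j: "j < k"
      have "y (\<tau> j) = y' (\<tau> j)" "y (\<tau> (Suc j)) = y' (\<tau> (Suc j))"
        using j le by (auto intro!: eq)
      with \<tau>(1) j show "\<tau> j \<le> \<tau> (Suc j) \<and> e < (- 1) ^ j * (y' (\<tau> (Suc j)) - y' (\<tau> j))"
        unfolding alternates_def by metis
    qed
    with \<tau>(2) show ?thesis unfolding alternating_def by blast
  qed
  from this[of y y'] this[of y' y] assms show ?thesis by metis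
qed

lemma measurable_alternating:
  assumes [measurable]: "\<And>i. i \<le> n \<Longrightarrow> (\<lambda>x. y x i) \<in> borel_measurable M"
  shows "Measurable.pred M (\<lambda>x. alternating e k n (y x))"
  unfolding alternating_iff_finite
proof (intro pred_intros_finite(4) pred_intros_finite(3) finite_PiE)
  fix \<tau> j assume \<tau>: "\<tau> \<in> PiE {..k} (\<lambda>_. {..n})" "j \<in> {..<k}"
  have [measurable]: "(\<lambda>x. y x (\<tau> j)) \<in> borel_measurable M" "(\<lambda>x. y x (\<tau> (Suc j))) \<in> borel_measurable M"
    using \<tau> by (auto intro!: assms simp: PiE_iff)
  show "Measurable.pred M (\<lambda>x. \<tau> j \<le> \<tau> (Suc j) \<and> e < (- 1) ^ j * (y x (\<tau> (Suc j)) - y x (\<tau> j)))"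
    by measurable
qed auto

definition big_step :: "real \<Rightarrow> nat \<Rightarrow> (nat \<Rightarrow> real) \<Rightarrow> bool" where
  "big_step \<delta> n x \<longleftrightarrow> (\<exists>i\<in>{..<n}. \<bar>x i\<bar> > \<delta>)"

lemma measurable_big_step:
  assumes [measurable]: "\<And>i. i < n \<Longrightarrow> (\<lambda>x. w x i) \<in> borel_measurable M"
  shows "Measurable.pred M (\<lambda>x. big_step \<delta> n (w x))"
  unfolding big_step_def by (intro pred_intros_finite(4)) auto

context
  fixes \<sigma> e :: real and n :: nat
  assumes \<sigma>: "\<sigma> > 0" and e: "e > 0"
begin

lemma measurable_walk_stg [measurable]: "(\<lambda>x. stg e x n) \<in> walk_measure \<sigma> n \<rightarrow>\<^sub>M count_space UNIV"
  by (intro measurable_stage measurable_walk_component)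

lemma measurable_walk_coupled: "i \<le> n \<Longrightarrow> (\<lambda>x. fst (coupled e x i)) \<in> borel_measurable (walk_measure \<sigma> n)"
  by (intro measurable_coupled measurable_walk_component) auto

lemma pred_big_step [measurable]: "Measurable.pred (walk_measure \<sigma> n) (\<lambda>x. big_step \<delta> n x)"
  by (rule measurable_big_step) (rule measurable_walk_component)

lemma pred_coupled_alternates [measurable]:
  "Measurable.pred (walk_measure \<sigma> n) (\<lambda>x. walk_alternates a k n (\<lambda>i. fst (coupled e x i)))"
  by (rule measurable_alternating, rule borel_measurable_abs, rule measurable_walk_coupled)

text \<open>The coupled walk is the partial sum of predictably flipped steps. Hence it has the law
  of the walk itself, although the two paths differ for a given \<open>x\<close>.\<close>

lemma nn_integral_coupled_alternates:
  "(\<integral>\<^sup>+x. of_bool (walk_alternates a k n (\<lambda>i. fst (coupled e x i))) \<partial>walk_measure \<sigma> n)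
   = (\<integral>\<^sup>+x. of_bool (walk_alternates a k n (\<lambda>i. \<Sum>j<i. x j)) \<partial>walk_measure \<sigma> n)"
proof -
  define f :: "(nat \<Rightarrow> real) \<Rightarrow> ennreal" where "f x = of_bool (walk_alternates a k n (\<lambda>i. \<Sum>j<i. x j))" for x
  have pr: "Measurable.pred (PiM {..<n} (\<lambda>_. borel)) (\<lambda>x. walk_alternates a k n (\<lambda>i. \<Sum>j<i. x j :: real))"
    by (rule measurable_alternating, rule borel_measurable_abs, rule borel_measurable_sum, rule measurable_component_singleton) auto
  have 1: "(\<integral>\<^sup>+x. f (\<lambda>i\<in>{..<n}. flip_coupled e x i * x i) \<partial>walk_measure \<sigma> n) = (\<integral>\<^sup>+x. f x \<partial>walk_measure \<sigma> n)"
  proof (rule nn_integral_walk_flip[OF \<sigma>, where s = "\<lambda>i x. flip_coupled e x i" and f = f])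
    show "f \<in> borel_measurable (PiM {..<n} (\<lambda>_. borel))"
      unfolding f_def of_bool_def using pr by measurable
    show "(\<lambda>x. flip_coupled e x i) \<in> borel_measurable (PiM {..<i} (\<lambda>_. borel))" for i
      by (intro measurable_coupled measurable_component_singleton) auto
    show "flip_coupled e x i = flip_coupled e y i" if "\<And>j. j < i \<Longrightarrow> x j = y j" for i and x y :: "nat \<Rightarrow> real"
      using coupled_cong[of i x y e] stage_cong[of i x y e] that by (simp add: flip_coupled_def)
  qed (rule flip_coupled_cases)
  have 2: "f (\<lambda>i\<in>{..<n}. flip_coupled e x i * x i) = of_bool (walk_alternates a k n (\<lambda>i. fst (coupled e x i)))" for x
  proof -
    have "walk_alternates a k n (\<lambda>i. \<Sum>j<i. (\<lambda>i\<in>{..<n}. flip_coupled e x i * x i) j)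
        = walk_alternates a k n (\<lambda>i. \<Sum>j<i. flip_coupled e x j * x j)"
      by (rule alternating_cong, rule arg_cong[of _ _ abs], rule sum.cong) auto
    thus ?thesis by (simp only: f_def coupled_eq_sum)
  qed
  from 1 show ?thesis by (simp only: 2) (simp only: f_def)
qed

lemma stage_count_le:
  assumes \<delta>: "0 < \<delta>" "4 * \<delta> \<le> e" and "\<not> big_step \<delta> n x" "walk_alternates (e + \<delta>) k n (\<lambda>i. fst (coupled e x i))"
  shows "k \<le> stg e x n"
proof -
  have "\<bar>x i\<bar> \<le> \<delta>" if "i < n" for i using that assms(3) by (force simp: big_step_def)
  from alternates_coupled_le_stg[where n = n and x = x, OF \<delta> this] assms(4) show ?thesis
    unfolding alternating_def by blast
qed

lemma stage_count_ge:
  assumes \<delta>: "0 < \<delta>" "4 * \<delta> \<le> e" and "\<not> big_step \<delta> n x" "k \<le> stg e x n"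
  shows "walk_alternates (e - 4 * \<delta>) k n (\<lambda>i. fst (coupled e x i))"
proof -
  have "\<bar>x i\<bar> \<le> \<delta>" if "i < n" for i using that assms(3) by (force simp: big_step_def)
  from alternates_coupled_exists[where n = n and x = x, OF \<delta> this] obtain \<tau> where
    \<tau>: "alternates (\<lambda>a. \<bar>fst (coupled e x a)\<bar>) (e - 4 * \<delta>) \<tau> (stg e x n)" "\<tau> (stg e x n) \<le> n" by auto
  have "\<tau> k \<le> n" using alternates_mono[OF \<tau>(1) assms(4) order.refl] \<tau>(2) by simp
  with alternates_shorten[OF \<tau>(1) assms(4)] show ?thesis unfolding alternating_def by blast
qed

text \<open>A Chebyshev bound that ignores the size of the steps. Averaged over the stage signs, the
  squared endpoint is the sum of the squared displacements, which is at least e^2 for each completed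
  stage. The right-hand side depends only on the law of the endpoint, so the bound is uniform in the
  mesh.\<close>

lemma stage_count_tail:
  "ennreal (e\<^sup>2 * real A) * (\<integral>\<^sup>+x. of_bool (stg e x n > A) \<partial>walk_measure \<sigma> n)
     \<le> (\<integral>\<^sup>+x. ennreal ((\<Sum>i<n. x i)\<^sup>2) \<partial>walk_measure \<sigma> n)"
proof -
  have 1: "ennreal (2 ^ Suc n) * (ennreal (e\<^sup>2 * real A) * (\<integral>\<^sup>+x. of_bool (stg e x n > A) \<partial>walk_measure \<sigma> n))
      = (\<integral>\<^sup>+x. ennreal (2 ^ Suc n) * (ennreal (e\<^sup>2 * real A) * of_bool (stg e x n > A)) \<partial>walk_measure \<sigma> n)"
  proof -
    have [measurable]: "(\<lambda>x. of_bool (stg e x n > A) :: ennreal) \<in> borel_measurable (walk_measure \<sigma> n)"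
      unfolding of_bool_def by measurable
    show ?thesis by (simp only: nn_integral_cmult borel_measurable_times_ennreal borel_measurable_const \<open>(\<lambda>x. of_bool (stg e x n > A) :: ennreal) \<in> _\<close>)
  qed
  have 2: "(\<integral>\<^sup>+x. ennreal (2 ^ Suc n) * (ennreal (e\<^sup>2 * real A) * of_bool (stg e x n > A)) \<partial>walk_measure \<sigma> n)
      \<le> (\<integral>\<^sup>+x. (\<Sum>c\<in>signs (Suc n). ennreal ((\<Sum>i<n. c (stg e x i) * x i)\<^sup>2)) \<partial>walk_measure \<sigma> n)"
  proof (rule nn_integral_mono)
    fix x
    have "e\<^sup>2 * real (stg e x n) = (\<Sum>m<stg e x n. e\<^sup>2)" by simp
    also have "\<dots> \<le> (\<Sum>m<stg e x n. (displacement e x n m)\<^sup>2)"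
      by (intro sum_mono abs_le_square_iff[THEN iffD1]) (use displacement_ge[OF e] e in auto)
    also have "\<dots> \<le> (\<Sum>m<Suc n. (displacement e x n m)\<^sup>2)"
      using stg_le[of e x n] by (intro sum_mono2) auto
    finally have "2 ^ Suc n * (e\<^sup>2 * real (stg e x n)) \<le> 2 ^ Suc n * (\<Sum>m<Suc n. (displacement e x n m)\<^sup>2)"
      by (intro mult_left_mono) auto
    also have "\<dots> = (\<Sum>c\<in>signs (Suc n). (\<Sum>m<Suc n. displacement e x n m * c m)\<^sup>2)"
      by (rule sum_signs_square[symmetric])
    also have "\<dots> = (\<Sum>c\<in>signs (Suc n). (\<Sum>i<n. c (stg e x i) * x i)\<^sup>2)"
      by (intro sum.cong refl arg_cong[of _ _ "\<lambda>z. z\<^sup>2"] sum_flip_stage[symmetric])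
    finally have *: "2 ^ Suc n * (e\<^sup>2 * real (stg e x n)) \<le> (\<Sum>c\<in>signs (Suc n). (\<Sum>i<n. c (stg e x i) * x i)\<^sup>2)" .
    show "ennreal (2 ^ Suc n) * (ennreal (e\<^sup>2 * real A) * of_bool (stg e x n > A))
        \<le> (\<Sum>c\<in>signs (Suc n). ennreal ((\<Sum>i<n. c (stg e x i) * x i)\<^sup>2))"
    proof (cases "stg e x n > A")
      case True
      have "2 ^ Suc n * (e\<^sup>2 * real A) \<le> 2 ^ Suc n * (e\<^sup>2 * real (stg e x n))"
        using True by (intro mult_left_mono) auto
      from order.trans[OF this *]
      have le: "ennreal (2 ^ Suc n * (e\<^sup>2 * real A)) \<le> ennreal (\<Sum>c\<in>signs (Suc n). (\<Sum>i<n. c (stg e x i) * x i)\<^sup>2)"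
        by (rule ennreal_leI)
      have "ennreal (2 ^ Suc n) * ennreal (e\<^sup>2 * real A) = ennreal (2 ^ Suc n * (e\<^sup>2 * real A))"
        by (rule ennreal_mult[symmetric]) auto
      also note le
      also have "ennreal (\<Sum>c\<in>signs (Suc n). (\<Sum>i<n. c (stg e x i) * x i)\<^sup>2)
          = (\<Sum>c\<in>signs (Suc n). ennreal ((\<Sum>i<n. c (stg e x i) * x i)\<^sup>2))"
        by (rule sum_ennreal[symmetric]) simp
      finally show ?thesis using True by (simp only: of_bool_eq mult_1_right)
    qed simp
  qed
  have 3: "(\<integral>\<^sup>+x. (\<Sum>c\<in>signs (Suc n). ennreal ((\<Sum>i<n. c (stg e x i) * x i)\<^sup>2)) \<partial>walk_measure \<sigma> n)
      = ennreal (2 ^ Suc n) * (\<integral>\<^sup>+x. ennreal ((\<Sum>i<n. x i)\<^sup>2) \<partial>walk_measure \<sigma> n)"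
    by (rule nn_integral_stage_signs[OF \<sigma>, where f = "\<lambda>w. ennreal (w\<^sup>2)", symmetric]) measurable
  show ?thesis
    using 2[folded 1, unfolded 3] by (subst (asm) ennreal_mult_le_mult_iff) (simp_all add: ennreal_eq_0_iff not_le)
qed

end

lemma bar_count_measurable [measurable]: "(\<lambda>w. bar_count e w) \<in> borel \<rightarrow>\<^sub>M count_space UNIV"
  unfolding bar_count_def by measurable

text \<open>Bar number \<open>k\<close>, counted from 0, requires 2k + 1 alternations; K
  alternations therefore give (K + 1) div 2 bars.\<close>

lemma sum_odd_le_count: "(\<Sum>k<N. of_bool (2 * k + 1 \<le> K)) \<le> (K + 1) div (2::nat)"
proof -
  have "(\<Sum>k<N. of_bool (2 * k + 1 \<le> K)) = card ({..<N} \<inter> {k. 2 * k + 1 \<le> K})"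
    by (simp add: sum_of_bool_eq)
  also have "\<dots> \<le> card {..<(K + 1) div 2}"
    by (intro card_mono) auto
  finally show ?thesis by simp
qed

lemma sum_odd_ge_count: "K \<le> N \<Longrightarrow> (K + 1) div (2::nat) \<le> (\<Sum>k<N. of_bool (2 * k + 1 \<le> K))"
proof -
  assume "K \<le> N"
  hence "card {..<(K + 1) div 2} \<le> card ({..<N} \<inter> {k. 2 * k + 1 \<le> K})"
    by (intro card_mono) auto
  also have "\<dots> = (\<Sum>k<N. of_bool (2 * k + 1 \<le> K))"
    by (simp add: sum_of_bool_eq)
  finally show ?thesis by simp
qed

lemma ennreal_cancel_power2:
  "ennreal (2 ^ n) * x \<le> ennreal (2 ^ n) * y \<longleftrightarrow> x \<le> y"
  by (subst ennreal_mult_le_mult_iff) (simp_all add: ennreal_eq_0_iff not_le)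

section \<open>Number of alternations against the count at the endpoint\<close>

context
  fixes \<sigma> e \<delta> :: real and n A :: nat
  assumes \<sigma>: "\<sigma> > 0" and e: "e > 0" and \<delta>: "0 < \<delta>" "4 * \<delta> \<le> e"
begin

private lemma small: "\<not> big_step \<delta> n x \<Longrightarrow> i < n \<Longrightarrow> \<bar>x i\<bar> \<le> \<delta>"
  by (force simp: big_step_def)

private abbreviation "S x \<equiv> (\<lambda>i. \<Sum>j<i. x j :: real)"
private abbreviation "V x \<equiv> (\<lambda>i. fst (coupled e x i))"

private lemma measurable_of_bool_pred:
  "Measurable.pred M P \<Longrightarrow> (\<lambda>x. of_bool (P x) :: ennreal) \<in> borel_measurable M"
  unfolding of_bool_def by measurable

private lemma meas_V: "(\<lambda>x. of_bool (walk_alternates a k n (V x)) :: ennreal) \<in> borel_measurable (walk_measure \<sigma> n)"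
  by (intro measurable_of_bool_pred pred_coupled_alternates[OF \<sigma> e])

private lemma meas_exc: "(\<lambda>x. of_bool (big_step \<delta> n x \<or> stg e x n > A) :: ennreal) \<in> borel_measurable (walk_measure \<sigma> n)"
proof -
  note [measurable] = pred_big_step[OF \<sigma> e] measurable_walk_stg[OF \<sigma> e]
  show ?thesis by (intro measurable_of_bool_pred) measurable
qed

private lemma meas_good: "(\<lambda>x. of_nat ((stg e x n + 1) div 2) * of_bool (\<not> (big_step \<delta> n x \<or> stg e x n > A)) :: ennreal)
   \<in> borel_measurable (walk_measure \<sigma> n)"
proof -
  note [measurable] = pred_big_step[OF \<sigma> e] measurable_walk_stg[OF \<sigma> e]
  have "(\<lambda>x. of_bool (\<not> (big_step \<delta> n x \<or> stg e x n > A)) :: ennreal) \<in> borel_measurable (walk_measure \<sigma> n)"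
    by (intro measurable_of_bool_pred) measurable
  moreover have "(\<lambda>x. of_nat ((stg e x n + 1) div 2) :: ennreal) \<in> borel_measurable (walk_measure \<sigma> n)"
    by (rule measurable_compose[OF measurable_walk_stg[OF \<sigma> e]]) simp
  ultimately show ?thesis by (rule borel_measurable_times_ennreal[rotated])
qed

text \<open>Off the exceptional event at most \<open>A\<close> overshoots of size \<delta> add up,
  less than the gap e - e'. On it the number of bars is bounded only by the truncation
  \<open>N\<close>.\<close>

lemma walk_count_upper:
  assumes "0 < e'" "e' < e" "real A * \<delta> < e - e'"
  shows "(\<Sum>k<N. \<integral>\<^sup>+x. of_bool (walk_alternates (e + \<delta>) (2 * k + 1) n (S x)) \<partial>walk_measure \<sigma> n)
    \<le> (\<integral>\<^sup>+x. of_nat (bar_count e' (\<Sum>i<n. x i)) \<partial>walk_measure \<sigma> n)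
      + of_nat N * (\<integral>\<^sup>+x. of_bool (big_step \<delta> n x \<or> stg e x n > A) \<partial>walk_measure \<sigma> n)"
proof -
  have avg: "(\<integral>\<^sup>+x. of_nat ((stg e x n + 1) div 2) * of_bool (\<not> (big_step \<delta> n x \<or> stg e x n > A)) \<partial>walk_measure \<sigma> n)
     \<le> (\<integral>\<^sup>+x. of_nat (bar_count e' (\<Sum>i<n. x i)) \<partial>walk_measure \<sigma> n)"
  proof -
    have 1: "ennreal (2 ^ Suc n) * (\<integral>\<^sup>+x. of_nat ((stg e x n + 1) div 2) * of_bool (\<not> (big_step \<delta> n x \<or> stg e x n > A)) \<partial>walk_measure \<sigma> n)
      = (\<integral>\<^sup>+x. ennreal (2 ^ Suc n) * (of_nat ((stg e x n + 1) div 2) * of_bool (\<not> (big_step \<delta> n x \<or> stg e x n > A))) \<partial>walk_measure \<sigma> n)"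
      by (rule nn_integral_cmult[OF meas_good, symmetric])
    have 2: "(\<integral>\<^sup>+x. ennreal (2 ^ Suc n) * (of_nat ((stg e x n + 1) div 2) * of_bool (\<not> (big_step \<delta> n x \<or> stg e x n > A))) \<partial>walk_measure \<sigma> n)
      \<le> (\<integral>\<^sup>+x. (\<Sum>c\<in>signs (Suc n). of_nat (bar_count e' (\<Sum>i<n. c (stg e x i) * x i))) \<partial>walk_measure \<sigma> n)"
    proof (rule nn_integral_mono)
      fix x
      show "ennreal (2 ^ Suc n) * (of_nat ((stg e x n + 1) div 2) * of_bool (\<not> (big_step \<delta> n x \<or> stg e x n > A)))
         \<le> (\<Sum>c\<in>signs (Suc n). of_nat (bar_count e' (\<Sum>i<n. c (stg e x i) * x i)))"
      proof (cases "big_step \<delta> n x \<or> stg e x n > A")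
        case False
        have "real (stg e x n) * \<delta> \<le> real A * \<delta>" using False \<delta> by (intro mult_right_mono) auto
        hence "real (stg e x n) * \<delta> < e - e'" using assms by simp
        hence "2 ^ Suc n * real ((stg e x n + 1) div 2)
           \<le> (\<Sum>c\<in>signs (Suc n). real (bar_count e' (\<Sum>i<n. c (stg e x i) * x i)))"
          using False small by (intro average_bar_count_ge[OF e _ assms(1) _ assms(2)]) auto
        from ennreal_leI[OF this]
        have "ennreal (2 ^ Suc n) * ennreal (real ((stg e x n + 1) div 2))
           \<le> (\<Sum>c\<in>signs (Suc n). ennreal (real (bar_count e' (\<Sum>i<n. c (stg e x i) * x i))))"
          by (subst (asm) ennreal_mult) (simp_all only: sum_ennreal of_nat_0_le_iff zero_le_power zero_le_numeral)
        thus ?thesis using False by (simp only: ennreal_of_nat_eq_real_of_nat) (simp del: power_Suc)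
      qed simp
    qed
    have 3: "ennreal (2 ^ Suc n) * (\<integral>\<^sup>+x. of_nat (bar_count e' (\<Sum>i<n. x i)) \<partial>walk_measure \<sigma> n)
      = (\<integral>\<^sup>+x. (\<Sum>c\<in>signs (Suc n). of_nat (bar_count e' (\<Sum>i<n. c (stg e x i) * x i))) \<partial>walk_measure \<sigma> n)"
      by (rule nn_integral_stage_signs[OF \<sigma>, where f = "\<lambda>w. of_nat (bar_count e' w)"]) measurable
    show ?thesis using 2[folded 1 3] unfolding ennreal_cancel_power2 .
  qed
  have "(\<Sum>k<N. \<integral>\<^sup>+x. of_bool (walk_alternates (e + \<delta>) (2 * k + 1) n (S x)) \<partial>walk_measure \<sigma> n)
    = (\<integral>\<^sup>+x. (\<Sum>k<N. of_bool (walk_alternates (e + \<delta>) (2 * k + 1) n (V x))) \<partial>walk_measure \<sigma> n)"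
    by (subst nn_integral_sum) (use meas_V nn_integral_coupled_alternates[OF \<sigma> e] in auto)
  also have "\<dots> \<le> (\<integral>\<^sup>+x. of_nat ((stg e x n + 1) div 2) * of_bool (\<not> (big_step \<delta> n x \<or> stg e x n > A))
      + of_nat N * of_bool (big_step \<delta> n x \<or> stg e x n > A) \<partial>walk_measure \<sigma> n)"
  proof (rule nn_integral_mono)
    fix x
    show "(\<Sum>k<N. of_bool (walk_alternates (e + \<delta>) (2 * k + 1) n (V x)) :: ennreal)
      \<le> of_nat ((stg e x n + 1) div 2) * of_bool (\<not> (big_step \<delta> n x \<or> stg e x n > A))
        + of_nat N * of_bool (big_step \<delta> n x \<or> stg e x n > A)"
    proof (cases "big_step \<delta> n x \<or> stg e x n > A")
      case True
      have "(\<Sum>k<N. of_bool (walk_alternates (e + \<delta>) (2 * k + 1) n (V x)) :: ennreal) \<le> (\<Sum>k<N. 1)"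
        by (intro sum_mono) auto
      with True show ?thesis by simp
    next
      case False
      have "(\<Sum>k<N. of_bool (walk_alternates (e + \<delta>) (2 * k + 1) n (V x)) :: ennreal)
          \<le> (\<Sum>k<N. of_bool (2 * k + 1 \<le> stg e x n))"
        using False stage_count_le[OF \<sigma> e \<delta>] by (intro sum_mono) auto
      also have "\<dots> = of_nat (\<Sum>k<N. of_bool (2 * k + 1 \<le> stg e x n))"
        by simp
      also have "\<dots> \<le> of_nat ((stg e x n + 1) div 2)"
        by (rule of_nat_mono[OF sum_odd_le_count])
      finally show ?thesis using False by simp
    qed
  qed
  also have "\<dots> = (\<integral>\<^sup>+x. of_nat ((stg e x n + 1) div 2) * of_bool (\<not> (big_step \<delta> n x \<or> stg e x n > A)) \<partial>walk_measure \<sigma> n)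
      + (\<integral>\<^sup>+x. of_nat N * of_bool (big_step \<delta> n x \<or> stg e x n > A) \<partial>walk_measure \<sigma> n)"
    by (rule nn_integral_add[OF meas_good]) (intro borel_measurable_times_ennreal borel_measurable_const meas_exc)
  also have "(\<integral>\<^sup>+x. of_nat N * of_bool (big_step \<delta> n x \<or> stg e x n > A) \<partial>walk_measure \<sigma> n)
      = of_nat N * (\<integral>\<^sup>+x. of_bool (big_step \<delta> n x \<or> stg e x n > A) \<partial>walk_measure \<sigma> n)"
    by (rule nn_integral_cmult[OF meas_exc])
  finally show ?thesis using add_right_mono[OF avg] by (rule order.trans)
qed

text \<open>Now the endpoint count has to be controlled on the exceptional event, hence its
  truncation at \<open>L\<close>. Off that event there are at most \<open>A\<close> stages, so
  \<open>A\<close> terms of the sum see all of them.\<close>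

lemma walk_count_lower:
  assumes "e < e'" "real A * \<delta> < e' - e"
  shows "(\<integral>\<^sup>+x. of_nat (min L (bar_count e' (\<Sum>i<n. x i))) \<partial>walk_measure \<sigma> n)
    \<le> (\<Sum>k<A. \<integral>\<^sup>+x. of_bool (walk_alternates (e - 4 * \<delta>) (2 * k + 1) n (S x)) \<partial>walk_measure \<sigma> n)
      + of_nat L * (\<integral>\<^sup>+x. of_bool (big_step \<delta> n x \<or> stg e x n > A) \<partial>walk_measure \<sigma> n)"
proof -
  let ?g = "\<lambda>x. of_nat ((stg e x n + 1) div 2) * of_bool (\<not> (big_step \<delta> n x \<or> stg e x n > A))
      + of_nat L * of_bool (big_step \<delta> n x \<or> stg e x n > A) :: ennreal"
  have g: "?g \<in> borel_measurable (walk_measure \<sigma> n)"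
    by (intro borel_measurable_add borel_measurable_times_ennreal borel_measurable_const meas_exc meas_good)
  have avg: "(\<integral>\<^sup>+x. of_nat (min L (bar_count e' (\<Sum>i<n. x i))) \<partial>walk_measure \<sigma> n) \<le> (\<integral>\<^sup>+x. ?g x \<partial>walk_measure \<sigma> n)"
  proof -
    have 1: "ennreal (2 ^ Suc n) * (\<integral>\<^sup>+x. ?g x \<partial>walk_measure \<sigma> n)
      = (\<integral>\<^sup>+x. ennreal (2 ^ Suc n) * ?g x \<partial>walk_measure \<sigma> n)"
      by (rule nn_integral_cmult[OF g, symmetric])
    have 2: "(\<integral>\<^sup>+x. (\<Sum>c\<in>signs (Suc n). of_nat (min L (bar_count e' (\<Sum>i<n. c (stg e x i) * x i)))) \<partial>walk_measure \<sigma> n)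
        \<le> (\<integral>\<^sup>+x. ennreal (2 ^ Suc n) * ?g x \<partial>walk_measure \<sigma> n)"
    proof (rule nn_integral_mono)
      fix x
      show "(\<Sum>c\<in>signs (Suc n). of_nat (min L (bar_count e' (\<Sum>i<n. c (stg e x i) * x i)))) \<le> ennreal (2 ^ Suc n) * ?g x"
      proof (cases "big_step \<delta> n x \<or> stg e x n > A")
        case False
        have "real (stg e x n) * \<delta> \<le> real A * \<delta>" using False \<delta> by (intro mult_right_mono) auto
        hence "real (stg e x n) * \<delta> < e' - e" using assms by simp
        hence "(\<Sum>c\<in>signs (Suc n). real (bar_count e' (\<Sum>i<n. c (stg e x i) * x i)))
            \<le> 2 ^ Suc n * real ((stg e x n + 1) div 2)"
          using False small by (intro average_bar_count_le[OF e _ _ assms(1)]) auto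
        from ennreal_leI[OF this]
        have "(\<Sum>c\<in>signs (Suc n). ennreal (real (bar_count e' (\<Sum>i<n. c (stg e x i) * x i))))
            \<le> ennreal (2 ^ Suc n) * ennreal (real ((stg e x n + 1) div 2))"
          by (subst (asm) ennreal_mult) (simp_all only: sum_ennreal of_nat_0_le_iff zero_le_power zero_le_numeral)
        hence "(\<Sum>c\<in>signs (Suc n). of_nat (bar_count e' (\<Sum>i<n. c (stg e x i) * x i))) \<le> ennreal (2 ^ Suc n) * ?g x"
          using False by (simp only: ennreal_of_nat_eq_real_of_nat) (simp del: power_Suc)
        moreover have "(\<Sum>c\<in>signs (Suc n). of_nat (min L (bar_count e' (\<Sum>i<n. c (stg e x i) * x i))) :: ennreal)
           \<le> (\<Sum>c\<in>signs (Suc n). of_nat (bar_count e' (\<Sum>i<n. c (stg e x i) * x i)))"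
          by (intro sum_mono of_nat_mono) simp
        ultimately show ?thesis by (rule order.trans[rotated])
      next
        case True
        have "(\<Sum>c\<in>signs (Suc n). of_nat (min L (bar_count e' (\<Sum>i<n. c (stg e x i) * x i))) :: ennreal)
           \<le> (\<Sum>c\<in>signs (Suc n). of_nat L)"
          by (intro sum_mono of_nat_mono) simp
        also have "\<dots> = ennreal (2 ^ Suc n) * of_nat L"
          by (simp add: card_signs ennreal_of_nat_eq_real_of_nat del: power_Suc)
        finally show ?thesis using True by simp
      qed
    qed
    have 3: "ennreal (2 ^ Suc n) * (\<integral>\<^sup>+x. of_nat (min L (bar_count e' (\<Sum>i<n. x i))) \<partial>walk_measure \<sigma> n)
      = (\<integral>\<^sup>+x. (\<Sum>c\<in>signs (Suc n). of_nat (min L (bar_count e' (\<Sum>i<n. c (stg e x i) * x i)))) \<partial>walk_measure \<sigma> n)"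
      by (rule nn_integral_stage_signs[OF \<sigma>, where f = "\<lambda>w. of_nat (min L (bar_count e' w))"]) measurable
    show ?thesis using 2[folded 1 3] unfolding ennreal_cancel_power2 .
  qed
  have "(\<integral>\<^sup>+x. ?g x \<partial>walk_measure \<sigma> n)
    \<le> (\<integral>\<^sup>+x. (\<Sum>k<A. of_bool (walk_alternates (e - 4 * \<delta>) (2 * k + 1) n (V x)))
        + of_nat L * of_bool (big_step \<delta> n x \<or> stg e x n > A) \<partial>walk_measure \<sigma> n)"
  proof (intro nn_integral_mono add_right_mono)
    fix x
    show "of_nat ((stg e x n + 1) div 2) * of_bool (\<not> (big_step \<delta> n x \<or> stg e x n > A))
        \<le> (\<Sum>k<A. of_bool (walk_alternates (e - 4 * \<delta>) (2 * k + 1) n (V x)) :: ennreal)"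
    proof (cases "big_step \<delta> n x \<or> stg e x n > A")
      case False
      have "(of_nat ((stg e x n + 1) div 2) :: ennreal) \<le> of_nat (\<Sum>k<A. of_bool (2 * k + 1 \<le> stg e x n))"
        using False by (intro of_nat_mono sum_odd_ge_count) simp
      also have "\<dots> = (\<Sum>k<A. of_bool (2 * k + 1 \<le> stg e x n))" by simp
      also have "\<dots> \<le> (\<Sum>k<A. of_bool (walk_alternates (e - 4 * \<delta>) (2 * k + 1) n (V x)))"
        using False stage_count_ge[OF \<sigma> e \<delta>] by (intro sum_mono) auto
      finally show ?thesis using False by simp
    qed simp
  qed
  also have "\<dots> = (\<integral>\<^sup>+x. (\<Sum>k<A. of_bool (walk_alternates (e - 4 * \<delta>) (2 * k + 1) n (V x))) \<partial>walk_measure \<sigma> n)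
      + (\<integral>\<^sup>+x. of_nat L * of_bool (big_step \<delta> n x \<or> stg e x n > A) \<partial>walk_measure \<sigma> n)"
    by (rule nn_integral_add) (intro borel_measurable_sum borel_measurable_times_ennreal borel_measurable_const meas_exc meas_V)+
  also have "(\<integral>\<^sup>+x. of_nat L * of_bool (big_step \<delta> n x \<or> stg e x n > A) \<partial>walk_measure \<sigma> n)
      = of_nat L * (\<integral>\<^sup>+x. of_bool (big_step \<delta> n x \<or> stg e x n > A) \<partial>walk_measure \<sigma> n)"
    by (rule nn_integral_cmult[OF meas_exc])
  also have "(\<integral>\<^sup>+x. (\<Sum>k<A. of_bool (walk_alternates (e - 4 * \<delta>) (2 * k + 1) n (V x))) \<partial>walk_measure \<sigma> n)
     = (\<Sum>k<A. \<integral>\<^sup>+x. of_bool (walk_alternates (e - 4 * \<delta>) (2 * k + 1) n (S x)) \<partial>walk_measure \<sigma> n)"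
    by (subst nn_integral_sum) (use meas_V nn_integral_coupled_alternates[OF \<sigma> e] in auto)
  finally show ?thesis using avg by (rule order.trans[rotated])
qed

lemma exceptional_bound:
  assumes "A > 0"
  shows "(\<integral>\<^sup>+x. of_bool (big_step \<delta> n x \<or> stg e x n > A) \<partial>walk_measure \<sigma> n)
    \<le> (\<integral>\<^sup>+x. of_bool (big_step \<delta> n x) \<partial>walk_measure \<sigma> n)
      + (\<integral>\<^sup>+x. ennreal ((\<Sum>i<n. x i)\<^sup>2) \<partial>walk_measure \<sigma> n) / ennreal (e\<^sup>2 * real A)"
proof -
  have m: "(\<lambda>x. of_bool (stg e x n > A) :: ennreal) \<in> borel_measurable (walk_measure \<sigma> n)"
    by (intro measurable_of_bool_pred measurable_compose[OF measurable_walk_stg[OF \<sigma> e]]) simp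
  have mb: "(\<lambda>x. of_bool (big_step \<delta> n x) :: ennreal) \<in> borel_measurable (walk_measure \<sigma> n)"
    by (intro measurable_of_bool_pred pred_big_step[OF \<sigma> e])
  have "(\<integral>\<^sup>+x. of_bool (big_step \<delta> n x \<or> stg e x n > A) \<partial>walk_measure \<sigma> n)
    \<le> (\<integral>\<^sup>+x. of_bool (big_step \<delta> n x) + of_bool (stg e x n > A) \<partial>walk_measure \<sigma> n)"
    by (intro nn_integral_mono) auto
  also have "\<dots> = (\<integral>\<^sup>+x. of_bool (big_step \<delta> n x) \<partial>walk_measure \<sigma> n) + (\<integral>\<^sup>+x. of_bool (stg e x n > A) \<partial>walk_measure \<sigma> n)"
    by (rule nn_integral_add[OF mb m])
  finally have 1: "(\<integral>\<^sup>+x. of_bool (big_step \<delta> n x \<or> stg e x n > A) \<partial>walk_measure \<sigma> n) \<le> \<dots>" .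
  have pos: "ennreal (e\<^sup>2 * real A) \<noteq> 0" "ennreal (e\<^sup>2 * real A) \<noteq> \<top>"
    using e assms by (auto simp: ennreal_eq_0_iff not_le)
  have "ennreal (e\<^sup>2 * real A) * (\<integral>\<^sup>+x. of_bool (stg e x n > A) \<partial>walk_measure \<sigma> n) / ennreal (e\<^sup>2 * real A)
     \<le> (\<integral>\<^sup>+x. ennreal ((\<Sum>i<n. x i)\<^sup>2) \<partial>walk_measure \<sigma> n) / ennreal (e\<^sup>2 * real A)"
    by (rule divide_right_mono_ennreal[OF stage_count_tail[OF \<sigma> e]])
  hence "(\<integral>\<^sup>+x. of_bool (stg e x n > A) \<partial>walk_measure \<sigma> n)
     \<le> (\<integral>\<^sup>+x. ennreal ((\<Sum>i<n. x i)\<^sup>2) \<partial>walk_measure \<sigma> n) / ennreal (e\<^sup>2 * real A)"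
    unfolding mult.commute[of "ennreal (e\<^sup>2 * real A)"] ennreal_mult_divide_eq[OF pos] .
  with 1 show ?thesis by (meson add_left_mono order.trans)
qed

end

section \<open>Bars of a continuous path\<close>

definition chain :: "(real \<Rightarrow> real) \<Rightarrow> real \<Rightarrow> nat \<Rightarrow> real \<Rightarrow> bool" where
  "chain y e k r \<longleftrightarrow> (\<exists>\<tau>. alternates y e \<tau> k \<and> 0 \<le> \<tau> 0 \<and> \<tau> k \<le> r)"

lemma chain_mono: "chain y e k r \<Longrightarrow> e' \<le> e \<Longrightarrow> r \<le> r' \<Longrightarrow> chain y e' k r'"
  unfolding chain_def by (meson alternates_mono_bound order.trans)

lemma rise_time_eq_drop_time: "rise_time x \<epsilon> s = drop_time (\<lambda>u. - x u) \<epsilon> s"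
  unfolding rise_time_def drop_time_def by (simp add: Inf_real_def image_image algebra_simps)

lemma drop_time_ge: "s \<le> drop_time x \<epsilon> s"
  unfolding drop_time_def by (intro Inf_greatest) auto

context
  fixes x :: "real \<Rightarrow> real"
  assumes cont: "continuous_on {0..} x"
begin

private lemma bdd:
  assumes "0 \<le> s" shows "bdd_above (x ` {v. s \<le> ereal v \<and> v \<le> u})"
proof -
  have "compact (x ` {0..u})"
    by (intro compact_continuous_image continuous_on_subset[OF cont]) auto
  hence "bdd_above (x ` {0..u})" by (intro bounded_imp_bdd_above compact_imp_bounded)
  thus ?thesis
    by (rule bdd_above_mono) (use assms in \<open>auto intro!: imageI dest: order.trans[of 0 s]\<close>)
qed

lemma drop_time_le:
  assumes "0 \<le> s" "s \<le> ereal a" "a \<le> b" "x a - x b > \<epsilon>"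
  shows "drop_time x \<epsilon> s \<le> ereal b"
proof -
  have "x a \<le> (SUP v\<in>{v. s \<le> ereal v \<and> v \<le> b}. x v)"
    using assms by (intro cSUP_upper bdd) auto
  moreover have "s \<le> ereal b" using assms(2,3) by (metis ereal_less_eq(3) order.trans)
  ultimately show ?thesis unfolding drop_time_def using assms(4) by (intro Inf_lower) auto
qed

lemma drop_time_lessD:
  assumes "0 \<le> s" "drop_time x \<epsilon> s < ereal r"
  obtains a b where "s \<le> ereal a" "a \<le> b" "b < r" "x a - x b > \<epsilon>"
proof -
  from assms(2) obtain u where u: "s \<le> ereal u" "(SUP v\<in>{v. s \<le> ereal v \<and> v \<le> u}. x v) - x u > \<epsilon>" "u < r"
    unfolding drop_time_def by (auto simp: Inf_less_iff)
  have "x u + \<epsilon> < (SUP v\<in>{v. s \<le> ereal v \<and> v \<le> u}. x v)" using u by simp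
  then obtain v where "s \<le> ereal v" "v \<le> u" "x u + \<epsilon> < x v"
    using u bdd[OF assms(1)] by (subst (asm) less_cSUP_iff) auto
  thus ?thesis using u that[of v u] by auto
qed

end

text \<open>Both kinds of hitting times in one sequence: odd indices are the times T, even ones the
  times S, all expressed as drop times of x or -x.\<close>

primrec greedy_time :: "(real \<Rightarrow> real) \<Rightarrow> real \<Rightarrow> nat \<Rightarrow> ereal" where
  "greedy_time x \<epsilon> 0 = 0"
| "greedy_time x \<epsilon> (Suc j) = drop_time (\<lambda>u. (-1) ^ j * x u) \<epsilon> (greedy_time x \<epsilon> j)"

lemma bar_time_eq_greedy_time: "bar_time x \<epsilon> k = greedy_time x \<epsilon> (2 * k)"
  by (induction k) (simp_all add: rise_time_eq_drop_time)

lemma greedy_time_nonneg: "0 \<le> greedy_time x \<epsilon> j"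
proof (induction j)
  case (Suc j)
  thus ?case unfolding greedy_time.simps by (rule order.trans[OF _ drop_time_ge])
qed simp

text \<open>Greedy hitting is earliest: by induction each move of the chain starts after the current
  greedy time, and its end is then a candidate in the next infimum.\<close>

lemma greedy_time_le:
  assumes cont: "continuous_on {0..} x" and "alternates (\<lambda>u. - x u) \<epsilon> \<tau> j" "0 \<le> \<tau> 0"
  shows "greedy_time x \<epsilon> j \<le> ereal (\<tau> j)"
  using assms(2)
proof (induction j)
  case (Suc j)
  have "greedy_time x \<epsilon> j \<le> ereal (\<tau> j)"
    using Suc.prems by (intro Suc.IH, elim alternates_shorten) auto
  moreover have "\<tau> j \<le> \<tau> (Suc j)" "(-1) ^ j * x (\<tau> j) - (-1) ^ j * x (\<tau> (Suc j)) > \<epsilon>"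
    using Suc.prems unfolding alternates_def by (auto simp: algebra_simps)
  moreover have "continuous_on {0..} (\<lambda>u. (-1) ^ j * x u)" by (intro continuous_intros cont)
  ultimately show ?case unfolding greedy_time.simps using greedy_time_nonneg
    by (intro drop_time_le) auto
qed (use assms in \<open>simp add: zero_ereal_def\<close>)

text \<open>A hitting time is an infimum that need not realise the strict inequality. The chain
  obtained by induction may therefore end slightly after the start \<open>a\<close> of the next
  drop; continuity at \<open>a\<close> leaves room for this.\<close>

lemma greedy_time_lessD:
  assumes cont: "continuous_on {0..} x" and \<epsilon>: "\<epsilon> > 0" and "greedy_time x \<epsilon> j < ereal r"
  shows "\<exists>\<tau>. alternates (\<lambda>u. - x u) \<epsilon> \<tau> j \<and> 0 \<le> \<tau> 0 \<and> \<tau> j < r"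
  using assms(3)
proof (induction j arbitrary: r)
  case 0
  thus ?case by (intro exI[of _ "\<lambda>_. 0"]) (auto simp: alternates_def zero_ereal_def)
next
  case (Suc j)
  define y where "y = (\<lambda>u. (-1) ^ j * x u)"
  have conty: "continuous_on {0..} y" unfolding y_def by (intro continuous_intros cont)
  from Suc.prems have "drop_time y \<epsilon> (greedy_time x \<epsilon> j) < ereal r" by (simp add: y_def)
  then obtain a b where ab: "greedy_time x \<epsilon> j \<le> ereal a" "a \<le> b" "b < r" "y a - y b > \<epsilon>"
    by (rule drop_time_lessD[OF conty greedy_time_nonneg])
  have "0 \<le> ereal a" using greedy_time_nonneg ab(1) by (rule order.trans)
  hence a0: "0 \<le> a" by (simp add: zero_ereal_def)
  have "a < b" using ab \<epsilon> by (cases "a = b") auto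
  define h where "h = y a - y b - \<epsilon>"
  have "h > 0" using ab by (simp add: h_def)
  with conty a0 obtain d where d: "d > 0" "\<And>c. c \<ge> 0 \<Longrightarrow> dist c a < d \<Longrightarrow> dist (y c) (y a) < h"
    unfolding continuous_on_iff by (meson atLeast_iff)
  \<comment> \<open>Starting anywhere in [a, a'), the drop down to \<open>b\<close> still exceeds
    \<epsilon>.\<close>
  define a' where "a' = min (a + d) b"
  have aa': "a < a'" using d \<open>a < b\<close> by (simp add: a'_def)
  have near: "y c - y b > \<epsilon>" if "a \<le> c" "c < a'" for c
  proof -
    have "dist c a < d" using that by (simp add: a'_def dist_real_def)
    from d(2)[OF _ this] a0 that show ?thesis by (simp add: dist_real_def h_def)
  qed
  have "greedy_time x \<epsilon> j < ereal a'" using ab(1) aa' by (simp add: le_less_trans)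
  from Suc.IH[OF this] obtain \<tau> where \<tau>: "alternates (\<lambda>u. - x u) \<epsilon> \<tau> j" "0 \<le> \<tau> 0" "\<tau> j < a'"
    by blast
  \<comment> \<open>Either the chain ends where the drop to \<open>b\<close> can start, or it ends
    before \<open>a\<close> at a smaller value of \<open>y\<close>. In the latter case its last time
    is moved to \<open>a\<close>, which widens the preceding move.\<close>
  have "\<exists>\<tau>. alternates (\<lambda>u. - x u) \<epsilon> \<tau> j \<and> 0 \<le> \<tau> 0 \<and> \<tau> j \<le> b \<and> y (\<tau> j) - y b > \<epsilon>"
  proof (cases "y (\<tau> j) - y b > \<epsilon>")
    case True
    with \<tau> show ?thesis by (intro exI[of _ \<tau>]) (auto simp: a'_def)
  next
    case False
    hence "\<tau> j < a" using near[of "\<tau> j"] \<tau>(3) by force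
    moreover have "y (\<tau> j) \<le> y a" using False ab by simp
    ultimately have "alternates (\<lambda>u. - x u) \<epsilon> (\<tau>(j := a)) j"
      using \<tau>(1) by (intro alternates_update_last) (auto simp: y_def)
    with \<tau>(2) a0 ab show ?thesis by (intro exI[of _ "\<tau>(j := a)"]) auto
  qed
  then obtain \<tau> where \<tau>: "alternates (\<lambda>u. - x u) \<epsilon> \<tau> j" "0 \<le> \<tau> 0" "\<tau> j \<le> b" "y (\<tau> j) - y b > \<epsilon>"
    by blast
  have "alternates (\<lambda>u. - x u) \<epsilon> (\<tau>(Suc j := b)) (Suc j)"
    using \<tau> by (intro alternates_snoc) (auto simp: y_def algebra_simps)
  moreover have "(\<tau>(Suc j := b)) 0 = \<tau> 0" "(\<tau>(Suc j := b)) (Suc j) = b" by simp_all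
  ultimately show ?case using \<tau>(2) ab(3) by metis
qed

text \<open>At the infimum itself the strict excess need not be attained yet, so the event is
  visible only through chains that end arbitrarily soon after \<open>t\<close>.\<close>

lemma bar_time_le_iff:
  assumes cont: "continuous_on {0..} x" and \<epsilon>: "\<epsilon> > 0" and "k > 0"
  shows "bar_time x \<epsilon> k \<le> ereal t \<longleftrightarrow> (\<forall>m. chain (\<lambda>u. - x u) \<epsilon> (2 * k) (t + 1 / real (Suc m)))"
proof
  assume le: "bar_time x \<epsilon> k \<le> ereal t"
  show "\<forall>m. chain (\<lambda>u. - x u) \<epsilon> (2 * k) (t + 1 / real (Suc m))"
  proof
    fix m
    have "ereal t < ereal (t + 1 / real (Suc m))" by simp
    with le have "greedy_time x \<epsilon> (2 * k) < ereal (t + 1 / real (Suc m))"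
      unfolding bar_time_eq_greedy_time by (rule le_less_trans)
    from greedy_time_lessD[OF cont \<epsilon> this] show "chain (\<lambda>u. - x u) \<epsilon> (2 * k) (t + 1 / real (Suc m))"
      unfolding chain_def by (meson less_imp_le)
  qed
next
  assume *: "\<forall>m. chain (\<lambda>u. - x u) \<epsilon> (2 * k) (t + 1 / real (Suc m))"
  have le: "bar_time x \<epsilon> k \<le> ereal (t + 1 / real (Suc m))" for m
  proof -
    from * obtain \<tau> where \<tau>: "alternates (\<lambda>u. - x u) \<epsilon> \<tau> (2 * k)" "0 \<le> \<tau> 0" "\<tau> (2 * k) \<le> t + 1 / real (Suc m)"
      unfolding chain_def by blast
    have "greedy_time x \<epsilon> (2 * k) \<le> ereal (\<tau> (2 * k))" by (rule greedy_time_le[OF cont \<tau>(1,2)])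
    also have "\<dots> \<le> ereal (t + 1 / real (Suc m))" using \<tau>(3) by simp
    finally show ?thesis unfolding bar_time_eq_greedy_time .
  qed
  have "(\<lambda>m. t + 1 / real (Suc m)) \<longlonglongrightarrow> t + 0"
    by (intro tendsto_add tendsto_const LIMSEQ_Suc[OF lim_1_over_n])
  hence "(\<lambda>m. ereal (t + 1 / real (Suc m))) \<longlonglongrightarrow> ereal t" by simp
  thus "bar_time x \<epsilon> k \<le> ereal t"
    by (rule LIMSEQ_le_const) (use le in auto)
qed

text \<open>By uniform continuity a move of more than \<open>e\<close> takes at least some fixed
  time \<open>d\<close>. This makes the set under \<open>Max\<close> in \<open>num_bars\<close>
  finite.\<close>

lemma chain_length_bound:
  assumes cont: "continuous_on {0..} y" and e: "e > 0"
  obtains C where "\<And>k. chain y e k r \<Longrightarrow> k \<le> C"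
proof -
  have "uniformly_continuous_on {0..r} y"
    by (intro compact_uniformly_continuous continuous_on_subset[OF cont]) auto
  then obtain d where d: "d > 0" "\<And>a b. a \<in> {0..r} \<Longrightarrow> b \<in> {0..r} \<Longrightarrow> dist a b < d \<Longrightarrow> dist (y a) (y b) < e"
    unfolding uniformly_continuous_on_def using e by metis
  have "k \<le> nat \<lceil>r / d\<rceil>" if "chain y e k r" for k
  proof -
    from that obtain \<tau> where \<tau>: "alternates y e \<tau> k" "0 \<le> \<tau> 0" "\<tau> k \<le> r" unfolding chain_def by blast
    have "real j * d \<le> \<tau> j" if "j \<le> k" for j
      using that
    proof (induction j)
      case (Suc j)
      have j: "\<tau> j \<le> \<tau> (Suc j)" "(-1) ^ j * (y (\<tau> (Suc j)) - y (\<tau> j)) > e"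
        using \<tau>(1) Suc.prems unfolding alternates_def by auto
      have "\<tau> (Suc j) \<le> \<tau> k" "\<tau> 0 \<le> \<tau> j"
        using Suc.prems by (auto intro!: alternates_mono[OF \<tau>(1)])
      hence in_r: "\<tau> j \<in> {0..r}" "\<tau> (Suc j) \<in> {0..r}" using \<tau> j by auto
      have "dist (y (\<tau> j)) (y (\<tau> (Suc j))) > e"
        using j(2) by (cases "even j") (auto simp: dist_real_def)
      hence "\<not> dist (\<tau> j) (\<tau> (Suc j)) < d" using d(2)[OF in_r] by auto
      with j(1) Suc show ?case by (simp add: dist_real_def algebra_simps)
    qed (use \<tau> in simp)
    from this[of k] \<tau>(3) have "real k * d \<le> r" by simp
    hence "real k \<le> r / d" using d(1) by (simp add: pos_le_divide_eq)
    thus ?thesis by linarith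
  qed
  thus ?thesis using that by blast
qed

lemma bar_time_Suc_ge: "bar_time x \<epsilon> k \<le> bar_time x \<epsilon> (Suc k)"
  unfolding bar_time.simps rise_time_eq_drop_time by (intro order.trans[OF drop_time_ge drop_time_ge])

lemma bar_time_mono: "i \<le> j \<Longrightarrow> bar_time x \<epsilon> i \<le> bar_time x \<epsilon> j"
proof (induction j rule: dec_induct)
  case (step n)
  show ?case using step.IH bar_time_Suc_ge[of x \<epsilon> n] by (rule order.trans)
qed simp

text \<open>Slot 0 is given to the infinite bar: \<open>bar_time\<close> at index 0 is 0 and adds
  nothing to the maximum, so the index is free for the range condition.\<close>

definition bar_event :: "(real \<Rightarrow> real) \<Rightarrow> real \<Rightarrow> real \<Rightarrow> nat \<Rightarrow> bool" where
  "bar_event x t \<epsilon> k \<longleftrightarrow> (if k = 0 then path_range x t \<ge> \<epsilon> else bar_time x \<epsilon> k \<le> ereal t)"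

lemma num_bars_eq_sum:
  assumes cont: "continuous_on {0..} x" and \<epsilon>: "\<epsilon> > 0" and t: "t \<ge> 0"
  obtains C where "\<And>N. N \<ge> C \<Longrightarrow> num_bars x t \<epsilon> = (\<Sum>k<N. of_bool (bar_event x t \<epsilon> k))"
proof -
  have contm: "continuous_on {0..} (\<lambda>u. - x u)" by (intro continuous_intros cont)
  obtain C where C: "\<And>k. chain (\<lambda>u. - x u) \<epsilon> k (t + 1) \<Longrightarrow> k \<le> C"
    using chain_length_bound[OF contm \<epsilon>] by blast
  define A where "A = {k. bar_time x \<epsilon> k \<le> ereal t}"
  have bound: "k \<le> C" if "k \<in> A" for k
  proof (cases "k = 0")
    case False
    with that have "chain (\<lambda>u. - x u) \<epsilon> (2 * k) (t + 1 / real (Suc 0))"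
      unfolding A_def using bar_time_le_iff[OF cont \<epsilon>, of k t] by blast
    from C[of "2 * k"] this show ?thesis by simp
  qed simp
  have fin: "finite A" by (rule finite_subset[of _ "{..C}"]) (use bound in auto)
  have "0 \<in> A" using t by (simp add: A_def zero_ereal_def)
  \<comment> \<open>The set is an initial segment, so its maximum equals the number of its positive
    elements.\<close>
  have A_eq: "A = {..Max A}"
  proof (intro equalityI subsetI)
    fix k assume "k \<in> {..Max A}"
    hence "bar_time x \<epsilon> k \<le> bar_time x \<epsilon> (Max A)" by (intro bar_time_mono) simp
    moreover have "Max A \<in> A" using fin \<open>0 \<in> A\<close> by (intro Max_in) auto
    ultimately show "k \<in> A" by (metis (mono_tags, lifting) A_def mem_Collect_eq order.trans)
  qed (use fin in auto)
  show ?thesis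
  proof (rule that)
    fix N assume N: "N \<ge> Suc C"
    then obtain N' where N': "N = Suc N'" "C \<le> N'" by (cases N) auto
    have "(\<Sum>k<N. of_bool (bar_event x t \<epsilon> k)) = of_bool (path_range x t \<ge> \<epsilon>) + (\<Sum>k<N'. of_bool (Suc k \<in> A) :: nat)"
      unfolding N'(1) sum.lessThan_Suc_shift by (simp add: bar_event_def A_def del: bar_time.simps(2))
    also have "(\<Sum>k<N'. of_bool (Suc k \<in> A) :: nat) = card ({..<N'} \<inter> {k. Suc k \<in> A})"
      by (simp add: sum_of_bool_eq)
    also have "{..<N'} \<inter> {k. Suc k \<in> A} = {..<Max A}"
    proof -
      have "Suc k \<in> A \<longleftrightarrow> k < Max A" for k by (subst A_eq) auto
      moreover have "k < N'" if "Suc k \<in> A" for k using bound[OF that] N'(2) by simp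
      ultimately show ?thesis by blast
    qed
    finally show "num_bars x t \<epsilon> = (\<Sum>k<N. of_bool (bar_event x t \<epsilon> k))"
      by (simp add: num_bars_def A_def)
  qed
qed

section \<open>Bars as alternating chains of a path\<close>

context
  fixes x :: "real \<Rightarrow> real" and t :: real
  assumes cont: "continuous_on {0..} x" and t: "t > 0"
begin

private lemma range_bdd: "bdd_above (x ` {0..t})" "bdd_below (x ` {0..t})"
proof -
  have "compact (x ` {0..t})"
    by (intro compact_continuous_image continuous_on_subset[OF cont]) auto
  hence "bounded (x ` {0..t})" by (rule compact_imp_bounded)
  thus "bdd_above (x ` {0..t})" "bdd_below (x ` {0..t})"
    by (auto intro: bounded_imp_bdd_above bounded_imp_bdd_below)
qed

lemma path_range_ge: "a \<in> {0..t} \<Longrightarrow> b \<in> {0..t} \<Longrightarrow> x b - x a \<le> path_range x t"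
  unfolding path_range_def by (intro diff_mono cSUP_upper cINF_lower range_bdd)

lemma path_range_greaterD:
  assumes "path_range x t > e"
  obtains a b where "a \<in> {0..t}" "b \<in> {0..t}" "x b - x a > e"
proof -
  have ne: "{0..t} \<noteq> {}" using t by simp
  have "e + (INF s\<in>{0..t}. x s) < (SUP s\<in>{0..t}. x s)" using assms by (simp add: path_range_def)
  then obtain b where b: "b \<in> {0..t}" "e + (INF s\<in>{0..t}. x s) < x b"
    using less_cSUP_iff[OF ne range_bdd(1)] by blast
  have "(INF s\<in>{0..t}. x s) < x b - e" using b by simp
  then obtain a where "a \<in> {0..t}" "x a < x b - e"
    using cINF_less_iff[OF ne range_bdd(2)] by blast
  thus ?thesis using b by (intro that[of a b]) auto
qed

lemma chain_1_iff: "chain y e 1 r \<longleftrightarrow> (\<exists>a b. 0 \<le> a \<and> a \<le> b \<and> b \<le> r \<and> y b - y a > e)"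
proof
  assume "chain y e 1 r"
  thus "\<exists>a b. 0 \<le> a \<and> a \<le> b \<and> b \<le> r \<and> y b - y a > e"
    unfolding chain_def alternates_def by auto
next
  assume "\<exists>a b. 0 \<le> a \<and> a \<le> b \<and> b \<le> r \<and> y b - y a > e"
  then obtain a b where "0 \<le> a \<and> a \<le> b \<and> b \<le> r \<and> y b - y a > e" by blast
  thus "chain y e 1 r"
    unfolding chain_def alternates_def by (intro exI[of _ "\<lambda>j. if j = 0 then a else b"]) auto
qed

text \<open>The minimum and the maximum may come in either order, hence two chains; chains are
  strict and the range condition is not, hence the vanishing tolerance. The form is chosen for
  measurability.\<close>

lemma path_range_ge_iff:
  "path_range x t \<ge> \<epsilon> \<longleftrightarrow>
     (\<forall>m. chain x (\<epsilon> - 1 / real (Suc m)) 1 t \<or> chain (\<lambda>u. - x u) (\<epsilon> - 1 / real (Suc m)) 1 t)"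
proof
  assume le: "path_range x t \<ge> \<epsilon>"
  show "\<forall>m. chain x (\<epsilon> - 1 / real (Suc m)) 1 t \<or> chain (\<lambda>u. - x u) (\<epsilon> - 1 / real (Suc m)) 1 t"
  proof
    fix m
    have "path_range x t > \<epsilon> - 1 / real (Suc m)"
      using le by (smt (verit) divide_pos_pos of_nat_0_less_iff zero_less_Suc)
    then obtain a b where ab: "a \<in> {0..t}" "b \<in> {0..t}" "x b - x a > \<epsilon> - 1 / real (Suc m)"
      by (rule path_range_greaterD)
    show "chain x (\<epsilon> - 1 / real (Suc m)) 1 t \<or> chain (\<lambda>u. - x u) (\<epsilon> - 1 / real (Suc m)) 1 t"
    proof (cases "a \<le> b")
      case True
      with ab show ?thesis unfolding chain_1_iff by (intro disjI1 exI[of _ a] exI[of _ b]) auto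
    next
      case False
      with ab show ?thesis unfolding chain_1_iff by (intro disjI2 exI[of _ b] exI[of _ a]) auto
    qed
  qed
next
  assume *: "\<forall>m. chain x (\<epsilon> - 1 / real (Suc m)) 1 t \<or> chain (\<lambda>u. - x u) (\<epsilon> - 1 / real (Suc m)) 1 t"
  have le: "\<epsilon> - 1 / real (Suc m) \<le> path_range x t" for m
  proof -
    obtain a b where ab: "a \<in> {0..t}" "b \<in> {0..t}" "x b - x a > \<epsilon> - 1 / real (Suc m)"
    proof -
      have "\<exists>a\<in>{0..t}. \<exists>b\<in>{0..t}. x b - x a > \<epsilon> - 1 / real (Suc m)"
        using *[rule_format, of m] unfolding chain_1_iff
      proof (elim disjE exE conjE)
        fix a b assume "0 \<le> a" "a \<le> b" "b \<le> t" "\<epsilon> - 1 / real (Suc m) < x b - x a"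
        thus ?thesis by (intro bexI[of _ a] bexI[of _ b]) auto
      next
        fix a b assume "0 \<le> a" "a \<le> b" "b \<le> t" "\<epsilon> - 1 / real (Suc m) < - x b - - x a"
        thus ?thesis by (intro bexI[of _ b] bexI[of _ a]) auto
      qed
      thus ?thesis using that by blast
    qed
    with path_range_ge[OF ab(1,2)] show ?thesis by linarith
  qed
  have "(\<lambda>m. \<epsilon> - 1 / real (Suc m)) \<longlonglongrightarrow> \<epsilon> - 0"
    by (intro tendsto_diff tendsto_const LIMSEQ_Suc[OF lim_1_over_n])
  hence "(\<lambda>m. \<epsilon> - 1 / real (Suc m)) \<longlonglongrightarrow> \<epsilon>" by simp
  thus "path_range x t \<ge> \<epsilon>"
    by (rule LIMSEQ_le_const2) (use le in auto)
qed

text \<open>Without its first rise, a chain of 2k + 1 moves becomes one of 2k moves that begins with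
  a fall, as in the definition of the hitting times.\<close>

lemma bar_event_of_chain:
  assumes \<epsilon>: "\<epsilon> > 0" and "chain x \<epsilon> (2 * k + 1) t"
  shows "bar_event x t \<epsilon> k"
proof -
  from assms(2) obtain \<tau> where \<tau>: "alternates x \<epsilon> \<tau> (2 * k + 1)" "0 \<le> \<tau> 0" "\<tau> (2 * k + 1) \<le> t"
    unfolding chain_def by blast
  have m: "\<tau> 0 \<le> \<tau> 1" "\<tau> 1 \<le> \<tau> (2 * k + 1)" by (intro alternates_mono[OF \<tau>(1)]; simp)+
  show ?thesis
  proof (cases "k = 0")
    case True
    have "x (\<tau> 1) - x (\<tau> 0) > \<epsilon>" using \<tau>(1) unfolding alternates_def by auto
    moreover have "x (\<tau> 1) - x (\<tau> 0) \<le> path_range x t"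
      using \<tau> m by (intro path_range_ge) auto
    ultimately show ?thesis using True by (simp add: bar_event_def)
  next
    case False
    have "alternates (\<lambda>u. - x u) \<epsilon> (\<lambda>j. \<tau> (Suc j)) (2 * k)"
      unfolding alternates_def
    proof (intro allI impI)
      fix j assume "j < 2 * k"
      with \<tau>(1) have "\<tau> (Suc j) \<le> \<tau> (Suc (Suc j)) \<and> \<epsilon> < (- 1) ^ (Suc j) * (x (\<tau> (Suc (Suc j))) - x (\<tau> (Suc j)))"
        unfolding alternates_def by auto
      thus "\<tau> (Suc j) \<le> \<tau> (Suc (Suc j)) \<and> \<epsilon> < (- 1) ^ j * (- x (\<tau> (Suc (Suc j))) - - x (\<tau> (Suc j)))"
        by (simp add: algebra_simps)
    qed
    moreover have "0 \<le> \<tau> (Suc 0)" using \<tau>(2) m by simp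
    ultimately have "greedy_time x \<epsilon> (2 * k) \<le> ereal (\<tau> (Suc (2 * k)))"
      by (rule greedy_time_le[OF cont, where \<tau> = "\<lambda>j. \<tau> (Suc j)"])
    also have "\<dots> \<le> ereal t" using \<tau>(3) by simp
    finally show ?thesis using False by (simp add: bar_event_def bar_time_eq_greedy_time)
  qed
qed

text \<open>Starting at 0 and staying nonnegative supplies the missing first rise: the point from
  which the path falls by more than \<epsilon> lies above \<epsilon>, and time 0 can be put before
  it. For the infinite bar, time 0 likewise replaces the place of the minimum. Passing to a smaller
  \<epsilon>' and a later \<open>r\<close> pays for strictness and for the infimum.\<close>

lemma chain_of_bar_event:
  assumes nonneg: "\<And>s. s \<ge> 0 \<Longrightarrow> x s \<ge> 0" and x0: "x 0 = 0"
    and \<epsilon>: "0 < \<epsilon>'" "\<epsilon>' < \<epsilon>" and r: "t < r" and ev: "bar_event x t \<epsilon> k"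
  shows "chain x \<epsilon>' (2 * k + 1) r"
proof (cases "k = 0")
  case True
  hence "path_range x t > \<epsilon>'" using ev \<epsilon> by (simp add: bar_event_def)
  then obtain a b where ab: "a \<in> {0..t}" "b \<in> {0..t}" "x b - x a > \<epsilon>'" by (rule path_range_greaterD)
  have "x b - x 0 > \<epsilon>'" using ab nonneg[of a] x0 by auto
  hence "chain x \<epsilon>' 1 r" unfolding chain_1_iff using ab r by (intro exI[of _ 0] exI[of _ b]) auto
  thus ?thesis using True by simp
next
  case False
  have "bar_time x \<epsilon> k \<le> ereal t" using ev False by (simp add: bar_event_def)
  also have "\<dots> < ereal r" using r by simp
  finally have "greedy_time x \<epsilon> (2 * k) < ereal r" by (simp add: bar_time_eq_greedy_time)
  then obtain \<tau> where \<tau>: "alternates (\<lambda>u. - x u) \<epsilon> \<tau> (2 * k)" "0 \<le> \<tau> 0" "\<tau> (2 * k) < r"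
    using greedy_time_lessD[OF cont, of \<epsilon> "2 * k" r] \<epsilon> by auto
  define \<tau>' where "\<tau>' = case_nat 0 \<tau>"
  have first: "x (\<tau> 0) > \<epsilon>"
  proof -
    have "\<tau> 0 \<le> \<tau> 1" "- x (\<tau> 1) - - x (\<tau> 0) > \<epsilon>"
      using \<tau>(1) False unfolding alternates_def by (auto dest: spec[of _ 0])
    thus ?thesis using nonneg[of "\<tau> 1"] \<tau>(2) by linarith
  qed
  have "alternates x \<epsilon> \<tau>' (2 * k + 1)"
    unfolding alternates_def
  proof (intro allI impI)
    fix j assume j: "j < 2 * k + 1"
    show "\<tau>' j \<le> \<tau>' (Suc j) \<and> \<epsilon> < (- 1) ^ j * (x (\<tau>' (Suc j)) - x (\<tau>' j))"
    proof (cases j)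
      case 0
      thus ?thesis using first \<tau>(2) x0 by (simp add: \<tau>'_def)
    next
      case (Suc i)
      hence "\<tau> i \<le> \<tau> (Suc i) \<and> \<epsilon> < (- 1) ^ i * (- x (\<tau> (Suc i)) - - x (\<tau> i))"
        using \<tau>(1) j unfolding alternates_def by auto
      thus ?thesis by (simp add: \<tau>'_def Suc algebra_simps)
    qed
  qed
  hence "chain x \<epsilon> (2 * k + 1) r"
    unfolding chain_def using \<tau> by (intro exI[of _ \<tau>']) (auto simp: \<tau>'_def)
  thus ?thesis by (rule chain_mono) (use \<epsilon> in auto)
qed

lemma num_bars_lower:
  assumes \<epsilon>: "\<epsilon> > 0"
  shows "(\<Sum>k<N. of_bool (chain x \<epsilon> (2 * k + 1) t)) \<le> num_bars x t \<epsilon>"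
proof -
  obtain C where C: "\<And>N. N \<ge> C \<Longrightarrow> num_bars x t \<epsilon> = (\<Sum>k<N. of_bool (bar_event x t \<epsilon> k))"
    using num_bars_eq_sum[OF cont \<epsilon>, of t] t by auto
  have "(\<Sum>k<N. of_bool (chain x \<epsilon> (2 * k + 1) t)) \<le> (\<Sum>k<max C N. of_bool (chain x \<epsilon> (2 * k + 1) t) :: nat)"
    by (intro sum_mono2) auto
  also have "\<dots> \<le> (\<Sum>k<max C N. of_bool (bar_event x t \<epsilon> k))"
    using bar_event_of_chain[OF \<epsilon>] by (intro sum_mono) auto
  also have "\<dots> = num_bars x t \<epsilon>" by (rule C[symmetric]) simp
  finally show ?thesis .
qed

lemma num_bars_upper:
  assumes nonneg: "\<And>s. s \<ge> 0 \<Longrightarrow> x s \<ge> 0" and x0: "x 0 = 0"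
    and \<epsilon>: "0 < \<epsilon>'" "\<epsilon>' < \<epsilon>" and r: "t < r"
  shows "\<exists>N. num_bars x t \<epsilon> \<le> (\<Sum>k<N. of_bool (chain x \<epsilon>' (2 * k + 1) r))"
proof -
  have \<epsilon>0: "\<epsilon> > 0" using \<epsilon> by simp
  obtain C where C: "\<And>N. N \<ge> C \<Longrightarrow> num_bars x t \<epsilon> = (\<Sum>k<N. of_bool (bar_event x t \<epsilon> k))"
    using num_bars_eq_sum[OF cont \<epsilon>0, of t] t by auto
  have "num_bars x t \<epsilon> = (\<Sum>k<C. of_bool (bar_event x t \<epsilon> k))" by (rule C) simp
  also have "\<dots> \<le> (\<Sum>k<C. of_bool (chain x \<epsilon>' (2 * k + 1) r))"
    using chain_of_bar_event[OF nonneg x0 \<epsilon> r] by (intro sum_mono) auto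
  finally show ?thesis by blast
qed

end

section \<open>Expected number of bars of reflected Brownian motion\<close>

definition grid :: "real \<Rightarrow> nat \<Rightarrow> nat \<Rightarrow> real" where
  "grid r n i = r * real i / 2 ^ n"

lemma chain_of_grid:
  assumes r: "r \<ge> 0" and "alternating e k (2 ^ n) (\<lambda>i. y (grid r n i))"
  shows "chain y e k r"
proof -
  from assms(2) obtain \<tau> where \<tau>: "alternates (\<lambda>i. y (grid r n i)) e \<tau> k" "\<tau> k \<le> 2 ^ n"
    unfolding alternating_def by blast
  have mono: "grid r n i \<le> grid r n j" if "i \<le> j" for i j
    unfolding grid_def using that r by (intro divide_right_mono mult_left_mono) auto
  have "alternates y e (\<lambda>j. grid r n (\<tau> j)) k"
    using \<tau>(1) mono unfolding alternates_def by auto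
  moreover have "0 \<le> grid r n (\<tau> 0)" using r by (simp add: grid_def)
  moreover have "grid r n (\<tau> k) \<le> r"
    using mono[OF \<tau>(2)] by (simp add: grid_def)
  ultimately show ?thesis unfolding chain_def by (intro exI[of _ "\<lambda>j. grid r n (\<tau> j)"]) auto
qed

lemma grid_refine:
  assumes "alternating e k (2 ^ n) (\<lambda>i. y (grid r n i))"
  shows "alternating e k (2 ^ Suc n) (\<lambda>i. y (grid r (Suc n) i))"
proof -
  from assms obtain \<tau> where \<tau>: "alternates (\<lambda>i. y (grid r n i)) e \<tau> k" "\<tau> k \<le> 2 ^ n"
    unfolding alternating_def by blast
  have "grid r (Suc n) (2 * i) = grid r n i" for i by (simp add: grid_def)
  with \<tau> show ?thesis unfolding alternating_def alternates_def
    by (intro exI[of _ "\<lambda>j. 2 * \<tau> j"]) simp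
qed

text \<open>Finitely many strict inequalities survive, by continuity, when the times are rounded
  down to a fine dyadic grid; rounding down also preserves their order and the bound
  \<open>r\<close>.\<close>

lemma grid_of_chain:
  assumes cont: "continuous_on {0..} y" and r: "r > 0" and "chain y e k r"
  shows "\<exists>n. alternating e k (2 ^ n) (\<lambda>i. y (grid r n i))"
proof -
  from assms(3) obtain \<tau> where \<tau>: "alternates y e \<tau> k" "0 \<le> \<tau> 0" "\<tau> k \<le> r"
    unfolding chain_def by blast
  define \<sigma> where "\<sigma> n j = nat \<lfloor>\<tau> j * 2 ^ n / r\<rfloor>" for n j
  have \<tau>0: "0 \<le> \<tau> j" if "j \<le> k" for j
    using alternates_mono[OF \<tau>(1) _ that, of 0] \<tau>(2) by simp
  have conv: "(\<lambda>n. grid r n (\<sigma> n j)) \<longlonglongrightarrow> \<tau> j" if "j \<le> k" for j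
  proof (rule tendsto_sandwich)
    have fl: "real (\<sigma> n j) \<le> \<tau> j * 2 ^ n / r" "\<tau> j * 2 ^ n / r - 1 \<le> real (\<sigma> n j)" for n
    proof -
      have "\<tau> j * 2 ^ n / r \<ge> 0" using \<tau>0[OF that] r by simp
      thus "real (\<sigma> n j) \<le> \<tau> j * 2 ^ n / r" "\<tau> j * 2 ^ n / r - 1 \<le> real (\<sigma> n j)"
        unfolding \<sigma>_def by linarith+
    qed
    have "grid r n (\<sigma> n j) \<le> r * (\<tau> j * 2 ^ n / r) / 2 ^ n" for n
      unfolding grid_def using fl r by (intro divide_right_mono mult_left_mono) auto
    thus "\<forall>\<^sub>F n in sequentially. grid r n (\<sigma> n j) \<le> \<tau> j" using r by simp
    have "r * (\<tau> j * 2 ^ n / r - 1) / 2 ^ n \<le> grid r n (\<sigma> n j)" for n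
      unfolding grid_def using fl r by (intro divide_right_mono mult_left_mono) auto
    moreover have "r * (\<tau> j * 2 ^ n / r - 1) / 2 ^ n = \<tau> j - r * (1 / 2) ^ n" for n
      using r by (simp add: field_simps)
    ultimately show "\<forall>\<^sub>F n in sequentially. \<tau> j - r * (1 / 2) ^ n \<le> grid r n (\<sigma> n j)" by simp
    show "(\<lambda>n. \<tau> j - r * (1 / 2) ^ n) \<longlonglongrightarrow> \<tau> j"
      by (rule tendsto_eq_intros LIMSEQ_power_zero refl | simp)+
  qed simp
  have convy: "(\<lambda>n. y (grid r n (\<sigma> n j))) \<longlonglongrightarrow> y (\<tau> j)" if "j \<le> k" for j
    by (rule continuous_on_tendsto_compose[OF cont conv[OF that]])
      (use \<tau>0[OF that] r in \<open>auto simp: grid_def\<close>)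
  have "\<forall>\<^sub>F n in sequentially. \<forall>j\<in>{..<k}. (-1) ^ j * (y (grid r n (\<sigma> n (Suc j))) - y (grid r n (\<sigma> n j))) > e"
  proof (intro eventually_ball_finite ballI)
    fix j assume j: "j \<in> {..<k}"
    have "(\<lambda>n. (-1) ^ j * (y (grid r n (\<sigma> n (Suc j))) - y (grid r n (\<sigma> n j))))
        \<longlonglongrightarrow> (-1) ^ j * (y (\<tau> (Suc j)) - y (\<tau> j))"
      using j by (intro tendsto_intros convy) auto
    moreover have "e < (-1) ^ j * (y (\<tau> (Suc j)) - y (\<tau> j))"
      using \<tau>(1) j unfolding alternates_def by auto
    ultimately show "\<forall>\<^sub>F n in sequentially. e < (-1) ^ j * (y (grid r n (\<sigma> n (Suc j))) - y (grid r n (\<sigma> n j)))"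
      by (rule order_tendstoD(1))
  qed simp
  then obtain n where n: "\<And>j. j < k \<Longrightarrow> (-1) ^ j * (y (grid r n (\<sigma> n (Suc j))) - y (grid r n (\<sigma> n j))) > e"
    by (auto simp: eventually_sequentially)
  have "\<sigma> n i \<le> \<sigma> n j" if "\<tau> i \<le> \<tau> j" for i j
    unfolding \<sigma>_def using that r by (intro nat_mono floor_mono divide_right_mono mult_right_mono) auto
  hence "alternates (\<lambda>i. y (grid r n i)) e (\<sigma> n) k"
    using \<tau>(1) n unfolding alternates_def by auto
  moreover have "\<sigma> n k \<le> 2 ^ n"
  proof -
    have "\<tau> k * 2 ^ n / r \<le> 2 ^ n"
      using \<tau>(3) r by (simp add: pos_divide_le_eq mult.commute)
    hence "\<lfloor>\<tau> k * 2 ^ n / r\<rfloor> \<le> \<lfloor>(2::real) ^ n\<rfloor>" by (rule floor_mono)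
    also have "\<lfloor>(2::real) ^ n\<rfloor> = 2 ^ n" by (metis floor_of_int of_int_numeral of_int_power)
    finally show ?thesis unfolding \<sigma>_def by (simp add: nat_le_iff)
  qed
  ultimately show ?thesis unfolding alternating_def by blast
qed

lemma chain_iff_grid:
  assumes "continuous_on {0..} y" "r > 0"
  shows "chain y e k r \<longleftrightarrow> (\<exists>n. alternating e k (2 ^ n) (\<lambda>i. y (grid r n i)))"
  using grid_of_chain[OF assms] chain_of_grid[of r e k _ y] assms(2) by auto

lemma measurable_chain:
  fixes Y :: "real \<Rightarrow> 'a \<Rightarrow> real"
  assumes meas: "\<And>s. s \<ge> 0 \<Longrightarrow> Y s \<in> borel_measurable M"
    and cont: "\<And>\<omega>. \<omega> \<in> space M \<Longrightarrow> continuous_on {0..} (\<lambda>s. Y s \<omega>)" and r: "r > 0"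
  shows "Measurable.pred M (\<lambda>\<omega>. chain (\<lambda>s. Y s \<omega>) e k r)"
proof -
  have "Measurable.pred M (\<lambda>\<omega>. \<exists>n. alternating e k (2 ^ n) (\<lambda>i. Y (grid r n i) \<omega>))"
    by (intro pred_intros_countable(2) measurable_alternating meas) (use r in \<open>auto simp: grid_def\<close>)
  also have "?this \<longleftrightarrow> ?thesis"
    by (intro measurable_cong) (use chain_iff_grid[OF cont r] in auto)
  finally show ?thesis .
qed

definition mean_bars :: "real \<Rightarrow> real \<Rightarrow> ennreal" where
  "mean_bars r e = (\<integral>\<^sup>+z. of_nat (bar_count e z) \<partial>gauss_measure (sqrt r))"

lemma gauss_second_moment_finite: "(\<integral>\<^sup>+z. ennreal (z\<^sup>2) \<partial>gauss_measure \<sigma>) < \<top>" if "\<sigma> > 0"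
proof -
  have "integrable lborel (\<lambda>x. normal_density 0 \<sigma> x * (x - 0) ^ 2)"
    by (rule integrable_normal_moment[OF that])
  hence "(\<integral>\<^sup>+z. ennreal (normal_density 0 \<sigma> z * z\<^sup>2) \<partial>lborel) < \<top>"
    by (subst nn_integral_eq_integral) auto
  also have "(\<integral>\<^sup>+z. ennreal (normal_density 0 \<sigma> z * z\<^sup>2) \<partial>lborel) = (\<integral>\<^sup>+z. ennreal (z\<^sup>2) \<partial>gauss_measure \<sigma>)"
    by (subst nn_integral_density) (auto simp: ennreal_mult)
  finally show ?thesis .
qed

lemma bar_count_bound:
  assumes "e > 0" shows "real (bar_count e z) \<le> (z / e)\<^sup>2 + 1"
proof -
  define q where "q = \<bar>z\<bar> / e"
  have q: "q \<ge> 0" using assms by (simp add: q_def)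
  have "real ((nat \<lfloor>q\<rfloor> + 1) div 2) \<le> real (nat \<lfloor>q\<rfloor> + 1) / 2"
    using of_nat_div_le_of_nat[of "nat \<lfloor>q\<rfloor> + 1" 2, where ?'a = real] by simp
  also have "\<dots> \<le> (q + 1) / 2" using q by simp
  finally have "real ((nat \<lfloor>q\<rfloor> + 1) div 2) \<le> (q + 1) / 2" .
  hence "(real ((nat \<lfloor>q\<rfloor> + 1) div 2))\<^sup>2 \<le> ((q + 1) / 2)\<^sup>2" by (rule power_mono) simp
  also have "\<dots> \<le> (q\<^sup>2 + 1) / 2"
    using zero_le_power2[of "q - 1"] by (simp add: power2_eq_square field_simps)
  finally have "2 * (real ((nat \<lfloor>q\<rfloor> + 1) div 2))\<^sup>2 \<le> q\<^sup>2 + 1" by simp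
  thus ?thesis by (simp add: bar_count_def q_def power_divide)
qed

lemma mean_bars_finite:
  assumes "r > 0" "e > 0" shows "mean_bars r e < \<top>"
proof -
  interpret prob_space "gauss_measure (sqrt r)" using assms by (intro prob_space_normal_density) simp
  have "mean_bars r e \<le> (\<integral>\<^sup>+z. ennreal (1 / e\<^sup>2) * ennreal (z\<^sup>2) + 1 \<partial>gauss_measure (sqrt r))"
    unfolding mean_bars_def
  proof (intro nn_integral_mono)
    fix z
    have "ennreal (real (bar_count e z)) \<le> ennreal (1 / e\<^sup>2 * z\<^sup>2 + 1)"
      using bar_count_bound[OF assms(2), of z] by (intro ennreal_leI) (simp add: power_divide)
    also have "\<dots> = ennreal (1 / e\<^sup>2) * ennreal (z\<^sup>2) + 1"
      by (subst ennreal_plus) (auto simp: ennreal_mult[symmetric])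
    finally show "of_nat (bar_count e z) \<le> ennreal (1 / e\<^sup>2) * ennreal (z\<^sup>2) + 1"
      by (simp add: ennreal_of_nat_eq_real_of_nat)
  qed
  also have "\<dots> = ennreal (1 / e\<^sup>2) * (\<integral>\<^sup>+z. ennreal (z\<^sup>2) \<partial>gauss_measure (sqrt r)) + 1"
    by (subst nn_integral_add, simp, simp, subst nn_integral_cmult) (auto simp: emeasure_space_1[simplified])
  also have "\<dots> < \<top>"
    using gauss_second_moment_finite[of "sqrt r"] assms by (simp add: ennreal_mult_less_top)
  finally show ?thesis .
qed

section \<open>Brownian motion sampled on dyadic grids\<close>

context standard_brownian_motion
begin

abbreviation "steps t n \<omega> \<equiv> (\<lambda>i. B (grid t n (Suc i)) \<omega> - B (grid t n i) \<omega>)"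

lemma grid_nonneg: "t \<ge> 0 \<Longrightarrow> grid t n i \<ge> 0"
  by (simp add: grid_def)

lemma measurable_steps [measurable]: "t > 0 \<Longrightarrow> (\<lambda>\<omega>. steps t n \<omega> i) \<in> borel_measurable M"
  by (intro borel_measurable_diff measurable_BM grid_nonneg) auto

lemma distr_steps:
  assumes t: "t > 0"
  shows "distr M (PiM {..<2 ^ n} (\<lambda>_. borel)) (\<lambda>\<omega>. \<lambda>i\<in>{..<2 ^ n}. steps t n \<omega> i) = walk_measure (sqrt (t / 2 ^ n)) (2 ^ n)"
proof -
  have iv: "indep_vars (\<lambda>_. borel) (\<lambda>i \<omega>. steps t n \<omega> i) {..<2 ^ n}"
    using t by (intro indep_increments_BM) (auto simp: grid_def divide_strict_right_mono)
  have "distr M (PiM {..<2 ^ n} (\<lambda>_. borel)) (\<lambda>\<omega>. \<lambda>i\<in>{..<2 ^ n}. steps t n \<omega> i)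
      = PiM {..<2 ^ n} (\<lambda>i. distr M borel (\<lambda>\<omega>. steps t n \<omega> i))"
  proof (subst indep_vars_iff_distr_eq_PiM'[symmetric])
    show "{..<2 ^ n} \<noteq> ({} :: nat set)" by (metis empty_iff lessThan_iff zero_less_numeral zero_less_power)
  qed (use t iv in auto)
  also have "\<dots> = walk_measure (sqrt (t / 2 ^ n)) (2 ^ n)"
    unfolding walk_measure_def
  proof (intro PiM_cong refl)
    fix i
    have "distributed M lborel (\<lambda>\<omega>. steps t n \<omega> i) (normal_density 0 (sqrt (grid t n (Suc i) - grid t n i)))"
      using t by (intro gaussian_increments_BM) (auto simp: grid_def divide_strict_right_mono)
    also have "grid t n (Suc i) - grid t n i = t / 2 ^ n" by (simp add: grid_def field_simps)
    finally have "distr M lborel (\<lambda>\<omega>. steps t n \<omega> i) = gauss_measure (sqrt (t / 2 ^ n))"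
      by (rule distributed_distr_eq_density)
    moreover have "distr M borel (\<lambda>\<omega>. steps t n \<omega> i) = distr M lborel (\<lambda>\<omega>. steps t n \<omega> i)"
      by (intro distr_cong) auto
    ultimately show "distr M borel (\<lambda>\<omega>. steps t n \<omega> i) = gauss_measure (sqrt (t / 2 ^ n))" by simp
  qed
  finally show ?thesis .
qed

text \<open>The product measure lives on functions that are undefined beyond its index set, while
  \<open>steps\<close> is total; the congruence hypothesis bridges the two.\<close>

lemma nn_integral_walk_eq:
  assumes t: "t > 0" and f: "f \<in> borel_measurable (PiM {..<2 ^ n} (\<lambda>_. borel))"
    and cong: "\<And>x y. (\<And>i. i < 2 ^ n \<Longrightarrow> x i = y i) \<Longrightarrow> f x = f y"
  shows "(\<integral>\<^sup>+x. f x \<partial>walk_measure (sqrt (t / 2 ^ n)) (2 ^ n)) = (\<integral>\<^sup>+\<omega>. f (steps t n \<omega>) \<partial>M)"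
proof -
  have "(\<lambda>\<omega>. \<lambda>i\<in>{..<2 ^ n}. steps t n \<omega> i) \<in> M \<rightarrow>\<^sub>M PiM {..<2 ^ n} (\<lambda>_. borel)"
    using t by (intro measurable_restrict) auto
  hence "(\<integral>\<^sup>+x. f x \<partial>walk_measure (sqrt (t / 2 ^ n)) (2 ^ n)) = (\<integral>\<^sup>+\<omega>. f (\<lambda>i\<in>{..<2 ^ n}. steps t n \<omega> i) \<partial>M)"
    unfolding distr_steps[OF t, symmetric] by (rule nn_integral_distr) (use f in simp)
  also have "\<dots> = (\<integral>\<^sup>+\<omega>. f (steps t n \<omega>) \<partial>M)"
    by (intro nn_integral_cong cong) auto
  finally show ?thesis .
qed

lemma sum_steps: "(\<Sum>j<i. steps t n \<omega> j) = B (grid t n i) \<omega> - B 0 \<omega>"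
  by (subst sum_lessThan_telescope) (simp add: grid_def)

lemma nn_integral_endpoint:
  assumes t: "t > 0" and [measurable]: "f \<in> borel_measurable borel"
  shows "(\<integral>\<^sup>+\<omega>. f (B t \<omega> - B 0 \<omega>) \<partial>M) = (\<integral>\<^sup>+z. f z \<partial>gauss_measure (sqrt t))"
proof -
  have "distributed M lborel (\<lambda>\<omega>. B t \<omega> - B 0 \<omega>) (normal_density 0 (sqrt (t - 0)))"
    using t by (intro gaussian_increments_BM) auto
  hence "distr M lborel (\<lambda>\<omega>. B t \<omega> - B 0 \<omega>) = gauss_measure (sqrt t)"
    using distributed_distr_eq_density by fastforce
  moreover have "(\<lambda>\<omega>. B t \<omega> - B 0 \<omega>) \<in> M \<rightarrow>\<^sub>M lborel"
    using t measurable_BM[of t] measurable_BM[of 0] by simp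
  ultimately show ?thesis
    using nn_integral_distr[of "\<lambda>\<omega>. B t \<omega> - B 0 \<omega>" M lborel f] by simp
qed

definition chain_prob :: "real \<Rightarrow> nat \<Rightarrow> real \<Rightarrow> ennreal" where
  "chain_prob e k r = (\<integral>\<^sup>+\<omega>. of_bool (chain (\<lambda>s. \<bar>B s \<omega>\<bar>) e k r) \<partial>M)"

definition grid_prob :: "real \<Rightarrow> nat \<Rightarrow> real \<Rightarrow> nat \<Rightarrow> ennreal" where
  "grid_prob e k r n = (\<integral>\<^sup>+\<omega>. of_bool (alternating e k (2 ^ n) (\<lambda>i. \<bar>B (grid r n i) \<omega>\<bar>)) \<partial>M)"

definition big_prob :: "real \<Rightarrow> real \<Rightarrow> nat \<Rightarrow> ennreal" where
  "big_prob \<delta> r n = (\<integral>\<^sup>+\<omega>. of_bool (big_step \<delta> (2 ^ n) (steps r n \<omega>)) \<partial>M)"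

lemma measurable_of_bool [measurable (raw)]:
  "Measurable.pred M P \<Longrightarrow> (\<lambda>x. of_bool (P x) :: ennreal) \<in> borel_measurable M"
  unfolding of_bool_def by measurable

lemma continuous_abs_path: "\<omega> \<in> space M \<Longrightarrow> continuous_on {0..} (\<lambda>s. \<bar>B s \<omega>\<bar>)"
  by (intro continuous_on_rabs continuous_BM)

lemma measurable_grid_alternating:
  assumes "r > 0"
  shows "Measurable.pred M (\<lambda>\<omega>. alternating e k (2 ^ n) (\<lambda>i. \<bar>B (grid r n i) \<omega>\<bar>))"
  using assms by (intro measurable_alternating borel_measurable_abs measurable_BM grid_nonneg) auto

text \<open>Under refinement the grid events increase, and their union is the chain event.\<close>

lemma grid_prob_tendsto:
  assumes r: "r > 0"
  shows "grid_prob e k r \<longlonglongrightarrow> chain_prob e k r"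
  unfolding grid_prob_def[abs_def] chain_prob_def
proof (rule nn_integral_dominated_convergence[where w = "\<lambda>_. 1"])
  let ?P = "\<lambda>n \<omega>. alternating e k (2 ^ n) (\<lambda>i. \<bar>B (grid r n i) \<omega>\<bar>)"
  show "(\<lambda>\<omega>. of_bool (chain (\<lambda>s. \<bar>B s \<omega>\<bar>) e k r) :: ennreal) \<in> borel_measurable M"
    by (intro measurable_of_bool measurable_chain[where Y = "\<lambda>s \<omega>. \<bar>B s \<omega>\<bar>"] continuous_abs_path borel_measurable_abs measurable_BM r)
  show "(\<lambda>\<omega>. of_bool (?P n \<omega>) :: ennreal) \<in> borel_measurable M" for n
    by (intro measurable_of_bool measurable_grid_alternating r)
  show "AE \<omega> in M. (\<lambda>n. of_bool (?P n \<omega>) :: ennreal) \<longlonglongrightarrow> of_bool (chain (\<lambda>s. \<bar>B s \<omega>\<bar>) e k r)"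
  proof (rule AE_I2)
    fix \<omega> assume \<omega>: "\<omega> \<in> space M"
    note iff = chain_iff_grid[OF continuous_abs_path[OF \<omega>] r, of e k]
    show "(\<lambda>n. of_bool (?P n \<omega>) :: ennreal) \<longlonglongrightarrow> of_bool (chain (\<lambda>s. \<bar>B s \<omega>\<bar>) e k r)"
    proof (cases "chain (\<lambda>s. \<bar>B s \<omega>\<bar>) e k r")
      case True
      then obtain n where n: "?P n \<omega>" using iff by blast
      have "?P m \<omega>" if "n \<le> m" for m
        using that by (induction m rule: dec_induct) (use n grid_refine[where y = "\<lambda>s. \<bar>B s \<omega>\<bar>"] in blast)+
      hence "\<forall>\<^sub>F m in sequentially. of_bool (?P m \<omega>) = (1 :: ennreal)"
        unfolding eventually_sequentially by (intro exI[of _ n]) simp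
      thus ?thesis using True by (simp add: tendsto_eventually)
    next
      case False
      hence "of_bool (?P m \<omega>) = (0 :: ennreal)" for m using iff by auto
      thus ?thesis using False by simp
    qed
  qed
qed (auto simp: emeasure_space_1)

text \<open>Each path is uniformly continuous on [0, r], so on all sufficiently fine grids it has no
  step above \<delta>.\<close>

lemma big_prob_tendsto:
  assumes r: "r > 0" and \<delta>: "\<delta> > 0"
  shows "big_prob \<delta> r \<longlonglongrightarrow> 0"
proof -
  have "(\<lambda>n. \<integral>\<^sup>+\<omega>. of_bool (big_step \<delta> (2 ^ n) (steps r n \<omega>)) \<partial>M) \<longlonglongrightarrow> (\<integral>\<^sup>+\<omega>. 0 \<partial>M)"
  proof (rule nn_integral_dominated_convergence[where w = "\<lambda>_. 1"])
    show "(\<lambda>\<omega>. of_bool (big_step \<delta> (2 ^ n) (steps r n \<omega>)) :: ennreal) \<in> borel_measurable M" for n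
      by (intro measurable_of_bool measurable_big_step measurable_steps r)
    show "AE \<omega> in M. (\<lambda>n. of_bool (big_step \<delta> (2 ^ n) (steps r n \<omega>)) :: ennreal) \<longlonglongrightarrow> 0"
    proof (rule AE_I2)
      fix \<omega> assume \<omega>: "\<omega> \<in> space M"
      have "uniformly_continuous_on {0..r} (\<lambda>s. B s \<omega>)"
        by (intro compact_uniformly_continuous continuous_on_subset[OF continuous_BM[OF \<omega>]]) auto
      then obtain d where d: "d > 0" "\<And>a b. a \<in> {0..r} \<Longrightarrow> b \<in> {0..r} \<Longrightarrow> dist a b < d \<Longrightarrow> dist (B a \<omega>) (B b \<omega>) < \<delta>"
        unfolding uniformly_continuous_on_def using \<delta> by metis
      have "(\<lambda>n. r * (1 / 2) ^ n) \<longlonglongrightarrow> 0"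
        by (rule tendsto_eq_intros LIMSEQ_power_zero refl | simp)+
      hence "\<forall>\<^sub>F n in sequentially. r * (1 / 2) ^ n < d" using d(1) by (rule order_tendstoD)
      hence "\<forall>\<^sub>F n in sequentially. of_bool (big_step \<delta> (2 ^ n) (steps r n \<omega>)) = (0 :: ennreal)"
      proof eventually_elim
        case (elim n)
        have "\<bar>steps r n \<omega> i\<bar> < \<delta>" if i: "i < 2 ^ n" for i
        proof -
          have le: "grid r n j \<le> r" if "j \<le> 2 ^ n" for j
          proof -
            have "real j \<le> 2 ^ n" using of_nat_mono[OF that, where ?'a = real] by simp
            thus ?thesis using r by (simp add: grid_def pos_divide_le_eq)
          qed
          have "grid r n (Suc i) - grid r n i = r * (1 / 2) ^ n"
            by (simp add: grid_def field_simps)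
          hence "dist (grid r n (Suc i)) (grid r n i) < d" using elim r by (simp add: dist_real_def)
          from d(2)[OF _ _ this] show ?thesis
            using le[of i] le[of "Suc i"] i r by (simp add: dist_real_def grid_nonneg)
        qed
        hence "\<not> big_step \<delta> (2 ^ n) (steps r n \<omega>)" by (force simp: big_step_def)
        thus ?case by simp
      qed
      thus "(\<lambda>n. of_bool (big_step \<delta> (2 ^ n) (steps r n \<omega>)) :: ennreal) \<longlonglongrightarrow> 0"
        by (rule tendsto_eventually)
    qed
  qed (auto simp: emeasure_space_1)
  thus ?thesis by (simp add: big_prob_def[abs_def])
qed

lemma walk_alternates_prob:
  assumes r: "r > 0"
  shows "(\<integral>\<^sup>+x. of_bool (walk_alternates e k (2 ^ n) (\<lambda>i. \<Sum>j<i. x j)) \<partial>walk_measure (sqrt (r / 2 ^ n)) (2 ^ n))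
     = grid_prob e k r n"
proof -
  have "(\<integral>\<^sup>+x. of_bool (walk_alternates e k (2 ^ n) (\<lambda>i. \<Sum>j<i. x j)) \<partial>walk_measure (sqrt (r / 2 ^ n)) (2 ^ n))
     = (\<integral>\<^sup>+\<omega>. of_bool (walk_alternates e k (2 ^ n) (\<lambda>i. \<Sum>j<i. steps r n \<omega> j)) \<partial>M)"
  proof (rule nn_integral_walk_eq[OF r, where f = "\<lambda>x. of_bool (walk_alternates e k (2 ^ n) (\<lambda>i. \<Sum>j<i. x j))"])
    show "(\<lambda>x. of_bool (walk_alternates e k (2 ^ n) (\<lambda>i. \<Sum>j<i. x j)) :: ennreal)
        \<in> borel_measurable (PiM {..<2 ^ n} (\<lambda>_. borel))"
      unfolding of_bool_def
      by (rule measurable_If, simp, simp, rule measurable_alternating[unfolded pred_def], rule borel_measurable_abs,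
          rule borel_measurable_sum, rule measurable_component_singleton) auto
    show "(of_bool (walk_alternates e k (2 ^ n) (\<lambda>i. \<Sum>j<i. x j)) :: ennreal)
      = of_bool (walk_alternates e k (2 ^ n) (\<lambda>i. \<Sum>j<i. y j))"
      if "\<And>i. i < 2 ^ n \<Longrightarrow> x i = y i" for x y
      by (intro arg_cong[of _ _ of_bool] alternating_cong arg_cong[of _ _ abs] sum.cong that) auto
  qed
  also have "\<dots> = grid_prob e k r n"
    unfolding grid_prob_def sum_steps
    by (rule nn_integral_cong_AE) (use start_BM in \<open>auto elim!: eventually_mono\<close>)
  finally show ?thesis .
qed

lemma big_step_prob:
  assumes r: "r > 0"
  shows "(\<integral>\<^sup>+x. of_bool (big_step \<delta> (2 ^ n) x) \<partial>walk_measure (sqrt (r / 2 ^ n)) (2 ^ n)) = big_prob \<delta> r n"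
  unfolding big_prob_def
proof (rule nn_integral_walk_eq[OF r])
  have "Measurable.pred (PiM {..<2 ^ n} (\<lambda>_. borel)) (\<lambda>x. big_step \<delta> (2 ^ n) x)"
    by (rule measurable_big_step, rule measurable_component_singleton) auto
  thus "(\<lambda>x. of_bool (big_step \<delta> (2 ^ n) x) :: ennreal) \<in> borel_measurable (PiM {..<2 ^ n} (\<lambda>_. borel))"
    unfolding of_bool_def by measurable
qed (auto simp: big_step_def)

lemma endpoint_expectation:
  assumes r: "r > 0" and f: "f \<in> borel_measurable borel"
  shows "(\<integral>\<^sup>+x. f (\<Sum>i<2 ^ n. x i) \<partial>walk_measure (sqrt (r / 2 ^ n)) (2 ^ n)) = (\<integral>\<^sup>+z. f z \<partial>gauss_measure (sqrt r))"
proof -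
  have "(\<integral>\<^sup>+x. f (\<Sum>i<2 ^ n. x i) \<partial>walk_measure (sqrt (r / 2 ^ n)) (2 ^ n)) = (\<integral>\<^sup>+\<omega>. f (\<Sum>i<2 ^ n. steps r n \<omega> i) \<partial>M)"
  proof (rule nn_integral_walk_eq[OF r, where f = "\<lambda>x. f (\<Sum>i<2 ^ n. x i)"])
    show "(\<lambda>x. f (\<Sum>i<2 ^ n. x i)) \<in> borel_measurable (PiM {..<2 ^ n} (\<lambda>_. borel))"
      by (rule measurable_compose[OF borel_measurable_sum f]) (rule measurable_component_singleton)
  qed (auto intro!: arg_cong[of _ _ f] sum.cong)
  also have "\<dots> = (\<integral>\<^sup>+\<omega>. f (B r \<omega> - B 0 \<omega>) \<partial>M)"
    unfolding sum_steps by (simp add: grid_def)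
  also have "\<dots> = (\<integral>\<^sup>+z. f z \<partial>gauss_measure (sqrt r))"
    by (rule nn_integral_endpoint[OF r f])
  finally show ?thesis .
qed

end

text \<open>Brownian scaling. It converts the loss in time, from \<open>t\<close> to a later
  \<open>r\<close>, into a loss in \<epsilon>, so that only one variable has to be sent to its
  limit.\<close>

lemma mean_bars_scale:
  assumes r: "r > 0" and e: "e > 0"
  shows "mean_bars r e = mean_bars 1 (e / sqrt r)"
proof -
  define s where "s = sqrt r"
  have s: "s > 0" using r by (simp add: s_def)
  have "mean_bars r e = (\<integral>\<^sup>+z. ennreal (normal_density 0 s z) * of_nat (bar_count e z) \<partial>lborel)"
    unfolding mean_bars_def s_def[symmetric] by (subst nn_integral_density) auto
  also have "\<dots> = ennreal \<bar>s\<bar> * (\<integral>\<^sup>+z. ennreal (normal_density 0 s (0 + s * z)) * of_nat (bar_count e (0 + s * z)) \<partial>lborel)"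
    using s by (intro nn_integral_real_affine) auto
  also have "\<dots> = (\<integral>\<^sup>+z. ennreal \<bar>s\<bar> * (ennreal (normal_density 0 s (0 + s * z)) * of_nat (bar_count e (0 + s * z))) \<partial>lborel)"
    by (rule nn_integral_cmult[symmetric]) auto
  also have "\<dots> = (\<integral>\<^sup>+z. ennreal (normal_density 0 1 z) * of_nat (bar_count (e / s) z) \<partial>lborel)"
  proof (rule nn_integral_cong)
    fix z
    have "\<bar>s\<bar> * normal_density 0 s (0 + s * z) = normal_density 0 1 z"
      using s by (simp add: normal_density_def real_sqrt_mult power_mult_distrib)
    moreover have "bar_count e (0 + s * z) = bar_count (e / s) z"
      using s by (simp add: bar_count_def abs_mult mult.commute)
    ultimately show "ennreal \<bar>s\<bar> * (ennreal (normal_density 0 s (0 + s * z)) * of_nat (bar_count e (0 + s * z)))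
        = ennreal (normal_density 0 1 z) * of_nat (bar_count (e / s) z)"
      using s by (simp only: mult.assoc[symmetric] ennreal_mult[symmetric] abs_ge_zero normal_density_nonneg)
  qed
  also have "\<dots> = mean_bars 1 (e / s)"
    unfolding mean_bars_def by (subst nn_integral_density) auto
  finally show ?thesis by (simp add: s_def)
qed

lemma mean_bars_antimono: "0 < e' \<Longrightarrow> e' \<le> e \<Longrightarrow> mean_bars r e \<le> mean_bars r e'"
  unfolding mean_bars_def by (intro nn_integral_mono of_nat_mono bar_count_antimono)

definition mean_bars_std :: "real \<Rightarrow> real" where
  "mean_bars_std a = enn2real (mean_bars 1 a)"

lemma ennreal_divide_tendsto_0:
  assumes "S < (\<top> :: ennreal)" "c > 0"
  shows "(\<lambda>n. S / ennreal (c * real (Suc n))) \<longlonglongrightarrow> 0"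
proof -
  obtain s where s: "S = ennreal s" "s \<ge> 0" using assms(1) by (cases S) auto
  have "(\<lambda>n. s / c * (1 / real (Suc n))) \<longlonglongrightarrow> s / c * 0"
    by (intro tendsto_mult tendsto_const LIMSEQ_Suc[OF lim_1_over_n])
  hence "(\<lambda>n. ennreal (s / (c * real (Suc n)))) \<longlonglongrightarrow> ennreal 0"
    by (intro tendsto_ennrealI) (simp add: divide_simps)
  moreover have "S / ennreal (c * real (Suc n)) = ennreal (s / (c * real (Suc n)))" for n
    unfolding s(1) using s assms(2) by (intro divide_ennreal) auto
  ultimately show ?thesis by simp
qed

context standard_brownian_motion
begin

lemma grid_prob_antimono: "e' \<le> e \<Longrightarrow> grid_prob e k r n \<le> grid_prob e' k r n"
  unfolding grid_prob_def alternating_def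
  by (intro nn_integral_mono) (auto simp: of_bool_def intro: alternates_mono_bound)

lemma exceptional_prob_bound:
  fixes \<delta> e :: real
  assumes r: "r > 0" and e: "e > 0" and \<delta>: "0 < \<delta>" "4 * \<delta> \<le> e"
  shows "(\<integral>\<^sup>+x. of_bool (big_step \<delta> (2 ^ n) x \<or> stg e x (2 ^ n) > Suc m) \<partial>walk_measure (sqrt (r / 2 ^ n)) (2 ^ n))
    \<le> big_prob \<delta> r n + (\<integral>\<^sup>+z. ennreal (z\<^sup>2) \<partial>gauss_measure (sqrt r)) / ennreal (e\<^sup>2 * real (Suc m))"
proof -
  have \<sigma>: "sqrt (r / 2 ^ n) > 0" using r by simp
  have "(\<integral>\<^sup>+x. ennreal ((\<Sum>i<2 ^ n. x i)\<^sup>2) \<partial>walk_measure (sqrt (r / 2 ^ n)) (2 ^ n)) = (\<integral>\<^sup>+z. ennreal (z\<^sup>2) \<partial>gauss_measure (sqrt r))"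
    by (rule endpoint_expectation[OF r, where f = "\<lambda>w. ennreal (w\<^sup>2)"]) measurable
  with exceptional_bound[OF \<sigma> e \<delta>, of "Suc m" "2 ^ n"] show ?thesis
    by (simp add: big_step_prob[OF r])
qed

text \<open>With at most m + 1 stages allowed, \<delta> is fixed first. Then the mesh is refined,
  which removes big steps, and afterwards m grows, which removes paths with too many stages. The
  midpoint \<open>e1\<close> divides the gap between the comparison of levels and the
  overshoots.\<close>

lemma chain_prob_sum_upper:
  assumes r: "r > 0" and e: "0 < e'" "e' < e"
  shows "(\<Sum>k<N. chain_prob e (2 * k + 1) r) \<le> mean_bars r e'"
proof -
  define e1 where "e1 = (e + e') / 2"
  have e1: "e1 > 0" "e' < e1" "e1 < e" using e by (auto simp: e1_def)
  define S where "S = (\<integral>\<^sup>+z. ennreal (z\<^sup>2) \<partial>gauss_measure (sqrt r))"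
  have S: "S < \<top>" unfolding S_def by (rule gauss_second_moment_finite) (use r in simp)
  have bound: "(\<Sum>k<N. chain_prob e (2 * k + 1) r) \<le> mean_bars r e' + of_nat N * (0 + S / ennreal (e1\<^sup>2 * real (Suc m)))" for m
  proof -
    \<comment> \<open>The three bounds yield \<open>e1 + \<delta> \<le> e\<close>, the condition
      \<open>4 * \<delta> \<le> e1\<close> of the coupling, and a total overshoot of at most half of
      e1 - e'.\<close>
    define \<delta> where "\<delta> = min (e - e1) (min (e1 / 4) ((e1 - e') / (2 * real (Suc m))))"
    have \<delta>: "0 < \<delta>" "4 * \<delta> \<le> e1" "e1 + \<delta> \<le> e"
    proof -
      show "0 < \<delta>" using e1 by (simp add: \<delta>_def)
      have "\<delta> \<le> e1 / 4" unfolding \<delta>_def by (intro min.coboundedI2 min.coboundedI1 order.refl)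
      moreover have "\<delta> \<le> e - e1" unfolding \<delta>_def by (rule min.cobounded1)
      ultimately show "4 * \<delta> \<le> e1" "e1 + \<delta> \<le> e" by linarith+
    qed
    have "real (Suc m) * \<delta> \<le> real (Suc m) * ((e1 - e') / (2 * real (Suc m)))"
      by (intro mult_left_mono) (auto simp: \<delta>_def)
    also have "\<dots> = (e1 - e') / 2" by (simp del: of_nat_Suc)
    also have "\<dots> < e1 - e'" using e1 by simp
    finally have \<delta>A: "real (Suc m) * \<delta> < e1 - e'" .
    have "(\<Sum>k<N. grid_prob e (2 * k + 1) r n) \<le> mean_bars r e' + of_nat N * (big_prob \<delta> r n + S / ennreal (e1\<^sup>2 * real (Suc m)))" for n
    proof -
      have \<sigma>: "sqrt (r / 2 ^ n) > 0" using r by simp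
      have mb: "(\<integral>\<^sup>+x. of_nat (bar_count e' (\<Sum>i<2 ^ n. x i)) \<partial>walk_measure (sqrt (r / 2 ^ n)) (2 ^ n)) = mean_bars r e'"
        unfolding mean_bars_def
        by (rule endpoint_expectation[OF r, where f = "\<lambda>w. of_nat (bar_count e' w)"]) measurable
      have "(\<Sum>k<N. grid_prob e (2 * k + 1) r n) \<le> (\<Sum>k<N. grid_prob (e1 + \<delta>) (2 * k + 1) r n)"
        by (intro sum_mono grid_prob_antimono \<delta>)
      also have "\<dots> \<le> mean_bars r e' + of_nat N * (\<integral>\<^sup>+x. of_bool (big_step \<delta> (2 ^ n) x \<or> stg e1 x (2 ^ n) > Suc m) \<partial>walk_measure (sqrt (r / 2 ^ n)) (2 ^ n))"
        using walk_count_upper[where n = "2 ^ n" and N = N, OF \<sigma> e1(1) \<delta>(1,2) e(1) e1(2) \<delta>A]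
        unfolding walk_alternates_prob[OF r] mb .
      also have "\<dots> \<le> mean_bars r e' + of_nat N * (big_prob \<delta> r n + S / ennreal (e1\<^sup>2 * real (Suc m)))"
        unfolding S_def by (intro add_left_mono mult_left_mono exceptional_prob_bound r e1 \<delta>) auto
      finally show ?thesis .
    qed
    moreover have "(\<lambda>n. \<Sum>k<N. grid_prob e (2 * k + 1) r n) \<longlonglongrightarrow> (\<Sum>k<N. chain_prob e (2 * k + 1) r)"
      by (intro tendsto_sum grid_prob_tendsto r)
    moreover have "(\<lambda>n. mean_bars r e' + of_nat N * (big_prob \<delta> r n + S / ennreal (e1\<^sup>2 * real (Suc m))))
       \<longlonglongrightarrow> mean_bars r e' + of_nat N * (0 + S / ennreal (e1\<^sup>2 * real (Suc m)))"
      by (intro tendsto_add tendsto_const ennreal_tendsto_cmult big_prob_tendsto r \<delta>) (auto simp: of_nat_less_top)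
    ultimately show ?thesis by (blast intro: LIMSEQ_le)
  qed
  have "(\<lambda>m. mean_bars r e' + of_nat N * (0 + S / ennreal (e1\<^sup>2 * real (Suc m)))) \<longlonglongrightarrow> mean_bars r e' + of_nat N * (0 + 0)"
    using e1 by (intro tendsto_add tendsto_const ennreal_tendsto_cmult ennreal_divide_tendsto_0 S) (auto simp: of_nat_less_top)
  hence "(\<Sum>k<N. chain_prob e (2 * k + 1) r) \<le> mean_bars r e' + of_nat N * (0 + 0)"
    by (rule LIMSEQ_le_const) (use bound in auto)
  thus ?thesis by simp
qed

text \<open>The same order of limits, applied to the count truncated at \<open>L\<close>, which is
  what keeps the contribution of exceptional paths small. Monotone convergence in \<open>L\<close>
  comes last.\<close>

lemma chain_prob_suminf_lower:
  assumes r: "r > 0" and e: "0 < e" "e < e'"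
  shows "mean_bars r e' \<le> (\<Sum>k. chain_prob e (2 * k + 1) r)"
proof -
  define e1 where "e1 = (e + e') / 2"
  have e1: "e1 > 0" "e < e1" "e1 < e'" using e by (auto simp: e1_def)
  define S where "S = (\<integral>\<^sup>+z. ennreal (z\<^sup>2) \<partial>gauss_measure (sqrt r))"
  have S: "S < \<top>" unfolding S_def by (rule gauss_second_moment_finite) (use r in simp)
  have trunc: "(\<integral>\<^sup>+z. of_nat (min L (bar_count e' z)) \<partial>gauss_measure (sqrt r)) \<le> (\<Sum>k. chain_prob e (2 * k + 1) r)" for L
  proof -
    have bound: "(\<integral>\<^sup>+z. of_nat (min L (bar_count e' z)) \<partial>gauss_measure (sqrt r))
       \<le> (\<Sum>k. chain_prob e (2 * k + 1) r) + of_nat L * (0 + S / ennreal (e1\<^sup>2 * real (Suc m)))" for m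
    proof -
      define \<delta> where "\<delta> = min ((e1 - e) / 4) (min (e1 / 4) ((e' - e1) / (2 * real (Suc m))))"
      have \<delta>: "0 < \<delta>" "4 * \<delta> \<le> e1" "e \<le> e1 - 4 * \<delta>"
      proof -
        show "0 < \<delta>" using e1 by (simp add: \<delta>_def)
        have "\<delta> \<le> e1 / 4" unfolding \<delta>_def by (intro min.coboundedI2 min.coboundedI1 order.refl)
        moreover have "\<delta> \<le> (e1 - e) / 4" unfolding \<delta>_def by (rule min.cobounded1)
        ultimately show "4 * \<delta> \<le> e1" "e \<le> e1 - 4 * \<delta>" by (auto simp: field_simps)
      qed
      have "real (Suc m) * \<delta> \<le> real (Suc m) * ((e' - e1) / (2 * real (Suc m)))"
        by (intro mult_left_mono) (auto simp: \<delta>_def)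
      also have "\<dots> = (e' - e1) / 2" by (simp del: of_nat_Suc)
      also have "\<dots> < e' - e1" using e1 by simp
      finally have \<delta>A: "real (Suc m) * \<delta> < e' - e1" .
      have "(\<integral>\<^sup>+z. of_nat (min L (bar_count e' z)) \<partial>gauss_measure (sqrt r))
         \<le> (\<Sum>k<Suc m. grid_prob e (2 * k + 1) r n) + of_nat L * (big_prob \<delta> r n + S / ennreal (e1\<^sup>2 * real (Suc m)))" for n
      proof -
        have \<sigma>: "sqrt (r / 2 ^ n) > 0" using r by simp
        have "(\<integral>\<^sup>+z. of_nat (min L (bar_count e' z)) \<partial>gauss_measure (sqrt r))
           = (\<integral>\<^sup>+x. of_nat (min L (bar_count e' (\<Sum>i<2 ^ n. x i))) \<partial>walk_measure (sqrt (r / 2 ^ n)) (2 ^ n))"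
          by (rule endpoint_expectation[OF r, where f = "\<lambda>w. of_nat (min L (bar_count e' w))", symmetric]) measurable
        also have "\<dots> \<le> (\<Sum>k<Suc m. grid_prob (e1 - 4 * \<delta>) (2 * k + 1) r n)
           + of_nat L * (\<integral>\<^sup>+x. of_bool (big_step \<delta> (2 ^ n) x \<or> stg e1 x (2 ^ n) > Suc m) \<partial>walk_measure (sqrt (r / 2 ^ n)) (2 ^ n))"
          using walk_count_lower[where n = "2 ^ n" and L = L, OF \<sigma> e1(1) \<delta>(1,2) e1(3) \<delta>A]
          unfolding walk_alternates_prob[OF r] .
        also have "\<dots> \<le> (\<Sum>k<Suc m. grid_prob e (2 * k + 1) r n) + of_nat L * (big_prob \<delta> r n + S / ennreal (e1\<^sup>2 * real (Suc m)))"
          unfolding S_def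
          by (intro add_mono sum_mono grid_prob_antimono mult_left_mono exceptional_prob_bound r e1 \<delta>) auto
        finally show ?thesis .
      qed
      moreover have "(\<lambda>n. (\<Sum>k<Suc m. grid_prob e (2 * k + 1) r n) + of_nat L * (big_prob \<delta> r n + S / ennreal (e1\<^sup>2 * real (Suc m))))
        \<longlonglongrightarrow> (\<Sum>k<Suc m. chain_prob e (2 * k + 1) r) + of_nat L * (0 + S / ennreal (e1\<^sup>2 * real (Suc m)))"
        by (intro tendsto_add tendsto_sum grid_prob_tendsto tendsto_const ennreal_tendsto_cmult big_prob_tendsto r \<delta>) (auto simp: of_nat_less_top)
      ultimately have "(\<integral>\<^sup>+z. of_nat (min L (bar_count e' z)) \<partial>gauss_measure (sqrt r))
        \<le> (\<Sum>k<Suc m. chain_prob e (2 * k + 1) r) + of_nat L * (0 + S / ennreal (e1\<^sup>2 * real (Suc m)))"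
        by (intro LIMSEQ_le_const) blast+
      also have "\<dots> \<le> (\<Sum>k. chain_prob e (2 * k + 1) r) + of_nat L * (0 + S / ennreal (e1\<^sup>2 * real (Suc m)))"
        by (intro add_right_mono sum_le_suminf) auto
      finally show ?thesis .
    qed
    have "(\<lambda>m. (\<Sum>k. chain_prob e (2 * k + 1) r) + of_nat L * (0 + S / ennreal (e1\<^sup>2 * real (Suc m))))
      \<longlonglongrightarrow> (\<Sum>k. chain_prob e (2 * k + 1) r) + of_nat L * (0 + 0)"
      using e1 by (intro tendsto_add tendsto_const ennreal_tendsto_cmult ennreal_divide_tendsto_0 S) (auto simp: of_nat_less_top)
    hence "(\<integral>\<^sup>+z. of_nat (min L (bar_count e' z)) \<partial>gauss_measure (sqrt r)) \<le> (\<Sum>k. chain_prob e (2 * k + 1) r) + of_nat L * (0 + 0)"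
      by (rule LIMSEQ_le_const) (use bound in auto)
    thus ?thesis by simp
  qed
  have "(\<lambda>L. \<integral>\<^sup>+z. of_nat (min L (bar_count e' z)) \<partial>gauss_measure (sqrt r)) \<longlonglongrightarrow> mean_bars r e'"
    unfolding mean_bars_def
  proof (rule nn_integral_LIMSEQ)
    show "incseq (\<lambda>L z. of_nat (min L (bar_count e' z)) :: ennreal)"
      by (intro incseq_SucI le_funI of_nat_mono) auto
    show "(\<lambda>L. of_nat (min L (bar_count e' z)) :: ennreal) \<longlonglongrightarrow> of_nat (bar_count e' z)" for z
      by (rule tendsto_eventually) (use eventually_ge_at_top[of "bar_count e' z"] in eventually_elim, simp)
  qed measurable
  thus ?thesis by (rule LIMSEQ_le_const2) (use trunc in auto)
qed

section \<open>The expected number of bars between two Gaussian means\<close>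

abbreviation "abs_path \<omega> \<equiv> (\<lambda>s. \<bar>B s \<omega>\<bar>)"

lemma measurable_bar_event:
  assumes t: "t > 0" and \<epsilon>: "\<epsilon> > 0"
  shows "Measurable.pred M (\<lambda>\<omega>. bar_event (abs_path \<omega>) t \<epsilon> k)"
proof (cases "k = 0")
  case True
  have "Measurable.pred M (\<lambda>\<omega>. \<forall>m. chain (abs_path \<omega>) (\<epsilon> - 1 / real (Suc m)) 1 t
      \<or> chain (\<lambda>u. - abs_path \<omega> u) (\<epsilon> - 1 / real (Suc m)) 1 t)"
    by (intro pred_intros_countable(1) pred_intros_logic(5) measurable_chain[where Y = "\<lambda>s \<omega>. \<bar>B s \<omega>\<bar>"]
         measurable_chain[where Y = "\<lambda>s \<omega>. - \<bar>B s \<omega>\<bar>"] continuous_abs_path continuous_on_minus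
         borel_measurable_uminus borel_measurable_abs measurable_BM t)
  also have "?this \<longleftrightarrow> ?thesis"
    by (intro measurable_cong) (simp add: bar_event_def True path_range_ge_iff[OF continuous_abs_path t])
  finally show ?thesis .
next
  case False
  have "Measurable.pred M (\<lambda>\<omega>. \<forall>m. chain (\<lambda>u. - abs_path \<omega> u) \<epsilon> (2 * k) (t + 1 / real (Suc m)))"
    by (intro pred_intros_countable(1) measurable_chain[where Y = "\<lambda>s \<omega>. - \<bar>B s \<omega>\<bar>"]
        continuous_abs_path continuous_on_minus borel_measurable_uminus borel_measurable_abs measurable_BM add_pos_pos t) auto
  also have "?this \<longleftrightarrow> ?thesis"
    by (intro measurable_cong) (use False \<epsilon> in \<open>simp add: bar_event_def bar_time_le_iff[OF continuous_abs_path]\<close>)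
  finally show ?thesis .
qed

lemma num_bars_eq_suminf:
  assumes t: "t > 0" and \<epsilon>: "\<epsilon> > 0" and \<omega>: "\<omega> \<in> space M"
  shows "(of_nat (num_bars (abs_path \<omega>) t \<epsilon>) :: ennreal) = (\<Sum>k. of_bool (bar_event (abs_path \<omega>) t \<epsilon> k))"
proof -
  obtain C where C: "\<And>N. N \<ge> C \<Longrightarrow> num_bars (abs_path \<omega>) t \<epsilon> = (\<Sum>k<N. of_bool (bar_event (abs_path \<omega>) t \<epsilon> k))"
    using num_bars_eq_sum[OF continuous_abs_path[OF \<omega>] \<epsilon>, of t] t by auto
  have "\<forall>\<^sub>F N in sequentially. (\<Sum>k<N. of_bool (bar_event (abs_path \<omega>) t \<epsilon> k)) = (of_nat (num_bars (abs_path \<omega>) t \<epsilon>) :: ennreal)"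
    using eventually_ge_at_top[of C]
  proof eventually_elim
    case (elim N)
    thus ?case by (subst C[OF elim]) (simp add: of_nat_sum)
  qed
  hence "(\<lambda>k. of_bool (bar_event (abs_path \<omega>) t \<epsilon> k)) sums (of_nat (num_bars (abs_path \<omega>) t \<epsilon>) :: ennreal)"
    unfolding sums_def by (rule tendsto_eventually)
  thus ?thesis by (rule sums_unique)
qed

lemma measurable_num_bars_ennreal:
  assumes t: "t > 0" and \<epsilon>: "\<epsilon> > 0"
  shows "(\<lambda>\<omega>. of_nat (num_bars (abs_path \<omega>) t \<epsilon>) :: ennreal) \<in> borel_measurable M"
proof -
  have "(\<lambda>\<omega>. \<Sum>k. of_bool (bar_event (abs_path \<omega>) t \<epsilon> k) :: ennreal) \<in> borel_measurable M"
    by (intro borel_measurable_suminf_order measurable_of_bool measurable_bar_event t \<epsilon>)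
  also have "?this \<longleftrightarrow> ?thesis"
    by (intro measurable_cong num_bars_eq_suminf[OF t \<epsilon>, symmetric])
  finally show ?thesis .
qed

lemma measurable_chain_of_bool:
  assumes "r > 0"
  shows "(\<lambda>\<omega>. of_bool (chain (abs_path \<omega>) e k r) :: ennreal) \<in> borel_measurable M"
  by (intro measurable_of_bool measurable_chain[where Y = "\<lambda>s \<omega>. \<bar>B s \<omega>\<bar>"] continuous_abs_path
        borel_measurable_abs measurable_BM assms)

lemma nn_expected_bars_sandwich:
  assumes t: "t > 0" and \<epsilon>: "0 < \<epsilon>'" "\<epsilon>' < \<epsilon>" "\<epsilon> < \<epsilon>''" and r: "t < r"
  shows "mean_bars t \<epsilon>'' \<le> (\<integral>\<^sup>+\<omega>. of_nat (num_bars (abs_path \<omega>) t \<epsilon>) \<partial>M)"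
    and "(\<integral>\<^sup>+\<omega>. of_nat (num_bars (abs_path \<omega>) t \<epsilon>) \<partial>M) \<le> mean_bars r \<epsilon>'"
proof -
  have \<epsilon>0: "\<epsilon> > 0" and r0: "r > 0" using \<epsilon> t r by auto
  have "mean_bars t \<epsilon>'' \<le> (\<Sum>k. chain_prob \<epsilon> (2 * k + 1) t)"
    by (rule chain_prob_suminf_lower[OF t \<epsilon>0 \<epsilon>(3)])
  also have "\<dots> = (\<integral>\<^sup>+\<omega>. (\<Sum>k. of_bool (chain (abs_path \<omega>) \<epsilon> (2 * k + 1) t)) \<partial>M)"
    unfolding chain_prob_def by (rule nn_integral_suminf[symmetric]) (rule measurable_chain_of_bool[OF t])
  also have "\<dots> \<le> (\<integral>\<^sup>+\<omega>. of_nat (num_bars (abs_path \<omega>) t \<epsilon>) \<partial>M)"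
  proof (rule nn_integral_mono)
    fix \<omega> assume \<omega>: "\<omega> \<in> space M"
    show "(\<Sum>k. of_bool (chain (abs_path \<omega>) \<epsilon> (2 * k + 1) t)) \<le> (of_nat (num_bars (abs_path \<omega>) t \<epsilon>) :: ennreal)"
    proof (rule suminf_le_const)
      fix n
      have "(of_nat (\<Sum>k<n. of_bool (chain (abs_path \<omega>) \<epsilon> (2 * k + 1) t)) :: ennreal) \<le> of_nat (num_bars (abs_path \<omega>) t \<epsilon>)"
        by (rule of_nat_mono[OF num_bars_lower[OF continuous_abs_path[OF \<omega>] t \<epsilon>0]])
      thus "(\<Sum>k<n. of_bool (chain (abs_path \<omega>) \<epsilon> (2 * k + 1) t)) \<le> (of_nat (num_bars (abs_path \<omega>) t \<epsilon>) :: ennreal)"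
        by (simp only: of_nat_sum of_nat_of_bool)
    qed auto
  qed
  finally show "mean_bars t \<epsilon>'' \<le> (\<integral>\<^sup>+\<omega>. of_nat (num_bars (abs_path \<omega>) t \<epsilon>) \<partial>M)" .
  \<comment> \<open>Two losses in \<epsilon> have to be paid: from bars to chains, down to
    \<open>h\<close>, and from chain probabilities to the Gaussian mean, down to
    \<epsilon>'.\<close>
  define h where "h = (\<epsilon> + \<epsilon>') / 2"
  have h: "0 < h" "\<epsilon>' < h" "h < \<epsilon>" using \<epsilon> by (auto simp: h_def)
  have "(\<integral>\<^sup>+\<omega>. of_nat (num_bars (abs_path \<omega>) t \<epsilon>) \<partial>M) \<le> (\<integral>\<^sup>+\<omega>. (\<Sum>k. of_bool (chain (abs_path \<omega>) h (2 * k + 1) r)) \<partial>M)"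
  proof (rule nn_integral_mono_AE)
    show "AE \<omega> in M. of_nat (num_bars (abs_path \<omega>) t \<epsilon>) \<le> (\<Sum>k. of_bool (chain (abs_path \<omega>) h (2 * k + 1) r) :: ennreal)"
      using start_BM AE_space
    proof eventually_elim
      case (elim \<omega>)
      obtain N where N: "num_bars (abs_path \<omega>) t \<epsilon> \<le> (\<Sum>k<N. of_bool (chain (abs_path \<omega>) h (2 * k + 1) r))"
        using num_bars_upper[OF continuous_abs_path[OF elim(2)] t _ _ h(1,3) r] elim by auto
      have "(of_nat (num_bars (abs_path \<omega>) t \<epsilon>) :: ennreal) \<le> of_nat (\<Sum>k<N. of_bool (chain (abs_path \<omega>) h (2 * k + 1) r))"
        by (rule of_nat_mono[OF N])
      also have "\<dots> = (\<Sum>k<N. of_bool (chain (abs_path \<omega>) h (2 * k + 1) r))"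
        by (simp only: of_nat_sum of_nat_of_bool)
      also have "\<dots> \<le> (\<Sum>k. of_bool (chain (abs_path \<omega>) h (2 * k + 1) r))"
        by (rule sum_le_suminf) auto
      finally show ?case .
    qed
  qed
  also have "\<dots> = (\<Sum>k. chain_prob h (2 * k + 1) r)"
    unfolding chain_prob_def by (rule nn_integral_suminf) (rule measurable_chain_of_bool[OF r0])
  also have "\<dots> \<le> mean_bars r \<epsilon>'"
    by (rule suminf_le_const[OF _ chain_prob_sum_upper[OF r0 \<epsilon>(1) h(2)]]) auto
  finally show "(\<integral>\<^sup>+\<omega>. of_nat (num_bars (abs_path \<omega>) t \<epsilon>) \<partial>M) \<le> mean_bars r \<epsilon>'" .
qed

lemma num_bars_integrable:
  assumes t: "t > 0" and \<epsilon>: "\<epsilon> > 0"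
  shows "integrable M (\<lambda>\<omega>. real (num_bars (abs_path \<omega>) t \<epsilon>))"
proof (rule integrableI_nonneg)
  have "(\<lambda>\<omega>. enn2real (of_nat (num_bars (abs_path \<omega>) t \<epsilon>))) \<in> borel_measurable M"
    by (rule borel_measurable_enn2real[OF measurable_num_bars_ennreal[OF t \<epsilon>]])
  thus "(\<lambda>\<omega>. real (num_bars (abs_path \<omega>) t \<epsilon>)) \<in> borel_measurable M"
    by (simp add: ennreal_of_nat_eq_real_of_nat)
  have "(\<integral>\<^sup>+\<omega>. of_nat (num_bars (abs_path \<omega>) t \<epsilon>) \<partial>M) \<le> mean_bars (t + 1) (\<epsilon> / 2)"
    using t \<epsilon> by (intro nn_expected_bars_sandwich(2)[where \<epsilon>'' = "\<epsilon> + 1"]) auto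
  also have "\<dots> < \<top>" using t \<epsilon> by (intro mean_bars_finite) auto
  finally show "(\<integral>\<^sup>+\<omega>. ennreal (real (num_bars (abs_path \<omega>) t \<epsilon>)) \<partial>M) < \<infinity>"
    by (simp add: ennreal_of_nat_eq_real_of_nat)
qed auto

lemma expected_bars_sandwich:
  assumes t: "t > 0" and \<epsilon>: "\<epsilon> > 0" and a: "0 < a'" "a' < \<epsilon> / sqrt t" "\<epsilon> / sqrt t < a''"
  shows "mean_bars_std a'' \<le> expected_bars M (\<lambda>s \<omega>. \<bar>B s \<omega>\<bar>) t \<epsilon>"
    and "expected_bars M (\<lambda>s \<omega>. \<bar>B s \<omega>\<bar>) t \<epsilon> \<le> mean_bars_std a'"
proof -
  have st: "sqrt t > 0" using t by simp
  define I where "I = (\<integral>\<^sup>+\<omega>. of_nat (num_bars (abs_path \<omega>) t \<epsilon>) \<partial>M)"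
  have eI: "expected_bars M (\<lambda>s \<omega>. \<bar>B s \<omega>\<bar>) t \<epsilon> = enn2real I"
    unfolding expected_bars_def I_def
    by (subst integral_eq_nn_integral) (use num_bars_integrable[OF t \<epsilon>] in \<open>auto simp: ennreal_of_nat_eq_real_of_nat\<close>)
  define \<epsilon>' where "\<epsilon>' = (a' * sqrt t + \<epsilon>) / 2"
  have lt: "a' * sqrt t < \<epsilon>" using a st by (simp add: pos_less_divide_eq)
  have \<epsilon>': "a' * sqrt t < \<epsilon>'" "\<epsilon>' < \<epsilon>" using lt by (auto simp: \<epsilon>'_def)
  have \<epsilon>'0: "0 < \<epsilon>'" using \<epsilon>'(1) a(1) st by (smt (verit) mult_pos_pos)
  \<comment> \<open>Chosen so that \<epsilon>' divided by the root of \<open>r\<close> is exactly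
    \<open>a'\<close>; then r > t because of how \<epsilon>' was placed.\<close>
  define r where "r = (\<epsilon>' / a')\<^sup>2"
  have sr: "sqrt r = \<epsilon>' / a'" using \<epsilon>'0 a by (simp add: r_def)
  have "sqrt t < sqrt r" unfolding sr using \<epsilon>'(1) a by (simp add: pos_less_divide_eq mult.commute)
  hence r: "t < r" by simp
  have \<epsilon>'': "\<epsilon> < a'' * sqrt t" using a(3) st by (simp add: pos_divide_less_eq)
  have a''0: "a'' > 0" using a by linarith
  have up: "I \<le> mean_bars r \<epsilon>'"
    unfolding I_def by (rule nn_expected_bars_sandwich(2)[OF t \<epsilon>'0 \<epsilon>'(2) \<epsilon>'' r])
  have lo: "mean_bars t (a'' * sqrt t) \<le> I"
    unfolding I_def by (rule nn_expected_bars_sandwich(1)[OF t \<epsilon>'0 \<epsilon>'(2) \<epsilon>'' r])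
  have 1: "mean_bars r \<epsilon>' = mean_bars 1 a'"
    using mean_bars_scale[of r \<epsilon>'] t r \<epsilon>'0 a(1) by (simp add: sr)
  have 2: "mean_bars t (a'' * sqrt t) = mean_bars 1 a''"
    using mean_bars_scale[of t "a'' * sqrt t"] t a''0 by simp
  have fin: "mean_bars 1 a' < \<top>" by (rule mean_bars_finite) (use a in auto)
  show "expected_bars M (\<lambda>s \<omega>. \<bar>B s \<omega>\<bar>) t \<epsilon> \<le> mean_bars_std a'"
    unfolding eI mean_bars_std_def using up fin unfolding 1 by (rule enn2real_mono)
  have "I < \<top>" using up fin unfolding 1 by (rule le_less_trans)
  with lo show "mean_bars_std a'' \<le> expected_bars M (\<lambda>s \<omega>. \<bar>B s \<omega>\<bar>) t \<epsilon>"
    unfolding eI mean_bars_std_def 2 by (rule enn2real_mono)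
qed

end

section \<open>Continuation of the Riemann zeta function\<close>

definition zeta_series :: "complex \<Rightarrow> complex" where
  "zeta_series s = (\<Sum>n. 1 / (of_nat (Suc n) powr s))"

lemma norm_zeta_term: "norm (1 / (of_nat (Suc n) powr s) :: complex) = real (Suc n) powr (- Re s)"
proof -
  have "norm (of_nat (Suc n) powr s :: complex) = real (Suc n) powr Re s"
    using norm_powr_real_powr[of "of_nat (Suc n)" s]
    by (metis Re_complex_of_real Reals_of_nat of_nat_0_le_iff of_real_of_nat_eq)
  thus ?thesis by (simp only: norm_divide norm_one powr_minus_divide)
qed

lemma summable_powr_Suc: "r < -1 \<Longrightarrow> summable (\<lambda>n. real (Suc n) powr r)"
  by (simp only: summable_Suc_iff[of "\<lambda>n. real n powr r"] summable_real_powr_iff)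

lemma summable_zeta_term: "Re s > 1 \<Longrightarrow> summable (\<lambda>n. norm (1 / (of_nat (Suc n) powr s) :: complex))"
  unfolding norm_zeta_term by (rule summable_powr_Suc) simp

lemma zeta_series_sums: "Re s > 1 \<Longrightarrow> (\<lambda>n. 1 / (of_nat (Suc n) powr s)) sums zeta_series s"
  unfolding zeta_series_def by (rule summable_sums, rule summable_norm_cancel, rule summable_zeta_term)

lemma norm_zeta_series_le:
  assumes "Re s \<ge> 2" shows "norm (zeta_series s) \<le> (\<Sum>n. real (Suc n) powr (-2))"
proof -
  have "norm (zeta_series s) \<le> (\<Sum>n. norm (1 / (of_nat (Suc n) powr s) :: complex))"
    unfolding zeta_series_def using assms by (intro summable_norm summable_zeta_term) simp
  also have "\<dots> \<le> (\<Sum>n. real (Suc n) powr (-2))"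
  proof (rule suminf_le)
    show "summable (\<lambda>n. norm (1 / (of_nat (Suc n) powr s) :: complex))"
      using assms by (intro summable_zeta_term) simp
    show "norm (1 / (of_nat (Suc n) powr s) :: complex) \<le> real (Suc n) powr (-2)" for n
      unfolding norm_zeta_term using assms by (intro powr_mono) auto
  qed (rule summable_powr_Suc, simp)
  finally show ?thesis .
qed

lemma open_Re_greater: "open {s. Re s > c}"
  by (rule open_halfspace_Re_gt)

lemma zeta_series_holomorphic: "zeta_series holomorphic_on {s. Re s > 1}"
proof (rule holomorphic_uniform_sequence[OF open_Re_greater])
  show "(\<lambda>s. \<Sum>i<n. 1 / (of_nat (Suc i) powr s)) holomorphic_on {s. Re s > 1}" for n
    by (intro holomorphic_intros) auto
  fix x assume "x \<in> {s. Re s > 1}"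
  hence x: "Re x > 1" by simp
  define d where "d = (Re x - 1) / 2"
  have d: "d > 0" "Re x = 1 + 2 * d" using x by (auto simp: d_def field_simps)
  have Re: "Re s \<ge> 1 + d" if "s \<in> cball x d" for s
    using that abs_Re_le_cmod[of "x - s"] d by (auto simp: dist_norm)
  have "uniform_limit (cball x d) (\<lambda>n s. \<Sum>i<n. 1 / (of_nat (Suc i) powr s)) (\<lambda>s. \<Sum>i. 1 / (of_nat (Suc i) powr s)) sequentially"
  proof (rule Weierstrass_m_test)
    show "norm (1 / (of_nat (Suc n) powr s) :: complex) \<le> real (Suc n) powr (-(1 + d))" if "s \<in> cball x d" for n s
      unfolding norm_zeta_term using Re[OF that] by (intro powr_mono) auto
    show "summable (\<lambda>n. real (Suc n) powr (-(1 + d)))" using d by (intro summable_powr_Suc) simp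
  qed
  moreover have "cball x d \<subseteq> {s. Re s > 1}" using Re d by force
  ultimately show "\<exists>d>0. cball x d \<subseteq> {s. Re s > 1} \<and>
      uniform_limit (cball x d) (\<lambda>n s. \<Sum>i<n. 1 / (of_nat (Suc i) powr s)) zeta_series sequentially"
    using d unfolding zeta_series_def[abs_def] by blast
qed

text \<open>
  The recursion comes from expanding \<open>(2m + 1) powr (1 - s) - (2m - 1) powr (1 - s)\<close> around \<open>2m\<close>
  and summing over \<open>m \<ge> 1\<close>.
\<close>

definition zeta_coeff :: "nat \<Rightarrow> complex \<Rightarrow> complex" where
  "zeta_coeff k s = ((1 - s) gchoose (2 * k + 2)) / of_nat (2 * k + 3) * (1 / 2) ^ (2 * k + 2)"

definition zeta_rec :: "(complex \<Rightarrow> complex) \<Rightarrow> complex \<Rightarrow> complex" where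
  "zeta_rec f s = 2 powr (s - 1) - (\<Sum>k. zeta_coeff k s * f (s + of_nat (2 * k + 2)))"

definition reg_zeta_series :: "complex \<Rightarrow> complex" where
  "reg_zeta_series s = (s - 1) * zeta_series s"

text \<open>Every factor satisfies |a - i| \<le> R + i = |-R - i|. One binomial coefficient thus
  majorises all those with \<open>a\<close> in a disc.\<close>

lemma norm_gbinomial_le:
  fixes a :: complex
  assumes "norm a \<le> R"
  shows "norm (a gchoose n) \<le> norm ((- of_real R :: complex) gchoose n)"
proof -
  have R: "R \<ge> 0" using assms norm_ge_zero[of a] by linarith
  have "norm (a gchoose n) = (\<Prod>i=0..<n. norm (a - of_nat i)) / fact n"
    by (simp add: gbinomial_prod_rev norm_divide prod_norm)
  also have "\<dots> \<le> (\<Prod>i=0..<n. norm (- of_real R - of_nat i :: complex)) / fact n"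
  proof (intro divide_right_mono prod_mono conjI)
    fix i
    have "norm (a - of_nat i) \<le> norm a + norm (of_nat i :: complex)" by (rule norm_triangle_ineq4)
    also have "\<dots> \<le> R + real i" using assms by simp
    also have "\<dots> = norm (- of_real (R + real i) :: complex)"
      using R by (simp only: norm_minus_cancel norm_of_real)
    also have "- of_real (R + real i) = (- of_real R - of_nat i :: complex)" by simp
    finally show "norm (a - of_nat i) \<le> norm (- of_real R - of_nat i :: complex)" .
  qed auto
  also have "\<dots> = norm ((- of_real R :: complex) gchoose n)"
    by (simp add: gbinomial_prod_rev norm_divide prod_norm)
  finally show ?thesis .
qed

text \<open>The binomial series has radius of convergence at least 1; convergence at 3/4 forces
  absolute convergence at 1/2.\<close>

lemma summable_gbinomial_half: "summable (\<lambda>n. norm ((a :: complex) gchoose n) * (1 / 2) ^ n)"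
proof -
  have "summable (\<lambda>n. (a gchoose n) * (3 / 4 :: complex) ^ n)"
    by (rule sums_summable[OF gen_binomial_complex]) (simp add: norm_divide)
  hence "summable (\<lambda>n. norm ((a gchoose n) * (1 / 2 :: complex) ^ n))"
    by (rule powser_insidea) (simp add: norm_divide)
  thus ?thesis by (simp add: norm_mult norm_power norm_divide)
qed

lemma summable_gbinomial_half_sub:
  assumes "strict_mono (g :: nat \<Rightarrow> nat)"
  shows "summable (\<lambda>k. norm ((a :: complex) gchoose (g k)) * (1 / 2) ^ g k)"
  using summable_mono_reindex[OF assms, of "\<lambda>n. if n \<in> range g then norm (a gchoose n) * (1 / 2) ^ n else 0"]
    summable_comparison_test'[OF summable_gbinomial_half[of a], of 0 "\<lambda>n. if n \<in> range g then norm (a gchoose n) * (1 / 2) ^ n else 0"]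
  by auto

lemma odd_difference_sums:
  fixes a :: complex and x :: real
  assumes "x > 1"
  shows "(\<lambda>k. 2 * (a gchoose (2 * k + 1)) * of_real x powr (a - of_nat (2 * k + 1)))
           sums (of_real (x + 1) powr a - of_real (x - 1) powr a)"
proof -
  define f where "f n = (a gchoose n) * of_real x powr (a - of_nat n) * (1 - (-1) ^ n)" for n
  have "(\<lambda>n. (a gchoose n) * of_real x powr (a - of_nat n) * of_real 1 ^ n
        - (a gchoose n) * of_real x powr (a - of_nat n) * of_real (-1) ^ n)
      sums (of_real (x + 1) powr a - of_real (x + (-1)) powr a)"
    using assms by (intro sums_diff gen_binomial_complex'') auto
  hence "f sums (of_real (x + 1) powr a - of_real (x - 1) powr a)"
    by (simp add: f_def[abs_def] right_diff_distrib)
  moreover have "f n = 0" if "n \<notin> range (\<lambda>k. 2 * k + 1 :: nat)" for n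
  proof -
    have "even n" using that by (metis oddE rangeI)
    thus ?thesis by (simp add: f_def)
  qed
  ultimately have "(\<lambda>k. f (2 * k + 1)) sums (of_real (x + 1) powr a - of_real (x - 1) powr a)"
    using sums_mono_reindex[of "\<lambda>k. 2 * k + 1" f] by (simp add: strict_mono_def)
  moreover have "f (2 * k + 1) = 2 * (a gchoose (2 * k + 1)) * of_real x powr (a - of_nat (2 * k + 1))" for k
    by (simp add: f_def)
  ultimately show ?thesis by simp
qed

text \<open>Summed over all m, the differences (2m + 3)^a - (2m + 1)^a telescope to -1, because Re a
  < 0. Expanding each and summing by columns, which Tannery's theorem permits, column 0 gives F(s)
  and column k + 1 a multiple of F(s + 2k + 2), all up to the factor -2^a.\<close>

lemma reg_zeta_series_rec:
  assumes s: "Re s > 1"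
  shows "reg_zeta_series s = zeta_rec reg_zeta_series s"
proof -
  define a where "a = 1 - s"
  have a: "Re a < 0" using s by (simp add: a_def)
  define g where "g m k = 2 * (a gchoose (2 * k + 1)) * of_real (real (2 * (m + 1))) powr (a - of_nat (2 * k + 1))" for m k :: nat
  define f where "f m = complex_of_real (real (2 * m + 1)) powr a" for m :: nat
  have inner: "(\<lambda>k. g m k) sums (f (Suc m) - f m)" for m
    using odd_difference_sums[of "real (2 * (m + 1))" a] by (simp add: g_def f_def algebra_simps)
  have ng: "norm (g m k) = 2 * norm (a gchoose (2 * k + 1)) * real (2 * (m + 1)) powr (Re a - real (2 * k + 1))" for m k
    unfolding g_def norm_mult by (simp add: norm_powr_real_powr)
  define U where "U m = real (Suc m) powr (Re a - 1)" for m
  define V where "V k = 4 * (norm (a gchoose (2 * k + 1)) * (1 / 2) ^ (2 * k + 1))" for k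
  have sU: "summable U" unfolding U_def using a by (intro summable_powr_Suc) simp
  have sV: "summable V" unfolding V_def
    by (intro summable_mult summable_gbinomial_half_sub) (simp add: strict_mono_def)
  have U0: "U m \<ge> 0" for m by (simp add: U_def)
  have V0: "V k \<ge> 0" for k by (simp add: V_def)
  \<comment> \<open>The bound factorises: the exponent Re a - 1 provides summability in
    \<open>m\<close>, and bounding (2m + 2)^(-2k) by 2^(-2k) leaves a geometric factor for
    \<open>k\<close>.\<close>
  have bound: "norm (g m k) \<le> U m * V k" for m k
  proof -
    have "real (2 * (m + 1)) powr (Re a - real (2 * k + 1)) = real (2 * (m + 1)) powr (Re a - 1) * real (2 * (m + 1)) powr (- real (2 * k))"
      by (subst powr_add[symmetric]) (simp add: algebra_simps)
    also have "\<dots> \<le> real (Suc m) powr (Re a - 1) * 2 powr (- real (2 * k))"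
      using a by (intro mult_mono powr_mono2') auto
    also have "2 powr (- real (2 * k)) = (1 / 2 :: real) ^ (2 * k)"
      by (simp only: powr_minus_divide powr_realpow[OF zero_less_numeral] power_one_over)
    finally have "2 * norm (a gchoose (2 * k + 1)) * real (2 * (m + 1)) powr (Re a - real (2 * k + 1))
       \<le> 2 * norm (a gchoose (2 * k + 1)) * (real (Suc m) powr (Re a - 1) * (1 / 2) ^ (2 * k))"
      by (rule mult_left_mono) simp
    also have "\<dots> = U m * V k" by (simp add: U_def V_def)
    finally show ?thesis unfolding ng .
  qed
  define W where "W k = 2 * (a gchoose (2 * k + 1)) * 2 powr (a - of_nat (2 * k + 1)) * zeta_series (s + of_nat (2 * k))" for k
  have column: "(\<lambda>m. g m k) sums W k" for k
  proof -
    have eq: "g m k = 2 * (a gchoose (2 * k + 1)) * 2 powr (a - of_nat (2 * k + 1)) * (1 / of_nat (Suc m) powr (s + of_nat (2 * k)))" for m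
    proof -
      have c: "a - of_nat (2 * k + 1) = - (s + of_nat (2 * k))" by (simp add: a_def)
      have "complex_of_real (real (2 * (m + 1))) = 2 * of_nat (Suc m)" by simp
      hence "complex_of_real (real (2 * (m + 1))) powr (- (s + of_nat (2 * k)))
         = 2 powr (- (s + of_nat (2 * k))) * of_nat (Suc m) powr (- (s + of_nat (2 * k)))"
        by (simp only:) (rule powr_times_real; simp del: of_nat_Suc)
      also have "(of_nat (Suc m) :: complex) powr (- (s + of_nat (2 * k))) = 1 / of_nat (Suc m) powr (s + of_nat (2 * k))"
        by (rule powr_minus_divide)
      finally show ?thesis unfolding g_def c by (simp only: mult.assoc)
    qed
    show ?thesis unfolding eq W_def using s by (intro sums_mult zeta_series_sums) simp
  qed
  have f_lim: "f \<longlonglongrightarrow> 0"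
  proof (rule tendsto_norm_zero_cancel)
    have "(\<lambda>m. real (2 * m + 1) powr Re a) \<longlonglongrightarrow> 0"
    proof (rule tendsto_neg_powr[OF a])
      show "filterlim (\<lambda>m. real (2 * m + 1)) at_top sequentially"
        by (rule filterlim_at_top_mono[OF filterlim_real_sequentially]) auto
    qed
    thus "(\<lambda>m. norm (f m)) \<longlonglongrightarrow> 0" by (simp add: f_def norm_powr_real_powr)
  qed
  have Tan: "summable (\<lambda>k. norm (W k)) \<and> ((\<lambda>n. suminf (\<lambda>k. \<Sum>m<n. g m k)) \<longlonglongrightarrow> suminf W)"
  proof (rule conjunct2[OF tannerys_theorem])
    show "(\<lambda>n. \<Sum>m<n. g m k) \<longlonglongrightarrow> W k" for k using column by (simp add: sums_def)
    have "norm (\<Sum>m<n. g m k) \<le> (\<Sum>m. U m) * V k" for n k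
    proof -
      have "norm (\<Sum>m<n. g m k) \<le> (\<Sum>m<n. U m * V k)"
        by (rule order.trans[OF norm_sum]) (intro sum_mono bound)
      also have "\<dots> = (\<Sum>m<n. U m) * V k" by (simp add: sum_distrib_right)
      also have "\<dots> \<le> (\<Sum>m. U m) * V k"
        using U0 V0 by (intro mult_right_mono sum_le_suminf sU) auto
      finally show ?thesis .
    qed
    thus "\<forall>\<^sub>F (k, n) in at_top \<times>\<^sub>F sequentially. norm (\<Sum>m<n. g m k) \<le> (\<Sum>m. U m) * V k"
      by (intro always_eventually) auto
    show "summable (\<lambda>k. (\<Sum>m. U m) * V k)" by (intro summable_mult sV)
  qed simp
  have "suminf (\<lambda>k. \<Sum>m<n. g m k) = f n - f 0" for n
  proof -
    have "(\<lambda>k. \<Sum>m<n. g m k) sums (\<Sum>m<n. f (Suc m) - f m)" by (intro sums_sum inner)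
    hence "suminf (\<lambda>k. \<Sum>m<n. g m k) = (\<Sum>m<n. f (Suc m) - f m)" by (rule sums_unique[symmetric])
    thus ?thesis by (simp only: sum_lessThan_telescope)
  qed
  hence "(\<lambda>n. f n - f 0) \<longlonglongrightarrow> suminf W" using Tan by simp
  moreover have "(\<lambda>n. f n - f 0) \<longlonglongrightarrow> 0 - f 0" by (intro tendsto_diff f_lim tendsto_const)
  ultimately have "suminf W = 0 - f 0" by (rule LIMSEQ_unique)
  hence sumW: "suminf W = -1" by (simp add: f_def)
  have summW: "summable W" using Tan by (auto intro: summable_norm_cancel)
  define C where "C = (2 :: complex) powr a"
  have C: "C \<noteq> 0" by (simp add: C_def)
  have pow: "2 powr (a - of_nat n) = C * (1 / 2) ^ n" for n
  proof -
    have "(2 :: complex) powr (of_nat n) = 2 ^ n" by (subst powr_nat) simp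
    thus ?thesis unfolding powr_diff C_def[symmetric] power_one_over by simp
  qed
  have W0: "W 0 = - C * reg_zeta_series s"
    unfolding W_def pow by (simp add: reg_zeta_series_def a_def algebra_simps)
  have WSuc: "W (Suc k) = - C * (zeta_coeff k s * reg_zeta_series (s + of_nat (2 * k + 2)))" for k
  proof -
    \<comment> \<open>Splitting off the last factor of the binomial coefficient produces -(s + 2k +
      1), which is what turns zeta at s + 2k + 2 into F there.\<close>
    have "(a gchoose Suc (2 * k + 2)) = (a gchoose (2 * k + 2)) * (a - of_nat (2 * k + 2)) / of_nat (2 * k + 3)"
      unfolding gbinomial_prod_rev by (simp add: prod.atLeast0_lessThan_Suc field_simps del: of_nat_Suc) (simp add: algebra_simps)
    hence "W (Suc k) = 2 * ((a gchoose (2 * k + 2)) * (a - of_nat (2 * k + 2)) / of_nat (2 * k + 3))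
        * (C * (1 / 2) ^ (2 * k + 3)) * zeta_series (s + of_nat (2 * k + 2))"
      unfolding W_def pow by (simp add: numeral_3_eq_3 numeral_2_eq_2)
    also have "a - of_nat (2 * k + 2) = - (s + of_nat (2 * k + 2) - 1)" by (simp add: a_def)
    also have h: "(1 / 2 :: complex) ^ (2 * k + 3) = 1 / 2 * (1 / 2) ^ (2 * k + 2)"
      by (simp add: numeral_3_eq_3)
    also have "2 * (P * - x / D) * (C * (1 / 2 * q)) * Z = - C * (P / D * q * (x * Z))" for P x D q Z :: complex
      by simp
    finally show ?thesis
      by (simp only: zeta_coeff_def reg_zeta_series_def a_def)
  qed
  have "summable (\<lambda>k. W (Suc k))" using summW by (subst summable_Suc_iff)
  hence "summable (\<lambda>k. zeta_coeff k s * reg_zeta_series (s + of_nat (2 * k + 2)))"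
    unfolding WSuc using C by (subst (asm) summable_cmult_iff) auto
  hence "(\<Sum>k. W (Suc k)) = - C * (\<Sum>k. zeta_coeff k s * reg_zeta_series (s + of_nat (2 * k + 2)))"
    unfolding WSuc by (rule suminf_mult)
  moreover have "(\<Sum>k. W (Suc k)) = -1 - W 0" using suminf_split_head[OF summW] sumW by simp
  ultimately have "C * (reg_zeta_series s + (\<Sum>k. zeta_coeff k s * reg_zeta_series (s + of_nat (2 * k + 2)))) = 1"
    by (simp add: W0 algebra_simps)
  hence "reg_zeta_series s + (\<Sum>k. zeta_coeff k s * reg_zeta_series (s + of_nat (2 * k + 2))) = 1 / C"
    using C by (simp add: field_simps)
  also have "1 / C = 2 powr (s - 1)" by (simp add: C_def a_def powr_minus_divide[symmetric])
  finally show ?thesis by (simp add: zeta_rec_def algebra_simps)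
qed

section \<open>Entire continuation by iterating the recursion\<close>

primrec reg_zeta_aux :: "nat \<Rightarrow> complex \<Rightarrow> complex" where
  "reg_zeta_aux 0 = reg_zeta_series"
| "reg_zeta_aux (Suc N) = zeta_rec (reg_zeta_aux N)"

text \<open>Each application of the recursion gains a strip of width 2. On the previous half-plane
  nothing changes, since the arguments s + 2k + 2 fall into the half-plane before it.\<close>

lemma reg_zeta_aux_Suc:
  assumes "Re s > 1 - 2 * real N"
  shows "reg_zeta_aux (Suc N) s = reg_zeta_aux N s"
  using assms
proof (induction N arbitrary: s)
  case 0
  thus ?case using reg_zeta_series_rec[of s] by simp
next
  case (Suc N)
  have "reg_zeta_aux (Suc N) (s + of_nat (2 * k + 2)) = reg_zeta_aux N (s + of_nat (2 * k + 2))" for k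
    using Suc.prems by (intro Suc.IH) simp
  thus ?case by (simp add: zeta_rec_def del: of_nat_add of_nat_mult of_nat_Suc)
qed

lemma reg_zeta_aux_eq:
  assumes "Re s > 1 - 2 * real N" "N \<le> N'"
  shows "reg_zeta_aux N' s = reg_zeta_aux N s"
  using assms(2)
proof (induction N' rule: dec_induct)
  case (step n)
  have "reg_zeta_aux (Suc n) s = reg_zeta_aux n s"
    using assms(1) step.hyps by (intro reg_zeta_aux_Suc) simp
  with step.IH show ?case by simp
qed simp

lemma reg_zeta_series_bound:
  obtains C where "C > 0" "\<And>s. Re s \<ge> 2 \<Longrightarrow> norm (reg_zeta_series s) \<le> C * (norm s + 1)"
proof (rule that)
  define C where "C = (\<Sum>n. real (Suc n) powr (-2)) + 1"
  have C0: "(\<Sum>n. real (Suc n) powr (-2)) \<ge> 0" by (intro suminf_nonneg summable_powr_Suc) auto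
  thus "C > 0" by (simp add: C_def)
  show "norm (reg_zeta_series s) \<le> C * (norm s + 1)" if "Re s \<ge> 2" for s
  proof -
    have "norm (reg_zeta_series s) \<le> (norm s + 1) * C"
      unfolding reg_zeta_series_def norm_mult using norm_zeta_series_le[OF that] norm_triangle_ineq4[of s 1]
      by (intro mult_mono) (auto simp: C_def)
    thus ?thesis by (simp add: mult.commute)
  qed
qed

lemma zeta_coeff_holomorphic: "zeta_coeff k holomorphic_on A"
  unfolding zeta_coeff_def[abs_def] gbinomial_prod_rev by (intro holomorphic_intros) (auto simp del: of_nat_add)

text \<open>Locally uniform convergence: all but finitely many shifted arguments have real part at
  least 2, where F grows at most linearly. The denominator 2k + 3 in \<open>zeta_coeff\<close>
  absorbs this growth, and binomial coefficients at -R give the majorant.\<close>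

lemma reg_zeta_aux_holomorphic: "reg_zeta_aux N holomorphic_on {s. Re s > 1 - 2 * real N}"
proof (induction N)
  case 0
  have "reg_zeta_series holomorphic_on {s. Re s > 1}"
    unfolding reg_zeta_series_def[abs_def] by (intro holomorphic_intros zeta_series_holomorphic)
  thus ?case by simp
next
  case (Suc N)
  define D where "D = {s. Re s > 1 - 2 * real (Suc N)}"
  define h where "h k s = zeta_coeff k s * reg_zeta_aux N (s + of_nat (2 * k + 2))" for k s
  obtain C where C: "C > 0" "\<And>s. Re s \<ge> 2 \<Longrightarrow> norm (reg_zeta_series s) \<le> C * (norm s + 1)"
    by (rule reg_zeta_series_bound) blast
  have hh: "h k holomorphic_on D" for k
  proof -
    have "(reg_zeta_aux N \<circ> (\<lambda>s. s + of_nat (2 * k + 2))) holomorphic_on D"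
      by (rule holomorphic_on_compose_gen[OF _ Suc.IH]) (auto intro!: holomorphic_intros simp: D_def)
    thus ?thesis unfolding h_def[abs_def] comp_def by (intro holomorphic_on_mult zeta_coeff_holomorphic)
  qed
  have "(\<lambda>s. \<Sum>k. h k s) holomorphic_on D"
  proof (rule holomorphic_uniform_sequence)
    show "open D" unfolding D_def by (rule open_Re_greater)
    show "(\<lambda>s. \<Sum>k<n. h k s) holomorphic_on D" for n by (intro holomorphic_on_sum hh)
    fix x assume "x \<in> D"
    hence x: "Re x > 1 - 2 * real (Suc N)" by (simp add: D_def)
    define d where "d = (Re x - (1 - 2 * real (Suc N))) / 2"
    define R where "R = norm x + d + 1"
    have d: "d > 0" using x by (simp add: d_def)
    have Re_s: "Re s > 1 - 2 * real (Suc N)" if "s \<in> cball x d" for s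
    proof -
      have "Re x - Re s \<le> d" using that abs_Re_le_cmod[of "x - s"] by (auto simp: dist_norm)
      moreover have "Re x = 1 - 2 * real (Suc N) + 2 * d" by (simp add: d_def field_simps)
      ultimately show ?thesis using d by linarith
    qed
    have norm_s: "norm s \<le> R - 1" if "s \<in> cball x d" for s
      using that norm_triangle_ineq2[of s x] by (auto simp: dist_norm R_def norm_minus_commute)
    define M where "M k = C * (R + 1) * (norm ((- of_real R :: complex) gchoose (2 * k + 2)) * (1 / 2) ^ (2 * k + 2))" for k
    have "summable M"
      unfolding M_def by (intro summable_mult summable_gbinomial_half_sub) (simp add: strict_mono_def)
    moreover have "norm (h k s) \<le> M k" if k: "k \<ge> N + 1" and s: "s \<in> cball x d" for k s
    proof -
      have R0: "R \<ge> 1" using d by (simp add: R_def)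
      have "real k \<ge> real N + 1" using k by linarith
      hence Re2: "Re (s + of_nat (2 * k + 2)) \<ge> 2" using Re_s[OF s] by simp
      have eq: "reg_zeta_aux N (s + of_nat (2 * k + 2)) = reg_zeta_series (s + of_nat (2 * k + 2))"
        using reg_zeta_aux_eq[of 0 "s + of_nat (2 * k + 2)" N] Re2 by simp
      have "norm (s + of_nat (2 * k + 2)) \<le> norm s + real (2 * k + 2)"
        using norm_triangle_ineq[of s "of_nat (2 * k + 2)"] by (simp only: norm_of_nat)
      hence "norm (s + of_nat (2 * k + 2)) + 1 \<le> R + real (2 * k + 2)" using norm_s[OF s] by linarith
      also have "\<dots> \<le> (R + 1) * real (2 * k + 3)"
        using R0 by (simp add: algebra_simps)
      finally have "C * (norm (s + of_nat (2 * k + 2)) + 1) \<le> C * ((R + 1) * real (2 * k + 3))"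
        using C by (intro mult_left_mono) auto
      hence F: "norm (reg_zeta_aux N (s + of_nat (2 * k + 2))) \<le> C * ((R + 1) * real (2 * k + 3))"
        unfolding eq using C(2)[OF Re2] by linarith
      have "norm (1 - s) \<le> R" using norm_triangle_ineq4[of 1 s] norm_s[OF s] by simp
      hence G: "norm ((1 - s) gchoose (2 * k + 2)) \<le> norm ((- of_real R :: complex) gchoose (2 * k + 2))"
        by (rule norm_gbinomial_le)
      have "norm (h k s) = norm ((1 - s) gchoose (2 * k + 2)) * ((1 / 2) ^ (2 * k + 2) / real (2 * k + 3))
          * norm (reg_zeta_aux N (s + of_nat (2 * k + 2)))"
        unfolding h_def zeta_coeff_def norm_mult norm_divide norm_power norm_of_nat by simp
      also have "\<dots> \<le> norm ((- of_real R :: complex) gchoose (2 * k + 2)) * ((1 / 2) ^ (2 * k + 2) / real (2 * k + 3))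
          * (C * ((R + 1) * real (2 * k + 3)))"
        by (intro mult_mono F G) auto
      also have "\<dots> = M k"
      proof -
        have "P * (q / D) * (C * ((R + 1) * D)) = C * (R + 1) * (P * q)" if "D \<noteq> 0" for P q D :: real
          using that by simp
        moreover have "real (2 * k + 3) \<noteq> 0" by simp
        ultimately show ?thesis unfolding M_def by blast
      qed
      finally show ?thesis .
    qed
    hence "\<forall>\<^sub>F k in sequentially. \<forall>s\<in>cball x d. norm (h k s) \<le> M k"
      unfolding eventually_sequentially by blast
    ultimately have "uniform_limit (cball x d) (\<lambda>n s. \<Sum>k<n. h k s) (\<lambda>s. \<Sum>k. h k s) sequentially"
      by (intro Weierstrass_m_test_ev)
    moreover have "cball x d \<subseteq> D" using Re_s by (auto simp: D_def)
    ultimately show "\<exists>d>0. cball x d \<subseteq> D \<and> uniform_limit (cball x d) (\<lambda>n s. \<Sum>k<n. h k s) (\<lambda>s. \<Sum>k. h k s) sequentially"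
      using d by blast
  qed
  thus ?case unfolding reg_zeta_aux.simps zeta_rec_def[abs_def] h_def D_def by (intro holomorphic_intros) auto
qed

definition reg_zeta :: "complex \<Rightarrow> complex" where
  "reg_zeta s = reg_zeta_aux (nat \<lceil>1 - Re s\<rceil> + 1) s"

lemma reg_zeta_index: "Re s > 1 - 2 * real (nat \<lceil>1 - Re s\<rceil> + 1)"
  using real_nat_ceiling_ge[of "1 - Re s"] of_nat_0_le_iff[of "nat \<lceil>1 - Re s\<rceil>"] by simp

lemma reg_zeta_eq_aux:
  assumes "Re s > 1 - 2 * real N" shows "reg_zeta s = reg_zeta_aux N s"
proof -
  define N' where "N' = nat \<lceil>1 - Re s\<rceil> + 1"
  have N': "Re s > 1 - 2 * real N'" unfolding N'_def by (rule reg_zeta_index)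
  have "reg_zeta s = reg_zeta_aux N' s" by (simp add: reg_zeta_def N'_def)
  also have "\<dots> = reg_zeta_aux (max N N') s" by (rule reg_zeta_aux_eq[OF N', symmetric]) simp
  also have "\<dots> = reg_zeta_aux N s" by (rule reg_zeta_aux_eq[OF assms]) simp
  finally show ?thesis .
qed

lemma reg_zeta_holomorphic: "reg_zeta holomorphic_on A"
proof -
  have "reg_zeta field_differentiable at s" for s
  proof -
    define N where "N = nat \<lceil>1 - Re s\<rceil> + 1"
    have "reg_zeta holomorphic_on {s. Re s > 1 - 2 * real N}"
      by (rule holomorphic_transform[OF reg_zeta_aux_holomorphic]) (simp add: reg_zeta_eq_aux)
    moreover have "s \<in> {s. Re s > 1 - 2 * real N}" unfolding N_def mem_Collect_eq by (rule reg_zeta_index)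
    ultimately show ?thesis by (rule holomorphic_on_imp_differentiable_at[OF _ open_Re_greater])
  qed
  thus ?thesis by (intro holomorphic_onI) (rule field_differentiable_at_within)
qed

lemma reg_zeta_rec: "reg_zeta s = zeta_rec reg_zeta s"
proof -
  define N where "N = nat \<lceil>1 - Re s\<rceil> + 1"
  have N: "Re s > 1 - 2 * real N" unfolding N_def by (rule reg_zeta_index)
  have "reg_zeta s = reg_zeta_aux (Suc N) s" using N by (intro reg_zeta_eq_aux) simp
  moreover have "reg_zeta (s + of_nat (2 * k + 2)) = reg_zeta_aux N (s + of_nat (2 * k + 2))" for k
    using N by (intro reg_zeta_eq_aux) simp
  ultimately show ?thesis by (simp add: zeta_rec_def del: of_nat_add of_nat_mult of_nat_Suc)
qed

lemma reg_zeta_eq_series: "Re s > 1 \<Longrightarrow> reg_zeta s = (s - 1) * zeta_series s"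
  using reg_zeta_eq_aux[of 0 s] by (simp add: reg_zeta_series_def)

text \<open>At s = 1 - n the recursion is a finite sum of ordinary binomial coefficients. For n = 0
  and n = 1 it is empty, which gives F(1) and F(0).\<close>

lemma zeta_coeff_nat:
  assumes "1 - s = of_nat n"
  shows "zeta_coeff k s = of_nat (n choose (2 * k + 2)) / of_nat (2 * k + 3) * (1 / 2) ^ (2 * k + 2)"
  unfolding zeta_coeff_def assms by (simp add: binomial_gbinomial)

lemma reg_zeta_1: "reg_zeta 1 = 1"
proof -
  have "zeta_coeff k 1 = 0" for k by (subst zeta_coeff_nat[of _ 0]) auto
  thus ?thesis by (subst reg_zeta_rec) (simp add: zeta_rec_def)
qed

lemma reg_zeta_0: "reg_zeta 0 = 1 / 2"
proof -
  have "zeta_coeff k 0 = 0" for k by (subst zeta_coeff_nat[of _ 1]) auto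
  thus ?thesis by (subst reg_zeta_rec) (simp add: zeta_rec_def powr_minus_divide)
qed

text \<open>In the recursion the terms k < j vanish by induction and those with k > j because the
  binomial coefficient does. The term k = j involves F(0) = 1/2 and equals 2^(s - 1), cancelling the
  leading term.\<close>

lemma reg_zeta_neg_even: "reg_zeta (- of_nat (2 * Suc j)) = 0"
proof (induction j rule: less_induct)
  case (less j)
  define s where "s = (- of_nat (2 * Suc j) :: complex)"
  define t where "t k = zeta_coeff k s * reg_zeta (s + of_nat (2 * k + 2))" for k
  have n: "1 - s = of_nat (2 * j + 3)" by (simp add: s_def)
  have "t k = 0" if "k \<noteq> j" for k
  proof (cases "k < j")
    case True
    define i where "i = j - Suc k"
    have eq: "s + of_nat (2 * k + 2) = - of_nat (2 * Suc i)"
      using True by (simp add: s_def i_def of_nat_diff algebra_simps)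
    have "i < j" using True by (simp add: i_def)
    thus ?thesis unfolding t_def eq by (simp only: less.IH mult_zero_right)
  next
    case False
    hence "2 * j + 3 < 2 * k + 2" using that by simp
    thus ?thesis unfolding t_def by (subst zeta_coeff_nat[OF n]) (simp add: binomial_eq_0)
  qed
  hence "(\<Sum>k. t k) = (\<Sum>k\<in>{j}. t k)" by (intro suminf_finite) auto
  also have "\<dots> = t j" by simp
  also have "t j = (1 / 2) ^ (2 * j + 3)"
  proof -
    have "(2 * j + 3) choose (2 * j + 2) = 2 * j + 3"
      using binomial_symmetric[of "2 * j + 2" "2 * j + 3"] by simp
    moreover have "s + of_nat (2 * j + 2) = 0" by (simp add: s_def)
    ultimately have "t j = of_nat (2 * j + 3) / of_nat (2 * j + 3) * (1 / 2) ^ (2 * j + 2) * (1 / 2)"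
      unfolding t_def by (subst zeta_coeff_nat[OF n]) (simp only: reg_zeta_0)
    also have "of_nat (2 * j + 3) / of_nat (2 * j + 3) = (1 :: complex)"
      by (rule divide_self) (unfold of_nat_eq_0_iff, simp)
    also have "1 * (1 / 2) ^ (2 * j + 2) * (1 / 2) = (1 / 2 :: complex) ^ (2 * j + 3)"
      by (simp add: numeral_3_eq_3)
    finally show ?thesis .
  qed
  finally have "(\<Sum>k. t k) = (1 / 2) ^ (2 * j + 3)" .
  moreover have "2 powr (s - 1) = (1 / 2) ^ (2 * j + 3)"
  proof -
    have "s - 1 = - of_nat (2 * j + 3)" using n by (metis minus_diff_eq)
    hence "2 powr (s - 1) = 1 / (2 powr of_nat (2 * j + 3) :: complex)" by (simp only: powr_minus_divide)
    also have "2 powr of_nat (2 * j + 3) = (2 :: complex) ^ (2 * j + 3)" by (subst powr_nat) simp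
    finally show ?thesis by (simp add: power_one_over)
  qed
  ultimately show ?case
    unfolding s_def[symmetric] by (subst reg_zeta_rec) (simp add: zeta_rec_def t_def)
qed

lemma riemann_zeta_eq: "riemann_zeta s = reg_zeta s / (s - 1)"
proof -
  define f where "f = (\<lambda>s. reg_zeta s / (s - 1))"
  have ana: "reg_zeta analytic_on A" for A
    using reg_zeta_holomorphic[of UNIV] by (simp add: analytic_on_open[symmetric] analytic_on_subset[of _ UNIV])
  have nice: "f nicely_meromorphic_on UNIV"
    unfolding nicely_meromorphic_on_def
  proof (intro conjI ballI)
    show "f meromorphic_on UNIV"
      unfolding f_def by (intro meromorphic_intros analytic_on_imp_meromorphic_on ana)
    fix z :: complex
    show "is_pole f z \<and> f z = 0 \<or> f \<midarrow>z\<rightarrow> f z"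
    proof (cases "z = 1")
      case True
      have "is_pole f 1"
        unfolding f_def
      proof (rule is_pole_divide)
        show "isCont reg_zeta 1"
          using reg_zeta_holomorphic[of UNIV] by (simp add: analytic_at_imp_isCont ana)
        show "filterlim (\<lambda>s. s - 1) (at 0) (at (1::complex))"
          by (intro filterlim_atI) (auto intro!: tendsto_eq_intros simp: eventually_at_filter)
      qed (simp add: reg_zeta_1)
      \<comment> \<open>Division by zero makes f 1 = 0, the value that the normal form prescribes at
        a pole.\<close>
      with True show ?thesis by (simp add: f_def)
    next
      case False
      have "isCont f z" unfolding f_def
        using False by (intro continuous_intros analytic_at_imp_isCont ana) auto
      thus ?thesis by (simp add: isCont_def)
    qed
  qed
  have "riemann_zeta = f"
    unfolding riemann_zeta_def
  proof (rule meromorphic_continuation_eqI[OF nice])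
    show "f z = (\<Sum>n. 1 / (of_nat (Suc n) powr z))" if "z \<in> {s. 1 < Re s}" for z
      using that by (auto simp: f_def reg_zeta_eq_series zeta_series_def)
    show "open {s. 1 < Re s}" by (rule open_Re_greater)
    have "(2 :: complex) \<in> {s. 1 < Re s}" by simp
    thus "{s. 1 < Re s} \<noteq> {}" by blast
  qed simp
  thus ?thesis unfolding f_def by (rule fun_cong)
qed

section \<open>Mellin transforms\<close>

lemma norm_of_real_powr: "a \<ge> 0 \<Longrightarrow> norm (complex_of_real a powr p) = a powr Re p"
  by (simp add: norm_powr_real_powr)

lemma powr_real_integrable:
  fixes b x :: real
  assumes "b \<ge> 0" "x > 0"
  shows "set_integrable lborel {0<..b} (\<lambda>a. a powr (x - 1))"
proof -
  have "((\<lambda>a. a powr (x - 1)) has_integral (b powr (x - 1 + 1) / (x - 1 + 1))) {0..b}"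
    using assms by (intro has_integral_powr_from_0) auto
  hence "(\<lambda>a. a powr (x - 1)) absolutely_integrable_on {0..b}"
    by (intro nonnegative_absolutely_integrable_1) (auto simp: integrable_on_def)
  hence "set_integrable lborel {0..b} (\<lambda>a. a powr (x - 1))"
    unfolding set_integrable_def by (subst (asm) integrable_completion) auto
  thus ?thesis by (rule set_integrable_subset) auto
qed

lemma powr_complex_integrable:
  assumes "b \<ge> 0" "Re p > 0"
  shows "set_integrable lborel {0<..b} (\<lambda>a. of_real a powr (p - 1) :: complex)"
proof (rule set_integrable_bound[OF powr_real_integrable[OF assms]])
  show "set_borel_measurable lborel {0<..b} (\<lambda>a. of_real a powr (p - 1) :: complex)"
    unfolding set_borel_measurable_def by measurable
qed (auto simp: norm_of_real_powr)

lemma powr_complex_integral: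
  assumes b: "b \<ge> 0" and p: "Re p > 0"
  shows "(LBINT a:{0<..b}. of_real a powr (p - 1)) = of_real b powr p / p"
proof (cases "b = 0")
  case False
  hence b: "b > 0" using b by simp
  have p0: "p \<noteq> 0" using p by auto
  have "(LBINT a=ereal 0..ereal b. of_real a powr (p - 1)) = of_real b powr p / p - 0"
  proof (rule interval_integral_FTC_integrable)
    show "ereal 0 < ereal b" using b by simp
    show "((\<lambda>a. of_real a powr p / p) has_vector_derivative of_real x powr (p - 1)) (at x)"
      if "ereal 0 < ereal x" for x
    proof -
      have "((\<lambda>z. z powr p / p) has_field_derivative (p * of_real x powr (p - 1)) / p) (at (of_real x))"
        using that by (intro DERIV_cdivide has_field_derivative_powr) auto
      thus ?thesis using p0 by (intro has_vector_derivative_real_field) simp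
    qed
    show "isCont (\<lambda>a. of_real a powr (p - 1) :: complex) x" if "ereal 0 < ereal x" for x
      using that by (intro continuous_intros) auto
    show "set_integrable lborel (einterval (ereal 0) (ereal b)) (\<lambda>a. of_real a powr (p - 1) :: complex)"
      by (rule set_integrable_subset[OF powr_complex_integrable[of b p]]) (use b p in \<open>auto simp: einterval_def\<close>)
    have "((\<lambda>a::real. a powr Re p / norm p) \<longlongrightarrow> 0 powr Re p / norm p) (at_right 0)"
      using p p0 by (intro tendsto_intros) (auto simp: eventually_at_filter)
    hence "((\<lambda>a::real. a powr Re p / norm p) \<longlongrightarrow> 0) (at_right 0)" by simp
    hence "((\<lambda>a. norm (complex_of_real a powr p / p)) \<longlongrightarrow> 0) (at_right 0)"
      by (rule Lim_transform_eventually) (use p in \<open>auto simp: eventually_at_filter norm_divide norm_of_real_powr\<close>)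
    hence "((\<lambda>a. complex_of_real a powr p / p) \<longlongrightarrow> 0) (at_right 0)" by (rule tendsto_norm_zero_cancel)
    thus "(((\<lambda>a. complex_of_real a powr p / p) \<circ> real_of_ereal) \<longlongrightarrow> 0) (at_right (ereal 0))"
      by (simp add: ereal_tendsto_simps)
    have "isCont (\<lambda>a. complex_of_real a powr p / p) b"
      using b p0 by (intro continuous_intros) auto
    hence "((\<lambda>a. complex_of_real a powr p / p) \<longlongrightarrow> of_real b powr p / p) (at_left b)"
      unfolding isCont_def by (rule filterlim_mono) (auto intro: at_le)
    thus "(((\<lambda>a. complex_of_real a powr p / p) \<circ> real_of_ereal) \<longlongrightarrow> of_real b powr p / p) (at_left (ereal b))"
      by (simp add: ereal_tendsto_simps)
  qed
  thus ?thesis using b by (simp add: interval_integral_Ioc)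
qed (simp add: set_lebesgue_integral_def)

text \<open>The substitution z = sqrt (2 u) turns the moment into the Gamma integral at w = (p +
  1)/2.\<close>

lemma gauss_half_moment:
  assumes p: "Re p > -1"
  shows "set_integrable lborel {0<..} (\<lambda>z. exp (- z\<^sup>2 / 2) *\<^sub>R (complex_of_real z powr p))"
    and "(LBINT z:{0<..}. exp (- z\<^sup>2 / 2) *\<^sub>R (complex_of_real z powr p))
           = 2 powr ((p - 1) / 2) * Gamma ((p + 1) / 2)"
proof -
  define w where "w = (p + 1) / 2"
  have w: "Re w > 0" using p by (simp add: w_def)
  define g :: "real \<Rightarrow> real" where "g u = sqrt (2 * u)" for u
  define g' :: "real \<Rightarrow> real" where "g' u = 1 / sqrt (2 * u)" for u
  define f where "f z = exp (- z\<^sup>2 / 2) *\<^sub>R (complex_of_real z powr p)" for z :: real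
  define fr where "fr z = exp (- z\<^sup>2 / 2) * z powr Re p" for z :: real
  have G: "set_integrable lborel {0<..} (\<lambda>u. of_real u powr (w - 1) / of_real (exp u) :: complex)"
    using absolutely_integrable_Gamma_integral'[OF w] unfolding set_integrable_def
    by (subst (asm) integrable_completion) auto
  have deriv: "(g has_real_derivative g' u) (at u)" if "u > 0" for u
    unfolding g_def g'_def using that by (auto intro!: derivative_eq_intros simp: field_simps)
  have crp: "complex_of_real v powr q = exp (q * of_real (ln v))" if "v > 0" for v q
    using that by (simp add: powr_def Ln_of_real)
  have fg: "g' u *\<^sub>R f (g u) = 2 powr ((p - 1) / 2) * (of_real u powr (w - 1) / of_real (exp u))" if u: "u > 0" for u
  proof -
    \<comment> \<open>All positive quantities are written as exponentials, so the identity of powers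
      reduces to a linear identity between exponents.\<close>
    define L where "L = ln 2 + ln u"
    have L: "ln (sqrt (2 * u)) = L / 2" using u by (simp add: ln_sqrt ln_mult L_def)
    have "sqrt (2 * u) = exp (L / 2)" using u by (subst L[symmetric]) simp
    hence g'L: "g' u = exp (- L / 2)" by (simp add: g'_def exp_minus inverse_eq_divide)
    have "g' u *\<^sub>R f (g u) = of_real (exp (- L / 2)) * (of_real (exp (- u)) * exp (p * of_real (L / 2)))"
    proof -
      have "f (g u) = of_real (exp (- u)) * exp (p * of_real (L / 2))"
        using u crp[of "sqrt (2 * u)" p] unfolding f_def g_def L by (simp add: scaleR_conv_of_real)
      thus ?thesis unfolding g'L by (simp only: scaleR_conv_of_real)
    qed
    also have "\<dots> = exp (of_real (- L / 2) + (of_real (- u) + p * of_real (L / 2)))"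
      by (simp only: exp_add exp_of_real)
    also have "of_real (- L / 2) + (of_real (- u) + p * of_real (L / 2))
       = (p - 1) / 2 * of_real (ln 2) + ((w - 1) * of_real (ln u) + of_real (- u))"
      by (simp add: L_def w_def field_simps)
    also have "exp \<dots> = exp ((p - 1) / 2 * of_real (ln 2)) * (exp ((w - 1) * of_real (ln u)) * of_real (exp (- u)))"
      by (simp only: exp_add exp_of_real)
    also have "\<dots> = 2 powr ((p - 1) / 2) * (of_real u powr (w - 1) / of_real (exp u))"
    proof -
      have 2: "(2 :: complex) powr ((p - 1) / 2) = exp ((p - 1) / 2 * of_real (ln 2))"
        using crp[of 2 "(p - 1) / 2"] by (simp only: of_real_numeral zero_less_numeral simp_thms)
      have "complex_of_real (exp (- u)) = 1 / of_real (exp u)"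
        by (simp only: exp_minus inverse_eq_divide of_real_divide of_real_1)
      thus ?thesis unfolding crp[OF u] 2 by (simp only: times_divide_eq_right mult_1_right)
    qed
    finally show ?thesis .
  qed
  have gpos: "g u > 0" if "u > 0" for u using that by (simp add: g_def)
  have norm_f: "norm (f z) = fr z" if "z > 0" for z
    using that by (simp add: f_def fr_def norm_of_real_powr)
  have int_fg: "set_integrable lborel {0<..} (\<lambda>u. g' u *\<^sub>R f (g u))"
  proof -
    have "set_integrable lborel {0<..} (\<lambda>u. 2 powr ((p - 1) / 2) * (of_real u powr (w - 1) / of_real (exp u)) :: complex)"
      by (rule set_integrable_mult_right) (use G in simp)
    thus ?thesis by (rule set_integrable_cong[THEN iffD1, rotated -1]) (auto simp: fg)
  qed
  have e0: "einterval 0 \<infinity> = {0::real<..}" by (auto simp: einterval_def)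
  have g0: "((ereal \<circ> g \<circ> real_of_ereal) \<longlongrightarrow> 0) (at_right 0)"
  proof -
    have "(g \<longlongrightarrow> g 0) (at_right 0)" unfolding g_def by (intro tendsto_intros)
    moreover have "g 0 = 0" by (simp add: g_def)
    ultimately show ?thesis unfolding zero_ereal_def by (simp only: ereal_tendsto_simps)
  qed
  have ginf: "((ereal \<circ> g \<circ> real_of_ereal) \<longlongrightarrow> \<infinity>) (at_left \<infinity>)"
  proof -
    have "filterlim g at_top at_top" unfolding g_def
      by (intro filterlim_compose[OF sqrt_at_top] filterlim_tendsto_pos_mult_at_top[OF tendsto_const _ filterlim_ident]) simp
    thus ?thesis by (simp only: ereal_tendsto_simps)
  qed
  have contf: "isCont f z" if "z > 0" for z
    unfolding f_def using that by (intro continuous_intros) auto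
  have contfr: "isCont fr z" if "z > 0" for z
    unfolding fr_def using that by (intro continuous_intros) auto
  have contg': "isCont g' u" if "u > 0" for u
    unfolding g'_def using that by (intro continuous_intros) auto
  have g'nn: "g' u \<ge> 0" if "u \<ge> 0" for u using that by (simp add: g'_def)
  \<comment> \<open>Integrability is first transported for the nonnegative function
    \<open>fr\<close>, the norm of \<open>f\<close>, and then passes to \<open>f\<close> by
    domination.\<close>
  have int_fr: "set_integrable lborel (einterval 0 \<infinity>) fr"
  proof (rule interval_integral_substitution_nonneg(1)[where g = g and g' = g' and a = 0 and b = \<infinity>])
    have "set_integrable lborel {0<..} (\<lambda>u. norm (g' u *\<^sub>R f (g u)))"
      using int_fg by (rule set_integrable_norm)
    thus "set_integrable lborel (einterval 0 \<infinity>) (\<lambda>u. fr (g u) * g' u)"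
      unfolding e0 by (rule set_integrable_cong[THEN iffD1, rotated -1]) (auto simp: norm_f[OF gpos] g'_def)
  qed (use deriv gpos contfr contg' g0 ginf g'nn in \<open>auto simp: fr_def zero_ereal_def\<close>)
  have int_f: "set_integrable lborel {0<..} f"
  proof (rule set_integrable_bound[OF int_fr[unfolded e0]])
    show "set_borel_measurable lborel {0<..} f"
      unfolding set_borel_measurable_def f_def by measurable
  qed (auto simp: norm_f fr_def)
  thus "set_integrable lborel {0<..} (\<lambda>z. exp (- z\<^sup>2 / 2) *\<^sub>R (complex_of_real z powr p))"
    unfolding f_def .
  have "(LBINT z=0..\<infinity>. f z) = (LBINT u=0..\<infinity>. g' u *\<^sub>R f (g u))"
    by (rule interval_integral_substitution_integrable)
      (use deriv gpos contf contg' g0 ginf int_f int_fg g'nn in \<open>auto simp: e0 zero_ereal_def\<close>)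
  hence "(LBINT z:{0<..}. f z) = (LBINT u:{0<..}. g' u *\<^sub>R f (g u))"
    by (simp only: interval_lebesgue_integral_0_infty)
  also have "\<dots> = (LBINT u:{0<..}. 2 powr ((p - 1) / 2) * (of_real u powr (w - 1) / of_real (exp u)))"
    by (rule set_lebesgue_integral_cong) (auto simp: fg)
  also have "\<dots> = 2 powr ((p - 1) / 2) * (LBINT u:{0<..}. of_real u powr (w - 1) / of_real (exp u))"
    by (rule set_integral_mult_right)
  also have "(LBINT u:{0<..}. of_real u powr (w - 1) / of_real (exp u)) = Gamma w"
    using set_borel_integral_eq_integral(2)[OF G] Gamma_integral_complex'[OF w] by (simp add: integral_unique)
  finally show "(LBINT z:{0<..}. exp (- z\<^sup>2 / 2) *\<^sub>R (complex_of_real z powr p))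
           = 2 powr ((p - 1) / 2) * Gamma ((p + 1) / 2)"
    by (simp add: f_def w_def)
qed

text \<open>The absolute moment of order p of a standard Gaussian variable.\<close>

definition gauss_moment :: "complex \<Rightarrow> complex" where
  "gauss_moment p = 2 powr (p / 2) * Gamma ((p + 1) / 2) / of_real (sqrt pi)"

lemma gauss_moment:
  assumes p: "Re p > -1"
  shows "has_bochner_integral (gauss_measure 1) (\<lambda>z. complex_of_real \<bar>z\<bar> powr p) (gauss_moment p)"
proof -
  define f where "f z = normal_density 0 1 z *\<^sub>R (complex_of_real \<bar>z\<bar> powr p)" for z
  have eq: "indicator {0..} z *\<^sub>R f z = (1 / sqrt (2 * pi)) *\<^sub>R (indicator {0<..} z *\<^sub>R (exp (- z\<^sup>2 / 2) *\<^sub>R (complex_of_real z powr p)))" for z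
    by (cases "z > 0"; cases "z = 0") (auto simp: f_def normal_density_def)
  have "has_bochner_integral lborel (\<lambda>z. indicator {0..} z *\<^sub>R f z)
     ((1 / sqrt (2 * pi)) *\<^sub>R (2 powr ((p - 1) / 2) * Gamma ((p + 1) / 2)))"
    unfolding eq
    using gauss_half_moment[OF p] unfolding set_integrable_def set_lebesgue_integral_def
    by (intro has_bochner_integral_scaleR_right) (auto simp: has_bochner_integral_iff)
  hence "has_bochner_integral lborel f (2 *\<^sub>R ((1 / sqrt (2 * pi)) *\<^sub>R (2 powr ((p - 1) / 2) * Gamma ((p + 1) / 2))))"
    by (rule has_bochner_integral_even_function) (simp add: f_def normal_density_def)
  also have "2 *\<^sub>R ((1 / sqrt (2 * pi)) *\<^sub>R (2 powr ((p - 1) / 2) * Gamma ((p + 1) / 2))) = gauss_moment p"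
  proof -
    have "complex_of_real (sqrt 2) = 2 powr (1 / 2)"
      using powr_of_real[of 2 "1 / 2"] by (simp add: powr_half_sqrt)
    moreover have "2 powr (p / 2) = 2 powr ((p - 1) / 2) * (2 powr (1 / 2) :: complex)"
    proof -
      have "p / 2 = (p - 1) / 2 + 1 / 2" by (simp add: field_simps)
      thus ?thesis by (simp only: powr_add)
    qed
    ultimately have "2 powr (p / 2) = 2 powr ((p - 1) / 2) * complex_of_real (sqrt 2)" by simp
    moreover have "2 * (1 / sqrt (2 * pi)) = sqrt 2 / sqrt pi"
    proof -
      have "2 * (1 / sqrt (2 * pi)) = 2 / sqrt 2 / sqrt pi" by (simp add: real_sqrt_mult)
      also have "2 / sqrt 2 = sqrt (2 :: real)" by (rule real_div_sqrt) simp
      finally show ?thesis .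
    qed
    ultimately show ?thesis
      unfolding gauss_moment_def scaleR_scaleR
      by (simp only: scaleR_conv_of_real of_real_divide times_divide_eq_left times_divide_eq_right mult_ac)
  qed
  finally show ?thesis
    unfolding f_def by (intro has_bochner_integral_density) auto
qed

section \<open>The count split into odd levels n = 2k + 1, and Fubini on each level\<close>

definition level_kernel :: "nat \<Rightarrow> complex \<Rightarrow> real \<times> real \<Rightarrow> complex" where
  "level_kernel k p = (\<lambda>(z, a). if 0 < a \<and> real (2 * k + 1) * a \<le> \<bar>z\<bar> then of_real a powr (p - 1) else 0)"

interpretation std_gauss: prob_space "gauss_measure 1"
  by (rule prob_space_normal_density) simp

interpretation gauss_lborel: pair_sigma_finite "gauss_measure 1" "lborel :: real measure" ..

lemma level_kernel_eq:
  "level_kernel k p (z, a) = indicator {0<..\<bar>z\<bar> / real (2 * k + 1)} a *\<^sub>R (of_real a powr (p - 1))"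
  by (auto simp: level_kernel_def pos_le_divide_eq mult.commute indicator_def)

lemma measurable_level_kernel [measurable]:
  "level_kernel k p \<in> borel_measurable (gauss_measure 1 \<Otimes>\<^sub>M lborel)"
  unfolding level_kernel_def by measurable

lemma of_real_inverse_powr:
  assumes "c > 0" shows "complex_of_real (1 / c) powr p = of_real c powr (- p)"
proof -
  have "complex_of_real (1 / c) powr p * of_real c powr p = (of_real (1 / c) * of_real c) powr p"
    by (rule powr_times_real[symmetric]) (use assms in auto)
  also have "complex_of_real (1 / c) * of_real c = 1" using assms by simp
  finally have "complex_of_real (1 / c) powr p * of_real c powr p = 1" by simp
  moreover have "complex_of_real c powr p \<noteq> 0" using assms by simp
  ultimately show ?thesis by (simp only: powr_minus) (metis inverse_unique mult.commute)
qed

lemma integral_level_kernel_inner: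
  assumes p: "Re p > 0"
  shows "integrable lborel (\<lambda>a. level_kernel k p (z, a))"
    and "(\<integral>a. level_kernel k p (z, a) \<partial>lborel) = of_real (real (2 * k + 1)) powr (-p) / p * (of_real \<bar>z\<bar> powr p)"
proof -
  have b: "\<bar>z\<bar> / real (2 * k + 1) \<ge> 0" by simp
  show "integrable lborel (\<lambda>a. level_kernel k p (z, a))"
    unfolding level_kernel_eq using powr_complex_integrable[OF b p] unfolding set_integrable_def .
  have "(\<integral>a. level_kernel k p (z, a) \<partial>lborel) = of_real (\<bar>z\<bar> / real (2 * k + 1)) powr p / p"
    unfolding level_kernel_eq using powr_complex_integral[OF b p] unfolding set_lebesgue_integral_def .
  also have "complex_of_real (\<bar>z\<bar> / real (2 * k + 1)) powr p = of_real \<bar>z\<bar> powr p * of_real (1 / real (2 * k + 1)) powr p"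
    by (subst powr_times_real[symmetric]) (auto simp: of_real_divide)
  also have "complex_of_real (1 / real (2 * k + 1)) powr p = of_real (real (2 * k + 1)) powr (- p)"
    by (rule of_real_inverse_powr) simp
  finally show "(\<integral>a. level_kernel k p (z, a) \<partial>lborel) = of_real (real (2 * k + 1)) powr (-p) / p * (of_real \<bar>z\<bar> powr p)"
    by simp
qed

text \<open>Taking norms replaces p by Re p, so absolute integrability and the bounds on the norms
  come from the same explicit integral.\<close>

lemma norm_level_kernel: "complex_of_real (norm (level_kernel k p y)) = level_kernel k (of_real (Re p)) y"
proof -
  have "complex_of_real (norm (complex_of_real a powr (p - 1))) = of_real a powr (of_real (Re p) - 1)" if "a > 0" for a
    using that powr_of_real[of a "Re p - 1"] by (simp add: norm_of_real_powr)
  thus ?thesis by (cases y) (auto simp: level_kernel_def)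
qed

lemma level_kernel_integrable:
  assumes p: "Re p > 0"
  shows "integrable (gauss_measure 1 \<Otimes>\<^sub>M lborel) (level_kernel k p)"
    and "integral\<^sup>L (gauss_measure 1 \<Otimes>\<^sub>M lborel) (level_kernel k p)
           = of_real (real (2 * k + 1)) powr (-p) / p * gauss_moment p"
proof -
  have m: "has_bochner_integral (gauss_measure 1) (\<lambda>z. complex_of_real \<bar>z\<bar> powr q) (gauss_moment q)" if "Re q > 0" for q
    using gauss_moment[of q] that by simp
  show int: "integrable (gauss_measure 1 \<Otimes>\<^sub>M lborel) (level_kernel k p)"
  proof (rule gauss_lborel.Fubini_integrable)
    have "complex_of_real (\<integral>a. norm (level_kernel k p (z, a)) \<partial>lborel)
       = of_real (real (2 * k + 1)) powr (- of_real (Re p)) / of_real (Re p) * (of_real \<bar>z\<bar> powr of_real (Re p))" for z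
      unfolding integral_complex_of_real[symmetric] norm_level_kernel
      using p by (intro integral_level_kernel_inner) simp
    moreover have "integrable (gauss_measure 1) (\<lambda>z. of_real (real (2 * k + 1)) powr (- of_real (Re p)) / of_real (Re p) * (complex_of_real \<bar>z\<bar> powr of_real (Re p)))"
      using m[of "of_real (Re p)"] p by (intro integrable_mult_right) (auto simp: has_bochner_integral_iff)
    ultimately have "integrable (gauss_measure 1) (\<lambda>z. complex_of_real (\<integral>a. norm (level_kernel k p (z, a)) \<partial>lborel))"
      by simp
    thus "integrable (gauss_measure 1) (\<lambda>z. \<integral>a. norm (level_kernel k p (z, a)) \<partial>lborel)"
      using integrable_Re by fastforce
  qed (use integral_level_kernel_inner(1)[OF p] in auto)
  have "integral\<^sup>L (gauss_measure 1 \<Otimes>\<^sub>M lborel) (level_kernel k p) = (\<integral>z. \<integral>a. level_kernel k p (z, a) \<partial>lborel \<partial>gauss_measure 1)"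
    by (rule gauss_lborel.integral_fst'[OF int, symmetric])
  also have "\<dots> = of_real (real (2 * k + 1)) powr (-p) / p * gauss_moment p"
    unfolding integral_level_kernel_inner(2)[OF p]
    using m[OF p] by (simp add: has_bochner_integral_iff)
  finally show "integral\<^sup>L (gauss_measure 1 \<Otimes>\<^sub>M lborel) (level_kernel k p)
           = of_real (real (2 * k + 1)) powr (-p) / p * gauss_moment p" .
qed

lemma sum_odd: "(\<Sum>k<h. 2 * (2 * k + 1)) = 2 * (h::nat)\<^sup>2"
  by (induction h) (auto simp: power2_eq_square)

lemma level_kernel_sums:
  assumes a: "a > 0"
  shows "(\<lambda>k. of_nat (2 * (2 * k + 1)) * level_kernel k p (z, a)) sums (of_real a powr (p - 1) * of_nat (bar_count a z))"
    and "summable (\<lambda>k. norm (of_nat (2 * (2 * k + 1)) * level_kernel k p (z, a)))"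
proof -
  define h where "h = (nat \<lfloor>\<bar>z\<bar> / a\<rfloor> + 1) div 2"
  have iff: "real (2 * k + 1) * a \<le> \<bar>z\<bar> \<longleftrightarrow> k < h" for k
  proof -
    have "real (2 * k + 1) * a \<le> \<bar>z\<bar> \<longleftrightarrow> real_of_int (int (2 * k + 1)) \<le> \<bar>z\<bar> / a"
      using a by (simp add: pos_le_divide_eq)
    also have "\<dots> \<longleftrightarrow> int (2 * k + 1) \<le> \<lfloor>\<bar>z\<bar> / a\<rfloor>" by (rule le_floor_iff[symmetric])
    also have "\<dots> \<longleftrightarrow> 2 * k + 1 \<le> nat \<lfloor>\<bar>z\<bar> / a\<rfloor>" by linarith
    also have "\<dots> \<longleftrightarrow> k < h" unfolding h_def by linarith
    finally show ?thesis .
  qed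
  have K: "level_kernel k p (z, a) = (if k < h then of_real a powr (p - 1) else 0)" for k
    using a unfolding level_kernel_def by (simp only: iff case_prod_conv simp_thms)
  have "(\<lambda>k. of_nat (2 * (2 * k + 1)) * level_kernel k p (z, a)) sums
      (\<Sum>k<h. of_nat (2 * (2 * k + 1)) * level_kernel k p (z, a))"
    by (rule sums_finite) (auto simp: K)
  also have "(\<Sum>k<h. of_nat (2 * (2 * k + 1)) * level_kernel k p (z, a)) = of_nat (\<Sum>k<h. 2 * (2 * k + 1)) * of_real a powr (p - 1)"
    unfolding of_nat_sum sum_distrib_right by (intro sum.cong refl) (simp add: K)
  also have "\<dots> = of_real a powr (p - 1) * of_nat (bar_count a z)"
    unfolding sum_odd bar_count_def h_def by (rule mult.commute)
  finally show "(\<lambda>k. of_nat (2 * (2 * k + 1)) * level_kernel k p (z, a)) sums (of_real a powr (p - 1) * of_nat (bar_count a z))" .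
  show "summable (\<lambda>k. norm (of_nat (2 * (2 * k + 1)) * level_kernel k p (z, a)))"
    by (rule summable_finite[of "{..<h}"]) (auto simp: K)
qed

text \<open>The terms are grouped in pairs, and the even ones, which are 2^(-s) times the whole
  series, are subtracted.\<close>

lemma odd_zeta_sums:
  assumes s: "Re s > 1"
  shows "(\<lambda>k. of_nat (2 * k + 1) powr (- s)) sums ((1 - 2 powr (- s)) * zeta_series s)"
proof -
  have all: "(\<lambda>n. of_nat (Suc n) powr (- s)) sums zeta_series s"
    using zeta_series_sums[OF s] by (simp add: powr_minus_divide)
  have "(\<lambda>k. \<Sum>n=k*2..<k*2+2. of_nat (Suc n) powr (- s)) sums zeta_series s"
    by (rule sums_group[OF all]) simp
  hence grp: "(\<lambda>k. of_nat (2 * k + 1) powr (- s) + of_nat (2 * k + 2) powr (- s)) sums zeta_series s"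
    by (simp add: sum.atLeast_Suc_lessThan numeral_2_eq_2 mult.commute add.commute del: of_nat_Suc of_nat_add of_nat_mult)
  have ev: "of_nat (2 * k + 2) powr (- s) = 2 powr (- s) * of_nat (Suc k) powr (- s)" for k
  proof -
    have "(of_nat (2 * k + 2) :: complex) = 2 * of_nat (Suc k)" by simp
    thus ?thesis by (simp only:) (rule powr_times_real; simp del: of_nat_Suc)
  qed
  have "(\<lambda>k. of_nat (2 * k + 2) powr (- s)) sums (2 powr (- s) * zeta_series s)"
    unfolding ev by (intro sums_mult all)
  from sums_diff[OF grp this] show ?thesis by (simp add: left_diff_distrib)
qed

lemma mean_bars_std_integral:
  assumes a: "a > 0"
  shows "integrable (gauss_measure 1) (\<lambda>z. real (bar_count a z))"
    and "(\<integral>z. real (bar_count a z) \<partial>gauss_measure 1) = mean_bars_std a"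
proof -
  have "(\<integral>\<^sup>+z. ennreal (real (bar_count a z)) \<partial>gauss_measure 1) = mean_bars 1 a"
    by (simp add: mean_bars_def ennreal_of_nat_eq_real_of_nat)
  moreover have "mean_bars 1 a < \<top>" using a by (intro mean_bars_finite) auto
  ultimately show int: "integrable (gauss_measure 1) (\<lambda>z. real (bar_count a z))"
    by (intro integrableI_nonneg) auto
  show "(\<integral>z. real (bar_count a z) \<partial>gauss_measure 1) = mean_bars_std a"
    unfolding mean_bars_std_def mean_bars_def using int
    by (subst integral_eq_nn_integral) (auto simp: ennreal_of_nat_eq_real_of_nat)
qed

text \<open>Level n carries the weight 2n and contributes a multiple of n^(1 - p). Absolute
  convergence over the odd n holds exactly for Re p > 2, which is where the condition on p
  originates.\<close>

lemma mean_bars_mellin: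
  assumes p: "Re p > 2"
  shows "set_integrable lborel {0<..} (\<lambda>a. of_real a powr (p - 1) * of_real (mean_bars_std a) :: complex)"
    and "p * (LBINT a:{0<..}. of_real a powr (p - 1) * of_real (mean_bars_std a))
           = 2 * (1 - 2 powr (1 - p)) * zeta_series (p - 1) * gauss_moment p"
proof -
  define P where "P = gauss_measure 1 \<Otimes>\<^sub>M (lborel :: real measure)"
  define f where "f k y = of_nat (2 * (2 * k + 1)) * level_kernel k p y" for k and y :: "real \<times> real"
  define H where "H = (\<lambda>(z, a). if 0 < a then of_real a powr (p - 1) * of_nat (bar_count a z) else (0::complex))"
  have p0: "Re p > 0" "p \<noteq> 0" using p by auto
  have sm: "summable (\<lambda>k. norm (f k y))" and sH: "(\<lambda>k. f k y) sums H y" for y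
  proof -
    obtain z a where y: "y = (z, a)" by (cases y)
    show "summable (\<lambda>k. norm (f k y))" "(\<lambda>k. f k y) sums H y"
    proof (atomize (full), cases "a > 0")
      case True
      thus "summable (\<lambda>k. norm (f k y)) \<and> (\<lambda>k. f k y) sums H y"
        using level_kernel_sums[OF True, of p z] by (simp add: f_def y H_def)
    next
      case False
      hence "f k y = 0" for k by (simp add: f_def y level_kernel_def)
      thus "summable (\<lambda>k. norm (f k y)) \<and> (\<lambda>k. f k y) sums H y" using False by (simp add: y H_def)
    qed
  qed
  have intf: "integrable P (f k)" for k
    unfolding f_def P_def by (intro integrable_mult_right level_kernel_integrable p0)
  have pw: "of_nat (2 * (2 * k + 1)) * (of_real (real (2 * k + 1)) powr (- q)) = 2 * of_nat (2 * k + 1) powr (- (q - 1))"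
    for k and q :: complex
  proof -
    have "(of_nat (2 * k + 1) :: complex) * of_nat (2 * k + 1) powr (- q) = of_nat (2 * k + 1) powr (1 + (- q))"
      by (subst powr_add) (simp add: powr_to_1)
    thus ?thesis by (simp only: of_nat_mult of_nat_numeral of_real_of_nat_eq mult.assoc) simp
  qed
  have intf_eq: "integral\<^sup>L P (f k) = of_nat (2 * k + 1) powr (- (p - 1)) * (2 * gauss_moment p / p)" for k
  proof -
    have "integral\<^sup>L P (f k) = of_nat (2 * (2 * k + 1)) * (of_real (real (2 * k + 1)) powr (-p) / p * gauss_moment p)"
      unfolding f_def P_def by (subst integral_mult_right_zero) (simp only: level_kernel_integrable(2)[OF p0(1)])
    also have "\<dots> = (of_nat (2 * (2 * k + 1)) * (of_real (real (2 * k + 1)) powr (-p))) * (gauss_moment p / p)"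
      by simp
    finally show ?thesis unfolding pw by simp
  qed
  have intn_eq: "complex_of_real (\<integral>y. norm (f k y) \<partial>P)
      = of_nat (2 * k + 1) powr (- (of_real (Re p) - 1)) * (2 * gauss_moment (of_real (Re p)) / of_real (Re p))" for k
  proof -
    have "complex_of_real (\<integral>y. norm (f k y) \<partial>P) = (\<integral>y. complex_of_real (norm (f k y)) \<partial>P)"
      by (rule integral_complex_of_real[symmetric])
    also have "\<dots> = (\<integral>y. of_nat (2 * (2 * k + 1)) * level_kernel k (of_real (Re p)) y \<partial>P)"
      unfolding f_def norm_mult norm_of_nat of_real_mult norm_level_kernel of_real_of_nat_eq ..
    also have "\<dots> = of_nat (2 * (2 * k + 1)) * (of_real (real (2 * k + 1)) powr (- of_real (Re p)) / of_real (Re p) * gauss_moment (of_real (Re p)))"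
      unfolding P_def using p0 by (subst integral_mult_right_zero, subst level_kernel_integrable(2)) auto
    also have "\<dots> = (of_nat (2 * (2 * k + 1)) * (of_real (real (2 * k + 1)) powr (- of_real (Re p)))) * (gauss_moment (of_real (Re p)) / of_real (Re p))"
      by simp
    finally show ?thesis unfolding pw by simp
  qed
  have "summable (\<lambda>k. complex_of_real (\<integral>y. norm (f k y) \<partial>P))"
    unfolding intn_eq using p
    by (intro summable_mult2 sums_summable[OF odd_zeta_sums]) simp
  hence sn: "summable (\<lambda>k. \<integral>y. norm (f k y) \<partial>P)"
    using summable_Re by fastforce
  have H_eq: "H = (\<lambda>y. \<Sum>k. f k y)" using sH by (auto simp: sums_iff)
  have intH: "integrable P H"
    unfolding H_eq by (rule integrable_suminf[OF intf _ sn]) (use sm in auto)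
  have "integral\<^sup>L P H = (\<Sum>k. integral\<^sup>L P (f k))"
    unfolding H_eq by (rule integral_suminf[OF intf _ sn]) (use sm in auto)
  also have "\<dots> = (1 - 2 powr (- (p - 1))) * zeta_series (p - 1) * (2 * gauss_moment p / p)"
    unfolding intf_eq using p by (intro sums_unique[symmetric] sums_mult2 odd_zeta_sums) simp
  finally have IH: "integral\<^sup>L P H = (1 - 2 powr (- (p - 1))) * zeta_series (p - 1) * (2 * gauss_moment p / p)" .
  have inner: "(\<integral>z. H (z, a) \<partial>gauss_measure 1) = indicator {0<..} a *\<^sub>R (of_real a powr (p - 1) * of_real (mean_bars_std a))" for a
  proof (cases "a > 0")
    case True
    have "(\<integral>z. H (z, a) \<partial>gauss_measure 1) = of_real a powr (p - 1) * (\<integral>z. complex_of_real (real (bar_count a z)) \<partial>gauss_measure 1)"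
      unfolding H_def using True by simp
    also have "(\<integral>z. complex_of_real (real (bar_count a z)) \<partial>gauss_measure 1) = of_real (mean_bars_std a)"
      by (subst integral_complex_of_real) (simp add: mean_bars_std_integral(2)[OF True])
    finally show ?thesis using True by simp
  qed (simp add: H_def)
  have intH': "integrable (gauss_measure 1 \<Otimes>\<^sub>M lborel) (\<lambda>(z, a). H (z, a))"
    using intH by (simp add: P_def)
  show "set_integrable lborel {0<..} (\<lambda>a. of_real a powr (p - 1) * of_real (mean_bars_std a) :: complex)"
    unfolding set_integrable_def inner[symmetric] by (rule gauss_lborel.integrable_snd[OF intH'])
  have "(LBINT a:{0<..}. of_real a powr (p - 1) * of_real (mean_bars_std a)) = integral\<^sup>L P H"
    unfolding set_lebesgue_integral_def inner[symmetric] P_def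
    using gauss_lborel.integral_snd[OF intH'] by simp
  thus "p * (LBINT a:{0<..}. of_real a powr (p - 1) * of_real (mean_bars_std a))
           = 2 * (1 - 2 powr (1 - p)) * zeta_series (p - 1) * gauss_moment p"
    using p0 by (simp add: IH)
qed

lemma mean_bars_std_antimono: "0 < a \<Longrightarrow> a \<le> b \<Longrightarrow> mean_bars_std b \<le> mean_bars_std a"
  unfolding mean_bars_std_def by (intro enn2real_mono mean_bars_antimono mean_bars_finite) auto

lemma mean_bars_std_nonneg: "0 \<le> mean_bars_std a"
  by (simp add: mean_bars_std_def)

section \<open>Divergence for Re p \<le> 2\<close>

lemma mean_bars_std_lower:
  obtains c where "c > 0" "\<And>a. 0 < a \<Longrightarrow> a \<le> 1 \<Longrightarrow> c / a\<^sup>2 \<le> mean_bars_std a"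
proof -
  define \<mu> where "\<mu> = measure (gauss_measure 1) {2..}"
  have "\<mu> > 0"
  proof -
    \<comment> \<open>The density on the unit interval [2, 3] is at least its value at 3, so this
      value bounds the tail beyond 2 from below.\<close>
    have "ennreal (normal_density 0 1 3) * emeasure lborel {2..3::real} = (\<integral>\<^sup>+z. ennreal (normal_density 0 1 3) * indicator {2..3::real} z \<partial>lborel)"
      by (rule nn_integral_cmult_indicator[symmetric]) simp
    also have "\<dots> \<le> (\<integral>\<^sup>+z. ennreal (normal_density 0 1 z) * indicator {2::real..} z \<partial>lborel)"
    proof (intro nn_integral_mono)
      fix z :: real
      have "normal_density 0 1 3 \<le> normal_density 0 1 z" if "2 \<le> z" "z \<le> 3"
      proof -
        have "z\<^sup>2 \<le> 3\<^sup>2" using that by (intro power_mono) auto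
        thus ?thesis unfolding normal_density_def by (intro mult_left_mono) auto
      qed
      thus "ennreal (normal_density 0 1 3) * indicator {2..3} z \<le> ennreal (normal_density 0 1 z) * indicator {2..} z"
        by (auto simp: indicator_def intro: ennreal_leI)
    qed
    also have "\<dots> = emeasure (gauss_measure 1) {2..}"
      by (rule emeasure_density[symmetric]) auto
    finally have "ennreal (normal_density 0 1 3) \<le> emeasure (gauss_measure 1) {2..}" by simp
    hence "ennreal (normal_density 0 1 3) \<le> ennreal \<mu>"
      by (simp add: \<mu>_def std_gauss.emeasure_eq_measure)
    moreover have "normal_density 0 1 3 > 0" by (rule normal_density_pos) simp
    ultimately show ?thesis by (smt (verit) ennreal_le_iff2)
  qed
  have "\<mu> / 2 / a\<^sup>2 \<le> mean_bars_std a" if a: "0 < a" "a \<le> 1" for a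
  proof -
    \<comment> \<open>With this \<open>h\<close>, (2h - 1) a is at most 1 + a and hence at most 2.
      Every z beyond 2 is therefore counted with at least 2 h^2, which is at least 1/(2
      a^2).\<close>
    define h where "h = nat \<lceil>1 / (2 * a)\<rceil>"
    have h: "1 / (2 * a) \<le> real h" "real h < 1 / (2 * a) + 1"
    proof -
      have "1 / (2 * a) > 0" using a by simp
      thus "1 / (2 * a) \<le> real h" "real h < 1 / (2 * a) + 1" unfolding h_def by linarith+
    qed
    have sq: "1 / (2 * a\<^sup>2) \<le> real (2 * h\<^sup>2)"
    proof -
      have "(1 / (2 * a))\<^sup>2 \<le> (real h)\<^sup>2" using h a by (intro power_mono) auto
      thus ?thesis by (simp add: power_divide power_mult_distrib field_simps)
    qed
    have "(2 * real h - 1) * a \<le> (1 / a + 1) * a"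
      using h a by (intro mult_right_mono) (auto simp: field_simps)
    also have "\<dots> \<le> 2" using a by (simp add: distrib_right)
    finally have ha: "(2 * real h - 1) * a \<le> 2" .
    have "\<mu> / 2 / a\<^sup>2 = (\<integral>z. 1 / (2 * a\<^sup>2) * indicator {2..} z \<partial>gauss_measure 1)"
      by (simp add: \<mu>_def)
    also have "\<dots> \<le> (\<integral>z. real (bar_count a z) \<partial>gauss_measure 1)"
    proof (rule integral_mono)
      show "integrable (gauss_measure 1) (\<lambda>z. 1 / (2 * a\<^sup>2) * indicator {2..} z :: real)"
        by (intro integrable_mult_right integrable_real_indicator) (auto simp: std_gauss.emeasure_eq_measure)
      show "integrable (gauss_measure 1) (\<lambda>z. real (bar_count a z))" by (rule mean_bars_std_integral[OF a(1)])
      fix z :: real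
      have "2 * h\<^sup>2 \<le> bar_count a z" if "z \<ge> 2"
        using that a ha by (intro bar_count_ge) auto
      hence "real (2 * h\<^sup>2) \<le> real (bar_count a z)" if "z \<ge> 2" using that of_nat_mono by blast
      with sq show "1 / (2 * a\<^sup>2) * indicator {2..} z \<le> real (bar_count a z)"
        by (cases "z \<ge> 2") auto
    qed
    also have "\<dots> = mean_bars_std a" by (rule mean_bars_std_integral[OF a(1)])
    finally show ?thesis .
  qed
  with \<open>\<mu> > 0\<close> show ?thesis by (intro that[of "\<mu> / 2"]) auto
qed

lemma inverse_not_integrable_at_0: "\<not> set_integrable lborel {0<..1} (\<lambda>a::real. 1 / a)"
proof
  assume int: "set_integrable lborel {0<..1} (\<lambda>a::real. 1 / a)"
  define I where "I = (LBINT a:{0<..1}. 1 / a :: real)"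
  \<comment> \<open>Makes the integral of 1/a over [\<delta>, 1] equal to |I| + 1, although it
    cannot exceed \<open>I\<close>.\<close>
  define \<delta> where "\<delta> = exp (- (\<bar>I\<bar> + 1))"
  have \<delta>: "0 < \<delta>" "\<delta> \<le> 1" by (auto simp: \<delta>_def)
  have sub: "set_integrable lborel {\<delta>..1} (\<lambda>a::real. 1 / a)"
    by (rule set_integrable_subset[OF int]) (use \<delta> in auto)
  have "((\<lambda>a. 1 / a) has_integral (ln 1 - ln \<delta>)) {\<delta>..1}"
    using \<delta> by (intro fundamental_theorem_of_calculus)
      (auto intro!: derivative_eq_intros simp flip: has_real_derivative_iff_has_vector_derivative)
  hence "(LBINT a:{\<delta>..1}. 1 / a) = \<bar>I\<bar> + 1"
    using set_borel_integral_eq_integral(2)[OF sub] by (simp add: integral_unique \<delta>_def)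
  moreover have "(LBINT a:{\<delta>..1}. 1 / a) \<le> I"
    unfolding I_def set_lebesgue_integral_def
    by (rule integral_mono) (use sub int \<delta> in \<open>auto simp: set_integrable_def indicator_def\<close>)
  ultimately show False by simp
qed

text \<open>Near 0 the mean is at least c/a^2, so for these p the norm of the integrand dominates
  c/a.\<close>

lemma mean_bars_std_mellin_diverges:
  assumes "Re p \<le> 2"
  shows "\<not> set_integrable lborel {0<..} (\<lambda>a. of_real a powr (p - 1) * of_real (mean_bars_std a) :: complex)"
proof
  assume "set_integrable lborel {0<..} (\<lambda>a. of_real a powr (p - 1) * of_real (mean_bars_std a) :: complex)"
  hence "set_integrable lborel {0<..} (\<lambda>a. norm (of_real a powr (p - 1) * of_real (mean_bars_std a) :: complex))"
    by (rule set_integrable_norm)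
  hence int: "set_integrable lborel {0<..1} (\<lambda>a. norm (of_real a powr (p - 1) * of_real (mean_bars_std a) :: complex))"
    by (rule set_integrable_subset) auto
  obtain c where c: "c > 0" "\<And>a. 0 < a \<Longrightarrow> a \<le> 1 \<Longrightarrow> c / a\<^sup>2 \<le> mean_bars_std a"
    using mean_bars_std_lower by blast
  have "c / a \<le> norm (of_real a powr (p - 1) * of_real (mean_bars_std a) :: complex)" if a: "0 < a" "a \<le> 1" for a
  proof -
    have "c / a = a powr 1 * (c / a\<^sup>2)" using a by (simp add: power2_eq_square)
    also have "\<dots> \<le> a powr (Re p - 1) * mean_bars_std a"
      using a assms c by (intro mult_mono powr_mono') auto
    finally show ?thesis using a mean_bars_std_nonneg[of a] by (simp add: norm_mult norm_of_real_powr)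
  qed
  moreover have "set_borel_measurable lborel {0<..1} (\<lambda>a. c / a)"
    unfolding set_borel_measurable_def by measurable
  ultimately have "set_integrable lborel {0<..1} (\<lambda>a. c / a)"
    using c(1) by (intro set_integrable_bound[OF int]) auto
  hence "set_integrable lborel {0<..1} (\<lambda>a. 1 / c * (c / a))" by (rule set_integrable_mult_right)
  thus False using c(1) inverse_not_integrable_at_0 by simp
qed

section \<open>The Mellin transform of the expected number of bars\<close>

context standard_brownian_motion
begin

context
  fixes t :: real
  assumes t: "t > 0"
begin

private abbreviation "E \<equiv> expected_bars M (\<lambda>s \<omega>. \<bar>B s \<omega>\<bar>) t"

text \<open>A point strictly between the two rescaled arguments separates them through the sandwich.
  The monotonicity is needed for Borel measurability in \<epsilon>.\<close>

lemma expected_bars_antimono: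
  assumes "0 < \<epsilon>1" "\<epsilon>1 \<le> \<epsilon>2" shows "E \<epsilon>2 \<le> E \<epsilon>1"
proof (cases "\<epsilon>1 = \<epsilon>2")
  case False
  define a where "a = (\<epsilon>1 + \<epsilon>2) / 2 / sqrt t"
  have st: "sqrt t > 0" using t by simp
  have a: "\<epsilon>1 / sqrt t < a" "a < \<epsilon>2 / sqrt t" "a > 0"
    unfolding a_def using assms False st by (intro divide_strict_right_mono divide_pos_pos; simp)+
  have half: "\<epsilon>1 / sqrt t / 2 < \<epsilon>1 / sqrt t"
  proof -
    have "x / 2 < x" if "x > 0" for x :: real using that by simp
    from this[OF divide_pos_pos[OF assms(1) st]] show ?thesis .
  qed
  have "E \<epsilon>2 \<le> mean_bars_std a"
    using assms a st by (intro expected_bars_sandwich(2)[OF t, where a'' = "\<epsilon>2 / sqrt t + 1"]) auto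
  also have "\<dots> \<le> E \<epsilon>1"
    using assms a st by (intro expected_bars_sandwich(1)[OF t _ _ half]) auto
  finally show ?thesis .
qed simp

text \<open>The monotone function \<open>mean_bars_std\<close> has at most countably many
  discontinuities on the positive half-line; at every other point the two sides of the sandwich
  meet.\<close>

lemma expected_bars_AE: "AE \<epsilon> in lborel. \<epsilon> > 0 \<longrightarrow> E \<epsilon> = mean_bars_std (\<epsilon> / sqrt t)"
proof -
  have st: "sqrt t > 0" using t by simp
  define C where "C = {a\<in>{0<..}. \<not> continuous (at a within {0<..}) (\<lambda>x. - mean_bars_std x)}"
  have "countable C"
    unfolding C_def by (intro mono_on_ctble_discont mono_onI) (auto intro: mean_bars_std_antimono)
  hence "countable ((\<lambda>a. a * sqrt t) ` C)" by simp
  hence "AE \<epsilon> in lborel. \<epsilon> \<notin> (\<lambda>a. a * sqrt t) ` C"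
    by (intro AE_not_in countable_imp_null_set_lborel)
  thus ?thesis
  proof eventually_elim
    case (elim \<epsilon>)
    show ?case
    proof
      assume \<epsilon>: "\<epsilon> > 0"
      define a where "a = \<epsilon> / sqrt t"
      have a: "a > 0" "\<epsilon> = a * sqrt t" using \<epsilon> st by (auto simp: a_def)
      have "a \<notin> C" using elim a by blast
      hence "continuous (at a within {0<..}) (\<lambda>x. - mean_bars_std x)" using a by (simp add: C_def)
      hence "continuous (at a within {0<..}) mean_bars_std"
        using continuous_minus[of "at a within {0<..}" "\<lambda>x. - mean_bars_std x"] by simp
      hence cont: "isCont mean_bars_std a"
        using a by (subst (asm) continuous_within_open) auto
      have "\<bar>E \<epsilon> - mean_bars_std a\<bar> < \<eta>" if \<eta>: "\<eta> > 0" for \<eta>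
      proof -
        from cont \<eta> obtain d where d: "d > 0" "\<And>x. \<bar>x - a\<bar> < d \<Longrightarrow> \<bar>mean_bars_std x - mean_bars_std a\<bar> < \<eta>"
          unfolding continuous_at_real_range by (auto simp: continuous_at_eps_delta dist_real_def)
        define h where "h = min (d / 2) (a / 2)"
        have h: "0 < h" "h < d" "h < a" using d a by (auto simp: h_def)
        have "mean_bars_std (a + h) \<le> E \<epsilon>" "E \<epsilon> \<le> mean_bars_std (a - h)"
          using h \<epsilon> by (intro expected_bars_sandwich[OF t \<epsilon>, of "a - h" "a + h"]; simp add: a_def)+
        moreover have "\<bar>mean_bars_std (a + h) - mean_bars_std a\<bar> < \<eta>" "\<bar>mean_bars_std (a - h) - mean_bars_std a\<bar> < \<eta>"
          using h by (intro d; simp)+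
        ultimately show ?thesis by linarith
      qed
      from this[of "\<bar>E \<epsilon> - mean_bars_std a\<bar>"] have "E \<epsilon> = mean_bars_std a" by force
      thus "E \<epsilon> = mean_bars_std (\<epsilon> / sqrt t)" by (simp add: a_def)
    qed
  qed
qed

lemma measurable_antimono_std:
  assumes "\<And>x y :: real. 0 < x \<Longrightarrow> x \<le> y \<Longrightarrow> f y \<le> (f x :: real)"
  shows "(\<lambda>x. indicator {0<..} x *\<^sub>R (complex_of_real x powr (p - 1) * of_real (f x))) \<in> borel_measurable lborel"
proof -
  have "(\<lambda>x. - f x) \<in> borel_measurable (restrict_space borel {0<..})"
    by (intro borel_measurable_mono_on_fnc mono_onI) (auto intro: assms)
  hence "(\<lambda>x. indicator {0<..} x *\<^sub>R (- f x)) \<in> borel_measurable borel"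
    by (subst (asm) borel_measurable_restrict_space_iff) auto
  hence [measurable]: "(\<lambda>x. - (indicator {0<..} x *\<^sub>R (- f x))) \<in> borel_measurable borel" by simp
  have "(\<lambda>x. complex_of_real x powr (p - 1) * of_real (- (indicator {0<..} x *\<^sub>R (- f x)))) \<in> borel_measurable lborel"
    by measurable
  moreover have "(\<lambda>x. complex_of_real x powr (p - 1) * of_real (- (indicator {0<..} x *\<^sub>R (- f x))))
      = (\<lambda>x. indicator {0<..} x *\<^sub>R (complex_of_real x powr (p - 1) * of_real (f x)))"
    by (auto simp: indicator_def)
  ultimately show ?thesis by simp
qed

text \<open>The affine change of variable \<epsilon> = s a with \<open>s = sqrt t\<close>, after
  \<open>E\<close> has been replaced by the Gaussian mean almost everywhere. The Jacobian s and s^(p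
  - 1) combine to s^p.\<close>

lemma expected_bars_mellin:
  shows "set_integrable lborel {0<..} (\<lambda>\<epsilon>. of_real \<epsilon> powr (p - 1) * of_real (E \<epsilon>) :: complex)
     \<longleftrightarrow> set_integrable lborel {0<..} (\<lambda>a. of_real a powr (p - 1) * of_real (mean_bars_std a) :: complex)"
    and "(LBINT \<epsilon>:{0<..}. of_real \<epsilon> powr (p - 1) * of_real (E \<epsilon>))
      = of_real (sqrt t) powr p * (LBINT a:{0<..}. of_real a powr (p - 1) * of_real (mean_bars_std a))"
proof -
  define s where "s = sqrt t"
  have s: "s > 0" using t by (simp add: s_def)
  define F where "F = (\<lambda>\<epsilon>. indicator {0<..} \<epsilon> *\<^sub>R (complex_of_real \<epsilon> powr (p - 1) * of_real (E \<epsilon>)))"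
  define G where "G = (\<lambda>\<epsilon>. indicator {0<..} \<epsilon> *\<^sub>R (complex_of_real \<epsilon> powr (p - 1) * of_real (mean_bars_std (\<epsilon> / s))))"
  define H where "H = (\<lambda>a. indicator {0<..} a *\<^sub>R (complex_of_real a powr (p - 1) * of_real (mean_bars_std a)))"
  have mF: "F \<in> borel_measurable lborel"
    unfolding F_def by (rule measurable_antimono_std) (rule expected_bars_antimono)
  have mG: "G \<in> borel_measurable lborel"
    unfolding G_def using s
    by (intro measurable_antimono_std mean_bars_std_antimono divide_right_mono) auto
  have FG: "AE \<epsilon> in lborel. F \<epsilon> = G \<epsilon>"
    using expected_bars_AE by eventually_elim (auto simp: F_def G_def s_def indicator_def)
  define K where "K = complex_of_real s powr (p - 1)"
  have K: "K \<noteq> 0" using s by (simp add: K_def)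
  have GH: "G (0 + s * a) = K * H a" for a
  proof (cases "a > 0")
    case True
    have "complex_of_real (s * a) powr (p - 1) = K * of_real a powr (p - 1)"
      unfolding K_def of_real_mult by (rule powr_times_real) (use s True in auto)
    thus ?thesis using s True by (simp add: G_def H_def)
  next
    case False
    hence "\<not> 0 < s * a" using s by (simp add: zero_less_mult_iff)
    thus ?thesis using False by (simp add: G_def H_def)
  qed
  have "integrable lborel F \<longleftrightarrow> integrable lborel G" by (rule integrable_cong_AE[OF mF mG FG])
  also have "\<dots> \<longleftrightarrow> integrable lborel (\<lambda>a. G (0 + s * a))"
    using s by (intro lborel_integrable_real_affine_iff[symmetric]) simp
  also have "\<dots> \<longleftrightarrow> integrable lborel H"
  proof
    assume "integrable lborel (\<lambda>a. G (0 + s * a))"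
    hence "integrable lborel (\<lambda>a. inverse K * (K * H a))" unfolding GH by (rule integrable_mult_right)
    thus "integrable lborel H" using K by (simp flip: mult.assoc)
  qed (unfold GH, rule integrable_mult_right)
  finally show "set_integrable lborel {0<..} (\<lambda>\<epsilon>. of_real \<epsilon> powr (p - 1) * of_real (E \<epsilon>) :: complex)
     \<longleftrightarrow> set_integrable lborel {0<..} (\<lambda>a. of_real a powr (p - 1) * of_real (mean_bars_std a) :: complex)"
    unfolding set_integrable_def F_def H_def .
  have "integral\<^sup>L lborel F = integral\<^sup>L lborel G" by (rule integral_cong_AE[OF mF mG FG])
  also have "\<dots> = \<bar>s\<bar> *\<^sub>R (\<integral>a. G (0 + s * a) \<partial>lborel)"
    using s by (intro lborel_integral_real_affine) simp
  also have "\<dots> = of_real s * K * integral\<^sup>L lborel H"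
    unfolding GH using s by (simp add: scaleR_conv_of_real)
  also have "of_real s * K = of_real s powr p"
    using s by (simp add: K_def powr_diff)
  finally show "(LBINT \<epsilon>:{0<..}. of_real \<epsilon> powr (p - 1) * of_real (E \<epsilon>))
      = of_real (sqrt t) powr p * (LBINT a:{0<..}. of_real a powr (p - 1) * of_real (mean_bars_std a))"
    unfolding set_lebesgue_integral_def F_def H_def s_def .
qed

lemma zeta_domain_abs: "zeta_domain M (\<lambda>s \<omega>. \<bar>B s \<omega>\<bar>) t = {p. Re p > 2}"
  unfolding zeta_domain_def expected_bars_mellin(1)
  using num_bars_integrable[OF t] mean_bars_mellin(1) mean_bars_std_mellin_diverges by force

lemma zeta_integral_abs:
  assumes "Re p > 2"
  shows "zeta_integral M (\<lambda>s \<omega>. \<bar>B s \<omega>\<bar>) t p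
    = of_real t powr (p / 2) * (2 * (1 - 2 powr (1 - p)) * zeta_series (p - 1) * gauss_moment p)"
proof -
  have "complex_of_real (sqrt t) powr p = of_real t powr (p / 2)"
    using t by (simp add: powr_def Ln_of_real ln_sqrt)
  moreover have "zeta_integral M (\<lambda>s \<omega>. \<bar>B s \<omega>\<bar>) t p
    = of_real (sqrt t) powr p * (p * (LBINT a:{0<..}. of_real a powr (p - 1) * of_real (mean_bars_std a)))"
    unfolding zeta_integral_def expected_bars_mellin(2) by simp
  ultimately show ?thesis using mean_bars_mellin(2)[OF assms] by simp
qed

end

end

section \<open>The closed form and its singularities\<close>

definition abs_zeta :: "real \<Rightarrow> complex \<Rightarrow> complex" where
  "abs_zeta t p = 2 powr (1 - p / 2) * (2 powr p - 2) * of_real t powr (p / 2) / of_real (sqrt pi)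
                * Gamma ((p + 1) / 2) * riemann_zeta (p - 1)"

text \<open>The entire part of the closed form: the poles of Gamma and of zeta are left to the
  denominators \<open>rGamma ((p + 1) / 2)\<close> and \<open>p - 2\<close>.\<close>

definition abs_zeta_numer :: "real \<Rightarrow> complex \<Rightarrow> complex" where
  "abs_zeta_numer t p = 2 powr (1 - p / 2) * (2 powr p - 2) * of_real t powr (p / 2) / of_real (sqrt pi) * reg_zeta (p - 1)"

lemma abs_zeta_eq: "abs_zeta t p = abs_zeta_numer t p / rGamma ((p + 1) / 2) / (p - 2)"
  by (simp add: abs_zeta_def abs_zeta_numer_def riemann_zeta_eq Gamma_def field_simps)

lemma abs_zeta_numer_holomorphic:
  assumes "t > 0" shows "abs_zeta_numer t holomorphic_on A"
proof -
  have "(\<lambda>p. reg_zeta (p - 1)) holomorphic_on A"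
    using holomorphic_on_compose[OF _ reg_zeta_holomorphic, of "\<lambda>p. p - 1" A]
    by (simp add: o_def holomorphic_intros)
  thus ?thesis unfolding abs_zeta_numer_def[abs_def] using assms by (intro holomorphic_intros) auto
qed

lemma abs_zeta_eq_mellin:
  assumes "Re p > 2"
  shows "abs_zeta t p = of_real t powr (p / 2) * (2 * (1 - 2 powr (1 - p)) * zeta_series (p - 1) * gauss_moment p)"
proof -
  have z: "riemann_zeta (p - 1) = zeta_series (p - 1)"
  proof -
    have "p - 2 \<noteq> 0" using assms by auto
    thus ?thesis using assms by (simp add: riemann_zeta_eq reg_zeta_eq_series)
  qed
  define q where "q = (2 :: complex) powr (p / 2)"
  have q: "q \<noteq> 0" by (simp add: q_def)
  have "p = p / 2 + p / 2" by simp
  hence p2: "2 powr p = q * q" unfolding q_def by (metis powr_add)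
  have "2 powr (1 - p / 2) * (2 powr p - 2) = 2 * (1 - 2 powr (1 - p)) * q"
    unfolding powr_diff q_def[symmetric] p2 using q by (simp add: field_simps)
  thus ?thesis unfolding abs_zeta_def gauss_moment_def z q_def by (simp add: mult_ac)
qed

lemma abs_zeta_analytic:
  assumes t: "t > 0" and "p \<noteq> 2" "(p + 1) / 2 \<notin> \<int>\<^sub>\<le>\<^sub>0"
  shows "abs_zeta t analytic_on {p}"
  unfolding abs_zeta_eq[abs_def]
proof (intro analytic_intros)
  show "abs_zeta_numer t analytic_on {p}"
    using abs_zeta_numer_holomorphic[OF t, of UNIV] by (simp add: analytic_on_holomorphic) blast
qed (use assms in \<open>auto simp: rGamma_eq_zero_iff\<close>)

lemma abs_zeta_meromorphic:
  assumes t: "t > 0" shows "abs_zeta t meromorphic_on UNIV"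
proof -
  have "abs_zeta_numer t analytic_on UNIV"
    using abs_zeta_numer_holomorphic[OF t, of UNIV] by (simp add: analytic_on_open)
  moreover have "(\<lambda>p. rGamma ((p + 1) / 2) :: complex) analytic_on UNIV"
    by (subst analytic_on_open) (auto intro!: holomorphic_intros)
  ultimately show ?thesis
    unfolding abs_zeta_eq[abs_def] by (intro meromorphic_intros analytic_on_imp_meromorphic_on)
qed

text \<open>Here p = -(2n + 1), so p - 1 is a trivial zero of zeta and meets the simple zero of
  \<open>rGamma\<close>. The limit is the quotient of the two derivatives, the lower one being
  nonzero.\<close>

lemma abs_zeta_no_pole:
  assumes t: "t > 0" and "(p + 1) / 2 \<in> \<int>\<^sub>\<le>\<^sub>0"
  shows "\<not> is_pole (abs_zeta t) p"
proof -
  from assms(2) obtain n where n: "(p + 1) / 2 = - of_nat n" by (elim nonpos_Ints_cases')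
  hence p: "p = - of_nat (2 * n + 1)" by (simp add: field_simps) (simp add: algebra_simps eq_neg_iff_add_eq_0)
  have p1: "p - 1 = - of_nat (2 * Suc n)" unfolding p by simp
  have p2: "p - 2 \<noteq> 0"
  proof
    assume "p - 2 = 0"
    hence "Re p = 2" by simp
    thus False unfolding p by simp
  qed
  define N where "N = (\<lambda>q. abs_zeta_numer t q / (q - 2))"
  define r where "r = (\<lambda>q::complex. rGamma ((q + 1) / 2))"
  have N0: "N p = 0" unfolding N_def abs_zeta_numer_def p1 reg_zeta_neg_even by simp
  have r0: "r p = 0" unfolding r_def n by (simp add: rGamma_eq_zero_iff)
  have "N field_differentiable at p"
    unfolding N_def using p2
    by (intro derivative_intros field_differentiable_divide holomorphic_on_imp_differentiable_at[OF abs_zeta_numer_holomorphic[OF t, of UNIV]]) auto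
  then obtain D where "(N has_field_derivative D) (at p)" by (auto simp: field_differentiable_def)
  hence N_lim: "((\<lambda>q. N q / (q - p)) \<longlongrightarrow> D) (at p)"
    by (simp add: has_field_derivative_iff N0)
  have "(rGamma has_field_derivative (-1) ^ n * fact n) (at ((p + 1) / 2 :: complex))"
    unfolding n by (rule has_field_derivative_rGamma_nonpos_int)
  hence "(r has_field_derivative ((-1) ^ n * fact n) * (1 / 2)) (at p)"
    unfolding r_def by (rule DERIV_chain2) (auto intro!: derivative_eq_intros)
  hence r_lim: "((\<lambda>q. r q / (q - p)) \<longlongrightarrow> ((-1) ^ n * fact n) * (1 / 2)) (at p)"
    by (simp add: has_field_derivative_iff r0)
  have "((\<lambda>q. (N q / (q - p)) / (r q / (q - p))) \<longlongrightarrow> D / (((-1) ^ n * fact n) * (1 / 2))) (at p)"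
    by (intro tendsto_divide N_lim r_lim) simp
  moreover have "\<forall>\<^sub>F q in at p. (N q / (q - p)) / (r q / (q - p)) = abs_zeta t q"
    unfolding eventually_at_filter by (auto simp: abs_zeta_eq N_def r_def mult_ac)
  ultimately have "(abs_zeta t \<longlongrightarrow> D / (((-1) ^ n * fact n) * (1 / 2))) (at p)"
    by (rule Lim_transform_eventually)
  thus ?thesis unfolding is_pole_def using not_tendsto_and_filterlim_at_infinity[of "at p"] by auto
qed

text \<open>Near 2 the function is h(p)/(p - 2) with h holomorphic. The values F(1) = 1 and
  Gamma(3/2) = sqrt(pi)/2 give h(2) = t, which is nonzero.\<close>

lemma abs_zeta_at_2:
  assumes t: "t > 0"
  shows "is_pole (abs_zeta t) 2" "residue (abs_zeta t) 2 = of_real t"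
proof -
  define h where "h = (\<lambda>p. abs_zeta_numer t p / rGamma ((p + 1) / 2))"
  define S where "S = {p :: complex. Re p > -1}"
  have S: "open S" "2 \<in> S" unfolding S_def by (auto simp: open_Re_greater)
  have h: "h holomorphic_on S"
  proof -
    have "rGamma ((p + 1) / 2) \<noteq> 0" if "p \<in> S" for p
    proof
      assume "rGamma ((p + 1) / 2) = 0"
      hence "(p + 1) / 2 \<in> \<int>\<^sub>\<le>\<^sub>0" by (simp add: rGamma_eq_zero_iff)
      then obtain n where "(p + 1) / 2 = - of_nat n" by (elim nonpos_Ints_cases')
      hence "Re ((p + 1) / 2) = - real n" by simp
      thus False using that by (simp add: S_def)
    qed
    thus ?thesis unfolding h_def by (intro holomorphic_intros abs_zeta_numer_holomorphic t) auto
  qed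
  have h2: "h 2 = of_real t"
  proof -
    have "Gamma (3 / 2 :: complex) = of_real (sqrt pi) / 2"
    proof -
      have "(1 / 2 :: complex) \<notin> \<int>\<^sub>\<le>\<^sub>0"
        using Gamma_eq_zero_iff[of "1 / 2 :: complex"] by (simp add: Gamma_one_half_complex)
      from Gamma_plus1[OF this] show ?thesis by (simp add: Gamma_one_half_complex)
    qed
    hence rG: "1 / rGamma (3 / 2 :: complex) = of_real (sqrt pi) / 2" by (simp add: Gamma_def inverse_eq_divide)
    have "h 2 = abs_zeta_numer t 2 * (1 / rGamma (3 / 2))" by (simp add: h_def)
    also have "abs_zeta_numer t 2 = 2 * of_real t / of_real (sqrt pi)"
      using t by (simp add: abs_zeta_numer_def reg_zeta_1 powr_numeral)
    finally show ?thesis unfolding rG by simp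
  qed
  have eq: "abs_zeta t = (\<lambda>p. h p / (p - 2))" by (auto simp: abs_zeta_eq h_def)
  show "residue (abs_zeta t) 2 = of_real t"
    unfolding eq using residue_simple[OF S h] h2 by simp
  have "isCont h 2" using h S by (metis holomorphic_on_imp_continuous_on continuous_on_eq_continuous_at)
  moreover have "filterlim (\<lambda>p. p - 2) (at 0) (at (2::complex))"
    by (intro filterlim_atI) (auto intro!: tendsto_eq_intros simp: eventually_at_filter)
  ultimately show "is_pole (abs_zeta t) 2"
    unfolding eq using h2 t by (intro is_pole_divide) auto
qed

theorem theorem4p11:
  fixes M :: "'a measure" and B :: "real \<Rightarrow> 'a \<Rightarrow> real" and t :: real
  assumes "standard_brownian_motion M B" and "t > 0"
  shows "let X = (\<lambda>s \<omega>. \<bar>B s \<omega>\<bar>); Z = process_zeta M X t in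
     zeta_domain M X t = {p. Re p > 2} \<and>
     (\<forall>p. Re p > 2 \<longrightarrow> Z p = zeta_integral M X t p) \<and>
     Z nicely_meromorphic_on UNIV \<and>
     (\<forall>p. p \<noteq> 2 \<and> (p + 1) / 2 \<notin> \<int>\<^sub>\<le>\<^sub>0 \<longrightarrow>
        Z p = 2 powr (1 - p / 2) * (2 powr p - 2) * of_real t powr (p / 2) / of_real (sqrt pi)
                * Gamma ((p + 1) / 2) * riemann_zeta (p - 1)) \<and>
     {p. is_pole Z p} = {2} \<and>
     residue Z 2 = of_real t"
proof -
  interpret standard_brownian_motion M B by (rule assms(1))
  note t = assms(2)
  define X where "X = (\<lambda>s \<omega>. \<bar>B s \<omega>\<bar>)"
  \<comment> \<open>At the poles of Gamma the closed form takes the value 0 by convention, which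
    need not be its limit there. Removing singularities inserts the limits and gives the normal form
    demanded of a continuation.\<close>
  define Z where "Z = remove_sings (abs_zeta t)"
  have mero: "abs_zeta t meromorphic_on UNIV" by (rule abs_zeta_meromorphic[OF t])
  have nice: "Z nicely_meromorphic_on UNIV"
    unfolding Z_def by (rule remove_sings_nicely_meromorphic[OF mero])
  have iso: "isolated_singularity_at (abs_zeta t) p" for p
    using mero by (simp add: meromorphic_on_altdef)
  have Z_eq: "Z p = abs_zeta t p" if "p \<noteq> 2" "(p + 1) / 2 \<notin> \<int>\<^sub>\<le>\<^sub>0" for p
    unfolding Z_def using abs_zeta_analytic[OF t that] by (rule remove_sings_at_analytic)
  have dom: "zeta_domain M X t = {p. Re p > 2}"
    unfolding X_def by (rule zeta_domain_abs[OF t])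
  have Z_int: "Z p = zeta_integral M X t p" if p: "Re p > 2" for p
  proof -
    have "(p + 1) / 2 \<notin> \<int>\<^sub>\<le>\<^sub>0"
    proof
      assume "(p + 1) / 2 \<in> \<int>\<^sub>\<le>\<^sub>0"
      then obtain n where "(p + 1) / 2 = - of_nat n" by (elim nonpos_Ints_cases')
      hence "Re ((p + 1) / 2) = - real n" by simp
      thus False using p by simp
    qed
    moreover have "p \<noteq> 2" using p by auto
    ultimately show ?thesis
      unfolding X_def zeta_integral_abs[OF t p] abs_zeta_eq_mellin[OF p, symmetric] by (intro Z_eq)
  qed
  have PZ: "process_zeta M X t = Z"
    unfolding process_zeta_def dom
  proof (rule meromorphic_continuation_eqI[OF nice])
    show "open {p. 2 < Re p}" by (rule open_Re_greater)
    have "(3 :: complex) \<in> {p. 2 < Re p}" by simp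
    thus "{p. 2 < Re p} \<noteq> {}" by blast
  qed (use Z_int in auto)
  have pole_iff: "is_pole Z p \<longleftrightarrow> is_pole (abs_zeta t) p" for p
    unfolding Z_def by (rule is_pole_remove_sings_iff[OF iso])
  have poles: "{p. is_pole Z p} = {2}"
  proof -
    have "\<not> is_pole (abs_zeta t) p" if "p \<noteq> 2" for p
    proof (cases "(p + 1) / 2 \<in> \<int>\<^sub>\<le>\<^sub>0")
      case True
      show ?thesis by (rule abs_zeta_no_pole[OF t True])
    next
      case False
      show ?thesis by (rule analytic_at_imp_no_pole[OF abs_zeta_analytic[OF t that False]])
    qed
    hence "is_pole Z p \<longleftrightarrow> p = 2" for p
      using abs_zeta_at_2(1)[OF t] pole_iff by metis
    thus ?thesis by simp
  qed
  have "residue Z 2 = residue (abs_zeta t) 2"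
    unfolding Z_def by (rule residue_cong[OF eventually_remove_sings_eq_at[OF iso] refl])
  hence res: "residue Z 2 = of_real t" using abs_zeta_at_2(2)[OF t] by simp
  have formula: "Z p = 2 powr (1 - p / 2) * (2 powr p - 2) * of_real t powr (p / 2) / of_real (sqrt pi)
                * Gamma ((p + 1) / 2) * riemann_zeta (p - 1)"
    if "p \<noteq> 2" "(p + 1) / 2 \<notin> \<int>\<^sub>\<le>\<^sub>0" for p
    unfolding Z_eq[OF that] abs_zeta_def ..
  show ?thesis
    unfolding Let_def X_def[symmetric] PZ
    using dom Z_int nice formula poles res by metis
qed

end
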